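(* Let $X$ be the spinor tenfold over $\mathbb{C}$. There is an exact sequence of vector bundles on $X$ $$0\longrightarrow\mathcal U^\vee\longrightarrow \mathbb V^{D_5}_{\omega_4}\otimes\mathcal O(1)\longrightarrow \mathbb V^{D_5}_{\omega_1}\otimes\mathcal U(2)\longrightarrow \mathbb V^{D_5}_{2\omega_1}\otimes\mathcal O(2)\longrightarrow \mathrm{Sym}^2\mathcal U^\vee(2)\longrightarrow 0 .$$
   Context: Work over $\mathbb{C}$. Let $V_{10}$ be a $10$-dimensional vector space with a nondegenerate symmetric bilinear form. The variety $OG(5,V_{10})$ of isotropic $5$-dimensional subspaces has two isomorphic connected components; $X=OG(5,V_{10})_+$ is one of them (the spinor tenfold), a smooth projective variety of dimension $10$. $\mathcal U$ is the restriction to $X$ of the rank $5$ tautological subbundle of the Grassmannian $G(5,V_{10})$. $\mathcal O(1)$ is the pullback of the hyperplane bundle under the spinor embedding $X\subset\mathbb P^{15}$; the Plücker line bundle of $G(5,V_{10})$ restricts to $\mathcal O(2)$. For a bundle $F$, $F(k)=F\otimes\mathcal O(k)$. $\mathbb V^{D_5}_{\lambda}$ denotes the irreducible representation of highest weight $\lambda$ of the simply connected simple group of type $D_5$ (Bourbaki numbering of fundamental weights), here regarded as a vector space: $\mathbb V^{D_5}_{\omega_1}\simeq V_{10}$ has dimension $10$, $\mathbb V^{D_5}_{\omega_4}$ is a half-spin representation of dimension $16$, and $\mathbb V^{D_5}_{2\omega_1}$ has dimension $54$, with $\mathrm{Sym}^2\mathbb V^{D_5}_{\omega_1}\simeq\mathbb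 V^{D_5}_{2\omega_1}\oplus\mathbb C$. *)

theory Defs
  imports "HOL-Analysis.Analysis" "HOL-Library.Function_Algebras"
begin

section \<open>Complex vector spaces\<close>

class complex_vector = ab_group_add +
  fixes scaleC :: "complex \<Rightarrow> 'a \<Rightarrow> 'a" (infixr \<open>*\<^sub>C\<close> 75)
  assumes scaleC_add_right: "a *\<^sub>C (x + y) = a *\<^sub>C x + a *\<^sub>C y"
    and scaleC_add_left: "(a + b) *\<^sub>C x = a *\<^sub>C x + b *\<^sub>C x"
    and scaleC_scaleC: "a *\<^sub>C b *\<^sub>C x = (a * b) *\<^sub>C x"
    and scaleC_one: "1 *\<^sub>C x = x"

global_interpretation complex_vector: vector_space "scaleC :: complex \<Rightarrow> 'a \<Rightarrow> 'a::complex_vector"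
  by unfold_locales (simp_all add: scaleC_add_right scaleC_add_left scaleC_scaleC scaleC_one)

instantiation complex :: complex_vector
begin
definition scaleC_complex :: "complex \<Rightarrow> complex \<Rightarrow> complex"
  where "scaleC_complex a x = a * x"
instance by standard (simp_all add: scaleC_complex_def algebra_simps)
end

instantiation "fun" :: (type, complex_vector) complex_vector
begin
definition scaleC_fun :: "complex \<Rightarrow> ('a \<Rightarrow> 'b) \<Rightarrow> 'a \<Rightarrow> 'b"
  where "scaleC_fun a f = (\<lambda>x. a *\<^sub>C f x)"
instance
  by standard
    (simp_all add: scaleC_fun_def plus_fun_def scaleC_add_right scaleC_add_left scaleC_scaleC scaleC_one)
end

abbreviation csubspace :: "'a::complex_vector set \<Rightarrow> bool"
  where "csubspace \<equiv> complex_vector.subspace"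

abbreviation cspan :: "'a::complex_vector set \<Rightarrow> 'a set"
  where "cspan \<equiv> complex_vector.span"

abbreviation cindependent :: "'a::complex_vector set \<Rightarrow> bool"
  where "cindependent \<equiv> complex_vector.independent"

abbreviation cdim :: "'a::complex_vector set \<Rightarrow> nat"
  where "cdim \<equiv> complex_vector.dim"

abbreviation clinear :: "('a::complex_vector \<Rightarrow> 'b::complex_vector) \<Rightarrow> bool"
  where "clinear \<equiv> Vector_Spaces.linear scaleC scaleC"

definition clinear_on :: "'a::complex_vector set \<Rightarrow> ('a \<Rightarrow> 'b::complex_vector) \<Rightarrow> bool"
  where "clinear_on A f \<longleftrightarrow>
    (\<forall>x\<in>A. \<forall>y\<in>A. f (x + y) = f x + f y) \<and> (\<forall>a. \<forall>x\<in>A. f (a *\<^sub>C x) = a *\<^sub>C f x)"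

definition cbilinear :: "('a::complex_vector \<Rightarrow> 'b::complex_vector \<Rightarrow> 'c::complex_vector) \<Rightarrow> bool"
  where "cbilinear f \<longleftrightarrow> (\<forall>x. clinear (f x)) \<and> (\<forall>y. clinear (\<lambda>x. f x y))"

text \<open>A linear form on a subspace is represented by its extension by \<open>0\<close>; the dual of a subspace
  is thus itself a subspace of a function space.\<close>

definition dual_space :: "'a::complex_vector set \<Rightarrow> ('a \<Rightarrow> complex) set"
  where "dual_space A = {f. clinear_on A f \<and> (\<forall>x. x \<notin> A \<longrightarrow> f x = 0)}"

text \<open>The vector \<open>x \<otimes> y\<close> is represented as evaluation at \<open>(x, y)\<close> on bilinear forms. Since bilinear
  forms separate tensors and extend from subspaces, the span of the \<open>x \<otimes> y\<close> with \<open>x \<in> A\<close> and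
  \<open>y \<in> B\<close> is the tensor product of the subspaces \<open>A\<close> and \<open>B\<close>.\<close>

type_synonym ('a, 'b) tensor = "('a \<Rightarrow> 'b \<Rightarrow> complex) \<Rightarrow> complex"

definition tens :: "'a::complex_vector \<Rightarrow> 'b::complex_vector \<Rightarrow> ('a, 'b) tensor"
  where "tens x y = (\<lambda>\<beta>. if cbilinear \<beta> then \<beta> x y else 0)"

definition tensor_space :: "'a::complex_vector set \<Rightarrow> 'b::complex_vector set \<Rightarrow> ('a, 'b) tensor set"
  where "tensor_space A B = cspan {tens x y | x y. x \<in> A \<and> y \<in> B}"

text \<open>Symmetric squares are realised as symmetric tensors (the characteristic is \<open>0\<close>).\<close>

definition sym2_space :: "'a::complex_vector set \<Rightarrow> ('a, 'a) tensor set"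
  where "sym2_space A = cspan {tens x x | x. x \<in> A}"


section \<open>Varieties and algebraic vector bundles\<close>

text \<open>A classical variety: a topological space with a sheaf of complex-valued regular functions.
  Here and for sections of bundles, functions are total, and membership over an open set \<open>W\<close> is
  meant to depend only on the values on \<open>W\<close>.\<close>

record 'x variety =
  zariski :: "'x topology"
  regular :: "'x set \<Rightarrow> ('x \<Rightarrow> complex) set"

record ('x, 'a) vbundle =
  fibre :: "'x \<Rightarrow> 'a set"
  sections :: "'x set \<Rightarrow> ('x \<Rightarrow> 'a) set"

text \<open>The sections form a sheaf, locally free of finite rank over the regular functions, and a local
  basis of sections restricts to a basis of every fibre.\<close>

definition vector_bundle :: "'x variety \<Rightarrow> ('x, 'a::complex_vector) vbundle \<Rightarrow> bool"
  where "vector_bundle M E \<longleftrightarrow>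
    (\<forall>W W' s. openin (zariski M) W \<and> openin (zariski M) W' \<and> W' \<subseteq> W \<and> s \<in> sections E W
        \<longrightarrow> s \<in> sections E W') \<and>
    (\<forall>W s. openin (zariski M) W \<and>
        (\<forall>x\<in>W. \<exists>N. openin (zariski M) N \<and> x \<in> N \<and> N \<subseteq> W \<and> s \<in> sections E N)
        \<longrightarrow> s \<in> sections E W) \<and>
    (\<forall>x\<in>topspace (zariski M). \<exists>N (n::nat) e. openin (zariski M) N \<and> x \<in> N \<and>
        (\<forall>y\<in>N. inj_on (\<lambda>i. e i y) {..<n} \<and> cindependent ((\<lambda>i. e i y) ` {..<n}) \<and>
                cspan ((\<lambda>i. e i y) ` {..<n}) = fibre E y) \<and>
        (\<forall>W s. openin (zariski M) W \<and> W \<subseteq> N \<longrightarrow>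
           (s \<in> sections E W \<longleftrightarrow>
             (\<exists>a. (\<forall>i<n. a i \<in> regular M W) \<and> (\<forall>y\<in>W. s y = (\<Sum>i<n. a i y *\<^sub>C e i y))))))"

definition bundle_morphism ::
    "'x variety \<Rightarrow> ('x, 'a::complex_vector) vbundle \<Rightarrow> ('x, 'b::complex_vector) vbundle \<Rightarrow>
     ('x \<Rightarrow> 'a \<Rightarrow> 'b) \<Rightarrow> bool"
  where "bundle_morphism M E F \<phi> \<longleftrightarrow>
    (\<forall>x\<in>topspace (zariski M). clinear_on (fibre E x) (\<phi> x) \<and> \<phi> x ` fibre E x \<subseteq> fibre F x) \<and>
    (\<forall>W s. openin (zariski M) W \<and> s \<in> sections E W \<longrightarrow> (\<lambda>x. \<phi> x (s x)) \<in> sections F W)"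

text \<open>Exactness of \<open>E \<rightarrow> F \<rightarrow> G\<close> at \<open>F\<close>, fibre by fibre. For a bounded sequence ending in \<open>0\<close>, as
  below, this is the same as exactness of the sequence of locally free sheaves of sections.\<close>

definition exact_at ::
    "'x variety \<Rightarrow> ('x, 'a::complex_vector) vbundle \<Rightarrow> ('x \<Rightarrow> 'a \<Rightarrow> 'b) \<Rightarrow>
     ('x, 'b::complex_vector) vbundle \<Rightarrow> ('x \<Rightarrow> 'b \<Rightarrow> 'c::complex_vector) \<Rightarrow> bool"
  where "exact_at M E \<phi> F \<psi> \<longleftrightarrow>
    (\<forall>x\<in>topspace (zariski M). \<phi> x ` fibre E x = {v \<in> fibre F x. \<psi> x v = 0})"

definition exact_sequence5 ::
    "'x variety \<Rightarrow>
     ('x, 'a::complex_vector) vbundle \<Rightarrow> ('x \<Rightarrow> 'a \<Rightarrow> 'b) \<Rightarrow>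
     ('x, 'b::complex_vector) vbundle \<Rightarrow> ('x \<Rightarrow> 'b \<Rightarrow> 'c) \<Rightarrow>
     ('x, 'c::complex_vector) vbundle \<Rightarrow> ('x \<Rightarrow> 'c \<Rightarrow> 'd) \<Rightarrow>
     ('x, 'd::complex_vector) vbundle \<Rightarrow> ('x \<Rightarrow> 'd \<Rightarrow> 'e) \<Rightarrow>
     ('x, 'e::complex_vector) vbundle \<Rightarrow> bool"
  where "exact_sequence5 M E1 \<phi>1 E2 \<phi>2 E3 \<phi>3 E4 \<phi>4 E5 \<longleftrightarrow>
    vector_bundle M E1 \<and> vector_bundle M E2 \<and> vector_bundle M E3 \<and>
    vector_bundle M E4 \<and> vector_bundle M E5 \<and>
    bundle_morphism M E1 E2 \<phi>1 \<and> bundle_morphism M E2 E3 \<phi>2 \<and>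
    bundle_morphism M E3 E4 \<phi>3 \<and> bundle_morphism M E4 E5 \<phi>4 \<and>
    (\<forall>x\<in>topspace (zariski M). inj_on (\<phi>1 x) (fibre E1 x)) \<and>
    exact_at M E1 \<phi>1 E2 \<phi>2 \<and> exact_at M E2 \<phi>2 E3 \<phi>3 \<and> exact_at M E3 \<phi>3 E4 \<phi>4 \<and>
    (\<forall>x\<in>topspace (zariski M). \<phi>4 x ` fibre E4 x = fibre E5 x)"

text \<open>Intended for finite-dimensional \<open>A\<close>.\<close>

definition trivial_bundle :: "'x variety \<Rightarrow> 'a::complex_vector set \<Rightarrow> ('x, 'a) vbundle"
  where "trivial_bundle M A =
    \<lparr>fibre = (\<lambda>_. A),
     sections = (\<lambda>W. {s. (\<forall>x\<in>W. s x \<in> A) \<and>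
       (\<forall>l::'a \<Rightarrow> complex. clinear l \<longrightarrow> (\<lambda>x. l (s x)) \<in> regular M W)})\<rparr>"

definition sub_bundle :: "('x, 'a) vbundle \<Rightarrow> ('x \<Rightarrow> 'a set) \<Rightarrow> ('x, 'a) vbundle"
  where "sub_bundle E F =
    \<lparr>fibre = F, sections = (\<lambda>W. {s \<in> sections E W. \<forall>x\<in>W. s x \<in> F x})\<rparr>"

definition dual_bundle ::
    "'x variety \<Rightarrow> ('x, 'a::complex_vector) vbundle \<Rightarrow> ('x, 'a \<Rightarrow> complex) vbundle"
  where "dual_bundle M E =
    \<lparr>fibre = (\<lambda>x. dual_space (fibre E x)),
     sections = (\<lambda>W. {f. (\<forall>x\<in>W. f x \<in> dual_space (fibre E x)) \<and>
       (\<forall>W' s. openin (zariski M) W' \<and> W' \<subseteq> W \<and> s \<in> sections E W'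
          \<longrightarrow> (\<lambda>x. f x (s x)) \<in> regular M W')})\<rparr>"

definition tensor_bundle ::
    "'x variety \<Rightarrow> ('x, 'a::complex_vector) vbundle \<Rightarrow> ('x, 'b::complex_vector) vbundle \<Rightarrow>
     ('x, ('a, 'b) tensor) vbundle"
  where "tensor_bundle M E F =
    \<lparr>fibre = (\<lambda>x. tensor_space (fibre E x) (fibre F x)),
     sections = (\<lambda>W. {t. \<forall>x\<in>W. \<exists>N (n::nat) e f. openin (zariski M) N \<and> x \<in> N \<and> N \<subseteq> W \<and>
       (\<forall>i<n. e i \<in> sections E N \<and> f i \<in> sections F N) \<and>
       (\<forall>y\<in>N. t y = (\<Sum>i<n. tens (e i y) (f i y)))})\<rparr>"

definition sym2_bundle ::
    "'x variety \<Rightarrow> ('x, 'a::complex_vector) vbundle \<Rightarrow> ('x, ('a, 'a) tensor) vbundle"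
  where "sym2_bundle M E = sub_bundle (tensor_bundle M E E) (\<lambda>x. sym2_space (fibre E x))"


section \<open>The Grassmannian of \<open>5\<close>-dimensional subspaces\<close>

inductive homogeneous :: "nat \<Rightarrow> ('a::complex_vector \<Rightarrow> complex) \<Rightarrow> bool"
  where
    homogeneous_const: "homogeneous 0 (\<lambda>_. a)"
  | homogeneous_linear: "clinear l \<Longrightarrow> homogeneous 1 l"
  | homogeneous_add: "homogeneous d p \<Longrightarrow> homogeneous d q \<Longrightarrow> homogeneous d (\<lambda>x. p x + q x)"
  | homogeneous_mult: "homogeneous d p \<Longrightarrow> homogeneous d' q \<Longrightarrow> homogeneous (d + d') (\<lambda>x. p x * q x)"

definition grassmannian5 :: "'v::complex_vector set set"
  where "grassmannian5 = {U. csubspace U \<and> cdim U = 5}"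

definition frames5 :: "'v::complex_vector set \<Rightarrow> (5 \<Rightarrow> 'v) set"
  where "frames5 U = {u. inj u \<and> cindependent (range u) \<and> cspan (range u) = U}"

text \<open>The vector \<open>u\<^sub>1 \<and> \<dots> \<and> u\<^sub>5\<close>, represented by its coordinates
  \<open>(l\<^sub>1 \<and> \<dots> \<and> l\<^sub>5)(u\<^sub>1 \<and> \<dots> \<and> u\<^sub>5)\<close> for all \<open>5\<close>-tuples of linear forms.\<close>

definition pluecker :: "(5 \<Rightarrow> 'v::complex_vector) \<Rightarrow> (5 \<Rightarrow> 'v \<Rightarrow> complex) \<Rightarrow> complex"
  where "pluecker u = (\<lambda>l. if \<forall>i. clinear (l i) then det (\<chi> i j. l i (u j)) else 0)"

text \<open>Principal open sets of the Pluecker embedding; whether a homogeneous polynomial vanishes at a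
  point does not depend on the frame.\<close>

definition grassmannian5_top :: "'v::complex_vector set topology"
  where "grassmannian5_top = topology_generated_by
    {{U \<in> grassmannian5. \<forall>u\<in>frames5 U. P (pluecker u) \<noteq> 0} | P d. homogeneous d P}"

text \<open>A (locally closed) subset of the Grassmannian as a reduced variety: regular functions are
  locally quotients of homogeneous polynomials of equal degree in the Pluecker coordinates.\<close>

definition subvariety5 :: "'v::complex_vector set set \<Rightarrow> 'v set variety"
  where "subvariety5 X =
    \<lparr>zariski = subtopology grassmannian5_top X,
     regular = (\<lambda>W. {f. \<forall>x\<in>W. \<exists>N d P Q.
       openin (subtopology grassmannian5_top X) N \<and> x \<in> N \<and> N \<subseteq> W \<and>
       homogeneous d P \<and> homogeneous d Q \<and>
       (\<forall>y\<in>N. \<forall>u\<in>frames5 y. Q (pluecker u) \<noteq> 0 \<and> f y = P (pluecker u) / Q (pluecker u))})\<rparr>"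

definition tautological :: "'v::complex_vector set set \<Rightarrow> ('v set, 'v) vbundle"
  where "tautological X = sub_bundle (trivial_bundle (subvariety5 X) UNIV) (\<lambda>U. U)"


section \<open>The spinor tenfold\<close>

definition nondegenerate_symmetric :: "('v::complex_vector \<Rightarrow> 'v \<Rightarrow> complex) \<Rightarrow> bool"
  where "nondegenerate_symmetric B \<longleftrightarrow>
    cbilinear B \<and> (\<forall>v w. B v w = B w v) \<and> (\<forall>v. (\<forall>w. B v w = 0) \<longrightarrow> v = 0)"

definition OG5 :: "('v::complex_vector \<Rightarrow> 'v \<Rightarrow> complex) \<Rightarrow> 'v set set"
  where "OG5 B = {U \<in> grassmannian5. \<forall>v\<in>U. \<forall>w\<in>U. B v w = 0}"

definition spinor_tenfold :: "('v::complex_vector \<Rightarrow> 'v \<Rightarrow> complex) \<Rightarrow> 'v set set \<Rightarrow> bool"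
  where "spinor_tenfold B X \<longleftrightarrow>
    X \<in> connected_components_of (subtopology grassmannian5_top (OG5 B))"

text \<open>The spin module of a \<open>10\<close>-dimensional quadratic space: the \<open>32\<close>-dimensional Clifford module
  (unique up to isomorphism, the Clifford algebra being the algebra of \<open>32 \<times> 32\<close> matrices) with
  its decomposition into the two half-spin modules, which are exchanged by Clifford multiplication
  \<open>c v\<close> with vectors \<open>v\<close>.\<close>

definition spin_module ::
    "('v::complex_vector \<Rightarrow> 'v \<Rightarrow> complex) \<Rightarrow> ('v \<Rightarrow> 's::complex_vector \<Rightarrow> 's) \<Rightarrow> 's set \<Rightarrow> 's set \<Rightarrow> bool"
  where "spin_module B c Sp Sm \<longleftrightarrow>
    cbilinear c \<and> (\<forall>v s. c v (c v s) = B v v *\<^sub>C s) \<and>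
    csubspace Sp \<and> csubspace Sm \<and> cdim Sp = 16 \<and> cdim Sm = 16 \<and>
    Sp \<inter> Sm = {0} \<and> (\<forall>s. \<exists>p\<in>Sp. \<exists>m\<in>Sm. s = p + m) \<and>
    (\<forall>v. c v ` Sp \<subseteq> Sm) \<and> (\<forall>v. c v ` Sm \<subseteq> Sp)"

text \<open>The spinor embedding sends \<open>U\<close> to its line of pure spinors, i.e. the spinors annihilated by
  \<open>U\<close>; on each component of \<open>OG5 B\<close> this line lies in a fixed half-spin module. Hence the pullbacks
  of the tautological line bundle and of the hyperplane bundle of \<open>\<P>\<^sup>1\<^sup>5\<close> are as follows.\<close>

definition pure_spinors :: "('v \<Rightarrow> 's::complex_vector \<Rightarrow> 's) \<Rightarrow> 'v set \<Rightarrow> 's set"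
  where "pure_spinors c U = {s. \<forall>v\<in>U. c v s = 0}"

definition O_minus1 ::
    "('v::complex_vector \<Rightarrow> 's::complex_vector \<Rightarrow> 's) \<Rightarrow> 'v set set \<Rightarrow> ('v set, 's) vbundle"
  where "O_minus1 c X = sub_bundle (trivial_bundle (subvariety5 X) UNIV) (pure_spinors c)"

definition O_1 ::
    "('v::complex_vector \<Rightarrow> 's::complex_vector \<Rightarrow> 's) \<Rightarrow> 'v set set \<Rightarrow> ('v set, 's \<Rightarrow> complex) vbundle"
  where "O_1 c X = dual_bundle (subvariety5 X) (O_minus1 c X)"

definition O_2 ::
    "('v::complex_vector \<Rightarrow> 's::complex_vector \<Rightarrow> 's) \<Rightarrow> 'v set set \<Rightarrow>
     ('v set, ('s \<Rightarrow> complex, 's \<Rightarrow> complex) tensor) vbundle"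
  where "O_2 c X = tensor_bundle (subvariety5 X) (O_1 c X) (O_1 c X)"

text \<open>The irreducible module of highest weight \<open>2\<omega>\<^sub>1\<close> is the trace-free part of the symmetric square
  of the vector representation: the value of a tensor at \<open>B\<close> is its contraction with \<open>B\<close>.\<close>

definition V_2omega1 :: "('v::complex_vector \<Rightarrow> 'v \<Rightarrow> complex) \<Rightarrow> ('v, 'v) tensor set"
  where "V_2omega1 B = {t \<in> sym2_space UNIV. t B = 0}"

end

theory Submission
  imports Defs
begin

text \<open>Let \<open>\<ell>\<close> be the line of pure spinors of \<open>U\<close>, spanned by
  \<open>s\<close>. The last map restricts a symmetric tensor along \<open>V \<rightarrow> V/U =
  U\<^sup>\<or>\<close>; its kernel is the trace-free part of \<open>U \<cdot> V\<close>, onto which \<open>V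
  \<otimes> U\<close> projects. Clifford multiplication \<open>v \<mapsto> c v s\<close> has kernel
  \<open>U\<close> and gives the first map. The second one uses an invariant pairing \<open>\<beta>\<close> of
  spinors: \<open>\<sigma>\<close> is sent to the bilinear form \<open>(v, w) \<mapsto> \<beta> (c w s) (c v
  \<sigma>)\<close>, which vanishes for \<open>w \<in> U\<close> and hence is an element of \<open>V \<otimes>
  U\<close>; by the Clifford relation its symmetric part is a multiple of \<open>B\<close>, and all such
  elements arise. Its kernel is read off from the filtration of the half-spin modules by the number of Clifford
  factors applied to \<open>s\<close>. Over the big cell of subspaces complementary to a fixed one,
  \<open>U\<close> has a frame \<open>u\<^sub>i\<close> with coordinates quotients of Pluecker coordinates, and
  \<open>s = c u\<^sub>1 (\<dots> (c u\<^sub>5 \<omega>))\<close> is a regular section of \<open>\<ell>\<close>,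
  so all maps are regular.\<close>

text \<open>No representation theory of \<open>D_5\<close> enters: every kernel and image is
  computed by hand in one fibre, with a hyperbolic basis adapted to \<open>U\<close>. The twists are
  dictated by homogeneity. They make each of the four expressions of degree zero in the chosen
  spinor, so maps defined through an arbitrary spinor at each point do not depend on it, and near
  any point the choice may be replaced by a regular spinor. This is how pointwise definitions by
  \<open>SOME\<close> become bundle morphisms. Two obstacles shape the rest. \<open>V_omega4\<close>
  may be either half-spin module, whatever the component \<open>X\<close> is; a constant unit vector
  exchanges the halves where necessary. And no pairing of spinors is given: an invariant form is
  found as a joint eigenvector of finitely many commuting involutions, and its nondegeneracy is
  deduced from the way products of vectors act on a pure spinor.\<close>

interpretation complex_vector_pair: vector_space_pair
  "scaleC :: complex \<Rightarrow> 'a \<Rightarrow> 'a::complex_vector" "scaleC :: complex \<Rightarrow> 'b \<Rightarrow> 'b::complex_vector"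
  ..

lemma scaleC_complex [simp]: "a *\<^sub>C (x::complex) = a * x"
  by (simp add: scaleC_complex_def)

lemma scaleC_fun_apply [simp]: "(a *\<^sub>C f) x = a *\<^sub>C f x"
  by (simp add: scaleC_fun_def)

lemma sum_fun_apply: "(\<Sum>i\<in>A. f i) x = (\<Sum>i\<in>A. f i x)"
  by (induction A rule: infinite_finite_induct) auto

lemmas scaleC_simps [simp] = scaleC_scaleC scaleC_one
  complex_vector.scale_zero_left complex_vector.scale_zero_right
  complex_vector.scale_minus_left complex_vector.scale_minus_right

lemmas scaleC_algebra = scaleC_add_right scaleC_add_left
  complex_vector.scale_right_diff_distrib complex_vector.scale_left_diff_distrib

section \<open>Linear and bilinear maps of complex vector spaces\<close>

lemma clinear_iff:
  "clinear f \<longleftrightarrow> (\<forall>x y. f (x + y) = f x + f y) \<and> (\<forall>a x. f (a *\<^sub>C x) = a *\<^sub>C f x)"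
  using complex_vector.vector_space_axioms[where 'a='a] complex_vector.vector_space_axioms[where 'a='b]
  by (simp add: Vector_Spaces.linear_iff)

lemma clinearI:
  assumes "\<And>x y. f (x + y) = f x + f y" "\<And>a x. f (a *\<^sub>C x) = a *\<^sub>C f x"
  shows "clinear f"
  using assms by (simp add: clinear_iff)

lemmas clinear_add = complex_vector_pair.linear_add
  and clinear_scale = complex_vector_pair.linear_scale
  and clinear_sum = complex_vector_pair.linear_sum
  and clinear_diff = complex_vector_pair.linear_diff
  and clinear_neg = complex_vector_pair.linear_neg
  and clinear_0 = complex_vector_pair.linear_0

lemma clinear_compose: "clinear f \<Longrightarrow> clinear g \<Longrightarrow> clinear (\<lambda>x. g (f x))"
  by (simp add: clinear_iff)

lemma clinear_mult_left: "clinear f \<Longrightarrow> clinear (\<lambda>x. z * f x :: complex)"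
  by (simp add: clinear_iff algebra_simps)

lemma clinear_mult_right: "clinear f \<Longrightarrow> clinear (\<lambda>x. f x * z :: complex)"
  by (simp add: clinear_iff algebra_simps)

lemma clinear_scaleC_const: "clinear f \<Longrightarrow> clinear (\<lambda>x. f x *\<^sub>C z)"
  by (simp add: clinear_iff scaleC_algebra)

lemma clinear_const_scaleC: "clinear f \<Longrightarrow> clinear (\<lambda>x. z *\<^sub>C f x)"
  by (simp add: clinear_iff scaleC_algebra mult.commute)

lemma clinear_sum_fun: "(\<And>i. i \<in> I \<Longrightarrow> clinear (f i)) \<Longrightarrow> clinear (\<lambda>x. \<Sum>i\<in>I. f i x)"
  by (simp add: clinear_iff sum.distrib complex_vector.scale_sum_right)

lemma clinear_plus: "clinear f \<Longrightarrow> clinear g \<Longrightarrow> clinear (\<lambda>x. f x + g x)"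
  by (simp add: clinear_iff scaleC_algebra algebra_simps)

lemma clinear_minus: "clinear f \<Longrightarrow> clinear g \<Longrightarrow> clinear (\<lambda>x. f x - g x)"
  by (simp add: clinear_iff scaleC_algebra algebra_simps)

lemma clinear_id: "clinear (\<lambda>x. x)"
  by (simp add: clinear_iff)

lemma clinear_apply: "clinear (\<lambda>f. f x :: 'b::complex_vector)"
  by (simp add: clinear_iff)

lemma clinear_onD_sum:
  assumes "clinear_on A f" "csubspace A" "\<And>i. i \<in> I \<Longrightarrow> x i \<in> A"
  shows "f (\<Sum>i\<in>I. a i *\<^sub>C x i) = (\<Sum>i\<in>I. a i *\<^sub>C f (x i))"
  using assms(3)
proof (induction I rule: infinite_finite_induct)
  case empty
  have "f (0 *\<^sub>C 0) = 0 *\<^sub>C f 0"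
    using assms(1,2) complex_vector.subspace_0 unfolding clinear_on_def by blast
  then show ?case by simp
next
  case (infinite I)
  have "f (0 *\<^sub>C 0) = 0 *\<^sub>C f 0"
    using assms(1,2) complex_vector.subspace_0 unfolding clinear_on_def by blast
  then show ?case using infinite by simp
next
  case (insert i I)
  have "(\<Sum>i\<in>I. a i *\<^sub>C x i) \<in> A" "a i *\<^sub>C x i \<in> A"
    using insert assms(2) by (auto intro!: complex_vector.subspace_sum complex_vector.subspace_scale)
  then show ?case using insert assms(1) by (simp add: clinear_on_def)
qed

lemma cbilinear_iff:
  "cbilinear b \<longleftrightarrow> (\<forall>x x' y. b (x + x') y = b x y + b x' y) \<and> (\<forall>x y y'. b x (y + y') = b x y + b x y')
     \<and> (\<forall>a x y. b (a *\<^sub>C x) y = a *\<^sub>C b x y) \<and> (\<forall>a x y. b x (a *\<^sub>C y) = a *\<^sub>C b x y)"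
  unfolding cbilinear_def clinear_iff by metis

lemma cbilinear_right: "cbilinear b \<Longrightarrow> clinear (b x)"
  and cbilinear_left: "cbilinear b \<Longrightarrow> clinear (\<lambda>x. b x y)"
  by (auto simp: cbilinear_def)

lemma cbilinear_add_left: "cbilinear b \<Longrightarrow> b (x + x') y = b x y + b x' y"
  and cbilinear_add_right: "cbilinear b \<Longrightarrow> b x (y + y') = b x y + b x y'"
  and cbilinear_diff_left: "cbilinear b \<Longrightarrow> b (x - x') y = b x y - b x' y"
  and cbilinear_diff_right: "cbilinear b \<Longrightarrow> b x (y - y') = b x y - b x y'"
  and cbilinear_scale_left: "cbilinear b \<Longrightarrow> b (a *\<^sub>C x) y = a *\<^sub>C b x y"
  and cbilinear_scale_right: "cbilinear b \<Longrightarrow> b x (a *\<^sub>C y) = a *\<^sub>C b x y"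
  and cbilinear_sum_left: "cbilinear b \<Longrightarrow> b (sum f I) y = (\<Sum>i\<in>I. b (f i) y)"
  and cbilinear_sum_right: "cbilinear b \<Longrightarrow> b x (sum g I) = (\<Sum>i\<in>I. b x (g i))"
  and cbilinear_zero_left: "cbilinear b \<Longrightarrow> b 0 y = 0"
  and cbilinear_zero_right: "cbilinear b \<Longrightarrow> b x 0 = 0"
  using clinear_add[of "\<lambda>x. b x y"] clinear_add[of "b x"] clinear_diff[of "\<lambda>x. b x y"] clinear_diff[of "b x"]
    clinear_scale[of "\<lambda>x. b x y"] clinear_scale[of "b x"] clinear_sum[of "\<lambda>x. b x y"] clinear_sum[of "b x"]
    clinear_0[of "\<lambda>x. b x y"] clinear_0[of "b x"]
  by (simp_all add: cbilinear_left cbilinear_right)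

lemmas cbilinear_simps = cbilinear_add_left cbilinear_add_right cbilinear_diff_left cbilinear_diff_right
  cbilinear_scale_left cbilinear_scale_right cbilinear_sum_left cbilinear_sum_right
  cbilinear_zero_left cbilinear_zero_right

lemma cbilinear_mult: "clinear l \<Longrightarrow> clinear m \<Longrightarrow> cbilinear (\<lambda>x y. l x * m y :: complex)"
  by (simp add: cbilinear_iff clinear_iff algebra_simps)

lemma cbilinear_compose: "cbilinear b \<Longrightarrow> clinear f \<Longrightarrow> clinear g \<Longrightarrow> cbilinear (\<lambda>x y. b (f x) (g y))"
  by (simp add: cbilinear_iff clinear_iff)

lemma cbilinear_flip: "cbilinear b \<Longrightarrow> cbilinear (\<lambda>x y. b y x)"
  by (simp add: cbilinear_iff)

lemma csubspaceI:
  assumes "0 \<in> A" "\<And>x y. x \<in> A \<Longrightarrow> y \<in> A \<Longrightarrow> x + y \<in> A" "\<And>a x. x \<in> A \<Longrightarrow> a *\<^sub>C x \<in> A"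
  shows "csubspace A"
  using assms by (auto simp: complex_vector.subspace_def)

subsection \<open>Finite families as bases\<close>

text \<open>A family rather than a set: a frame of a bundle varies with the point while its index
  set stays fixed. Injectivity excludes repetitions, which the image set could not detect.\<close>

definition cbasis :: "'i set \<Rightarrow> ('i \<Rightarrow> 'a::complex_vector) \<Rightarrow> 'a set \<Rightarrow> bool"
  where "cbasis I b A \<longleftrightarrow> finite I \<and> inj_on b I \<and> cindependent (b ` I) \<and> cspan (b ` I) = A"

lemma cbasisD:
  assumes "cbasis I b A"
  shows "finite I" "inj_on b I" "cindependent (b ` I)" "cspan (b ` I) = A" "csubspace A"
    "\<And>i. i \<in> I \<Longrightarrow> b i \<in> A"
  using assms by (auto simp: cbasis_def intro: complex_vector.span_base)

lemma independent_familyI: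
  assumes "finite I" and "\<And>a. (\<Sum>i\<in>I. a i *\<^sub>C b i) = 0 \<Longrightarrow> \<forall>i\<in>I. a i = 0"
  shows "inj_on b I" "cindependent (b ` I)"
proof -
  show inj: "inj_on b I"
  proof (rule inj_onI, rule ccontr)
    fix i j assume ij: "i \<in> I" "j \<in> I" "b i = b j" "i \<noteq> j"
    \<comment> \<open>If two indices carried the same vector, coefficients 1 and -1 on them would
      give a nontrivial relation.\<close>
    let ?a = "\<lambda>k. if k = i then 1 else if k = j then - 1 else (0::complex)"
    have "(\<Sum>k\<in>I. ?a k *\<^sub>C b k) = (\<Sum>k\<in>{i,j}. ?a k *\<^sub>C b k)"
      by (rule sum.mono_neutral_right) (use assms(1) ij in auto)
    also have "\<dots> = 0" using ij by simp
    finally show False using assms(2)[of ?a] ij by auto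
  qed
  show "cindependent (b ` I)"
  proof (rule complex_vector.independent_if_scalars_zero)
    show "finite (b ` I)" using assms(1) by simp
    fix f x assume "(\<Sum>x\<in>b ` I. f x *\<^sub>C x) = 0" "x \<in> b ` I"
    then show "f x = 0" using assms(2)[of "\<lambda>i. f (b i)"] by (auto simp: sum.reindex[OF inj])
  qed
qed

lemma cbasisI:
  assumes "finite I" "csubspace A" "\<And>i. i \<in> I \<Longrightarrow> b i \<in> A"
    and "\<And>a. (\<Sum>i\<in>I. a i *\<^sub>C b i) = 0 \<Longrightarrow> \<forall>i\<in>I. a i = 0"
    and "\<And>x. x \<in> A \<Longrightarrow> \<exists>a. x = (\<Sum>i\<in>I. a i *\<^sub>C b i)"
  shows "cbasis I b A"
proof -
  have "cspan (b ` I) \<subseteq> A"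
    using assms(2,3) by (intro complex_vector.span_minimal) auto
  moreover have "A \<subseteq> cspan (b ` I)"
  proof
    fix x assume "x \<in> A"
    then obtain a where "x = (\<Sum>i\<in>I. a i *\<^sub>C b i)" using assms(5) by blast
    then show "x \<in> cspan (b ` I)"
      by (auto intro!: complex_vector.span_sum complex_vector.span_scale intro: complex_vector.span_base)
  qed
  ultimately show ?thesis
    using independent_familyI[OF assms(1), of b] assms(1,4) by (auto simp: cbasis_def)
qed

text \<open>\<open>representation\<close> is zero outside the span, so these coordinate forms are
  already extended by zero as \<open>dual_space\<close> demands.\<close>

definition dual_family :: "'i set \<Rightarrow> ('i \<Rightarrow> 'a::complex_vector) \<Rightarrow> 'i \<Rightarrow> 'a \<Rightarrow> complex"
  where "dual_family I b i = (\<lambda>x. complex_vector.representation (b ` I) x (b i))"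

lemma dual_family_notin: "cbasis I b A \<Longrightarrow> x \<notin> A \<Longrightarrow> dual_family I b i x = 0"
  by (simp add: cbasis_def dual_family_def complex_vector.representation_def)

lemma dual_family_expand:
  assumes "cbasis I b A" "x \<in> A"
  shows "x = (\<Sum>i\<in>I. dual_family I b i x *\<^sub>C b i)"
proof -
  note b = cbasisD[OF assms(1)]
  have "(\<Sum>v\<in>b ` I. complex_vector.representation (b ` I) x v *\<^sub>C v) = x"
    using b assms(2) by (intro complex_vector.sum_representation_eq) auto
  then show ?thesis by (simp add: sum.reindex[OF b(2)] dual_family_def)
qed

lemma dual_family_in_dual:
  assumes "cbasis I b A" shows "dual_family I b i \<in> dual_space A"
  using cbasisD[OF assms] dual_family_notin[OF assms]
  by (auto simp: dual_space_def clinear_on_def dual_family_def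
      complex_vector.representation_add complex_vector.representation_scale)

lemma dual_family_basis:
  assumes "cbasis I b A" "i \<in> I" "j \<in> I"
  shows "dual_family I b i (b j) = (if i = j then 1 else 0)"
  using assms cbasisD[OF assms(1)]
  by (auto simp: dual_family_def complex_vector.representation_basis inj_on_eq_iff)

lemma dual_family_sum:
  assumes "cbasis I b A" "i \<in> I"
  shows "dual_family I b i (\<Sum>j\<in>I. a j *\<^sub>C b j) = a i"
proof -
  have lin: "clinear_on A (dual_family I b i)"
    using dual_family_in_dual[OF assms(1)] by (auto simp: dual_space_def)
  have "dual_family I b i (\<Sum>j\<in>I. a j *\<^sub>C b j) = (\<Sum>j\<in>I. a j *\<^sub>C dual_family I b i (b j))"
    using cbasisD[OF assms(1)] by (intro clinear_onD_sum[OF lin]) auto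
  also have "\<dots> = (\<Sum>j\<in>I. if i = j then a j else 0)"
    by (intro sum.cong) (use assms in \<open>auto simp: dual_family_basis\<close>)
  also have "\<dots> = a i" using assms cbasisD[OF assms(1)] by simp
  finally show ?thesis .
qed

lemma cbasis_unique:
  assumes "cbasis I b A" "(\<Sum>i\<in>I. a i *\<^sub>C b i) = (\<Sum>i\<in>I. a' i *\<^sub>C b i)" "i \<in> I"
  shows "a i = a' i"
  using dual_family_sum[OF assms(1,3)] assms(2) by metis

lemma cbasis_independent:
  assumes "cbasis I b A" "(\<Sum>i\<in>I. a i *\<^sub>C b i) = 0" "i \<in> I"
  shows "a i = 0"
  using cbasis_unique[OF assms(1), of a "\<lambda>_. 0" i] assms by simp

lemma dual_space_subspace: "csubspace (dual_space A)"
  by (rule csubspaceI) (auto simp: dual_space_def clinear_on_def algebra_simps)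

lemma dual_space_on_basis:
  assumes "cbasis I b A" "f \<in> dual_space A" "x \<in> A"
  shows "f x = (\<Sum>i\<in>I. dual_family I b i x * f (b i))"
proof -
  have "f (\<Sum>i\<in>I. dual_family I b i x *\<^sub>C b i) = (\<Sum>i\<in>I. dual_family I b i x *\<^sub>C f (b i))"
    using assms(2) cbasisD(5,6)[OF assms(1)] by (intro clinear_onD_sum[of A]) (auto simp: dual_space_def)
  then show ?thesis using dual_family_expand[OF assms(1,3)] by simp
qed

lemma dual_space_eqI:
  assumes "cbasis I b A" "f \<in> dual_space A" "g \<in> dual_space A" "\<And>i. i \<in> I \<Longrightarrow> f (b i) = g (b i)"
  shows "f = g"
proof
  fix x
  show "f x = g x"
  proof (cases "x \<in> A")
    case True
    then show ?thesis
      unfolding dual_space_on_basis[OF assms(1,2) True] dual_space_on_basis[OF assms(1,3) True]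
      using assms(4) by simp
  qed (use assms(2,3) in \<open>auto simp: dual_space_def\<close>)
qed

lemma dual_space_expand:
  assumes "cbasis I b A" "f \<in> dual_space A"
  shows "f = (\<Sum>i\<in>I. f (b i) *\<^sub>C dual_family I b i)"
proof (rule dual_space_eqI[OF assms])
  show "(\<Sum>i\<in>I. f (b i) *\<^sub>C dual_family I b i) \<in> dual_space A"
    using dual_space_subspace dual_family_in_dual[OF assms(1)]
    by (intro complex_vector.subspace_sum complex_vector.subspace_scale) auto
  fix j assume j: "j \<in> I"
  have "(\<Sum>i\<in>I. f (b i) *\<^sub>C dual_family I b i) (b j) = (\<Sum>i\<in>I. if i = j then f (b i) else 0)"
    unfolding sum_fun_apply by (intro sum.cong) (use assms j in \<open>auto simp: dual_family_basis\<close>)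
  then show "f (b j) = (\<Sum>i\<in>I. f (b i) *\<^sub>C dual_family I b i) (b j)"
    using j cbasisD(1)[OF assms(1)] by simp
qed

lemma cbasis_dual:
  assumes "cbasis I b A"
  shows "cbasis I (dual_family I b) (dual_space A)"
proof (rule cbasisI)
  fix a assume a: "(\<Sum>i\<in>I. a i *\<^sub>C dual_family I b i) = 0"
  show "\<forall>j\<in>I. a j = 0"
  proof
    fix j assume j: "j \<in> I"
    have "(\<Sum>i\<in>I. a i *\<^sub>C dual_family I b i) (b j) = (\<Sum>i\<in>I. if i = j then a i else 0)"
      unfolding sum_fun_apply by (intro sum.cong) (use assms j in \<open>auto simp: dual_family_basis\<close>)
    then show "a j = 0" using a j cbasisD(1)[OF assms] by simp
  qed
next
  show "finite I" using cbasisD(1)[OF assms] .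
  show "csubspace (dual_space A)" by (rule dual_space_subspace)
  show "dual_family I b i \<in> dual_space A" for i using dual_family_in_dual[OF assms] .
  show "\<exists>a. f = (\<Sum>i\<in>I. a i *\<^sub>C dual_family I b i)" if "f \<in> dual_space A" for f
    using dual_space_expand[OF assms that] by (rule exI[of _ "\<lambda>i. f (b i)"])
qed

lemma cbasis_reindex:
  assumes "cbasis I b A" "bij_betw h J I"
  shows "cbasis J (\<lambda>j. b (h j)) A"
proof -
  have "(\<lambda>j. b (h j)) ` J = b ` I" using assms(2) by (auto simp: bij_betw_def)
  moreover have "inj_on (\<lambda>j. b (h j)) J"
    using assms cbasisD(2)[OF assms(1)] by (auto simp: bij_betw_def inj_on_def)
  moreover have "finite J" using assms bij_betw_finite cbasis_def by blast
  ultimately show ?thesis using assms(1) by (simp add: cbasis_def)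
qed

text \<open>An independent family extends to a basis. The forms live on the whole space, unlike
  \<open>dual_family\<close>, so products of them are bilinear forms at which tensors can be
  evaluated.\<close>

lemma linear_functional_family:
  assumes "cindependent (b ` I)" "inj_on b I"
  shows "\<exists>l. clinear l \<and> (\<forall>i\<in>I. l (b i) = (v i::complex))"
proof -
  have "\<exists>l. clinear l \<and> (\<forall>x\<in>b ` I. l x = v (the_inv_into I b x))"
    using complex_vector_pair.linear_independent_extend[OF assms(1), of "\<lambda>x. v (the_inv_into I b x)"] by simp
  then show ?thesis using assms(2) by (auto simp: the_inv_into_f_f)
qed

lemma linear_functional_nonzero:
  assumes "x \<noteq> (0::'a::complex_vector)"
  obtains l where "clinear l" "l x = (1::complex)"
proof -
  have "cindependent ((\<lambda>_::unit. x) ` UNIV)" "inj_on (\<lambda>_::unit. x) UNIV"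
    using assms by (auto simp: complex_vector.independent_insert inj_on_def)
  from linear_functional_family[OF this, of "\<lambda>_. 1"] show ?thesis using that by auto
qed

lemma linear_functionals_separate:
  assumes "\<And>l::'a::complex_vector \<Rightarrow> complex. clinear l \<Longrightarrow> l x = l y"
  shows "x = y"
proof (rule ccontr)
  assume "x \<noteq> y"
  then obtain l :: "'a \<Rightarrow> complex" where "clinear l" "l (x - y) = 1"
    using linear_functional_nonzero[of "x - y"] by auto
  then show False using assms[of l] by (simp add: clinear_diff)
qed

text \<open>A finite spanning set bounds the size of an independent set. This serves for
  \<open>V4\<close> and \<open>V_2omega1 B\<close>, of which only an ambient finite-dimensional
  space is at hand.\<close>

lemma csubspace_has_cbasis:
  assumes "csubspace A" "A \<subseteq> cspan F" "finite F"
  obtains n :: nat and b where "cbasis {..<n} b A"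
proof -
  obtain C where C: "C \<subseteq> A" "cindependent C" "A \<subseteq> cspan C"
    using complex_vector.basis_exists[of A] by metis
  have fin: "finite C"
    using complex_vector.independent_span_bound[OF assms(3) C(2)] C(1) assms(2) by auto
  then obtain h where h: "bij_betw h {0..<card C} C" using ex_bij_betw_nat_finite by blast
  have "cbasis C (\<lambda>x. x) A"
    using C fin assms(1) complex_vector.span_minimal[of C A] by (auto simp: cbasis_def)
  then show ?thesis
    using cbasis_reindex[of C "\<lambda>x. x" A h "{0..<card C}"] h that[of "card C" h] by (simp add: atLeast0LessThan)
qed

subsection \<open>Tensors\<close>

lemma tens_apply: "cbilinear \<beta> \<Longrightarrow> tens x y \<beta> = \<beta> x y"
  by (simp add: tens_def)

lemma cbilinear_tens: "cbilinear tens"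
  by (auto simp: cbilinear_iff tens_def fun_eq_iff)

lemmas tens_simps = cbilinear_simps[OF cbilinear_tens]

text \<open>Evaluation at the form \<open>m x * l y\<close>, with \<open>m\<close> the coordinate
  along \<open>g i\<close>, isolates \<open>l (y i)\<close>; linear forms separate points.\<close>

lemma tens_sum_unique:
  assumes "finite I" "inj_on g I" "cindependent (g ` I)"
    and "(\<Sum>i\<in>I. tens (g i) (y i)) = (\<Sum>i\<in>I. tens (g i) (y' i))" "i \<in> I"
  shows "y i = (y' i :: 'c::complex_vector)"
proof (rule linear_functionals_separate)
  fix l :: "'c \<Rightarrow> complex" assume l: "clinear l"
  obtain m where m: "clinear m" "\<And>j. j \<in> I \<Longrightarrow> m (g j) = (if j = i then 1 else (0::complex))"
    using linear_functional_family[OF assms(3,2), of "\<lambda>j. if j = i then 1 else 0"]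
    by (elim exE conjE) (rule that, assumption, simp)
  let ?b = "\<lambda>x y. m x * l y"
  have ev: "(\<Sum>j\<in>I. tens (g j) (z j)) ?b = l (z i)" for z
  proof -
    have "(\<Sum>j\<in>I. tens (g j) (z j)) ?b = (\<Sum>j\<in>I. if j = i then l (z j) else 0)"
      unfolding sum_fun_apply using m(2)
      by (intro sum.cong) (auto simp: tens_apply cbilinear_mult l m(1))
    then show ?thesis using assms(1,5) by simp
  qed
  show "l (y i) = l (y' i)"
    by (rule trans[OF ev[of y, symmetric] trans[OF fun_cong[OF assms(4)] ev[of y']]])
qed

lemma tens_eq_right_unique:
  assumes "tens x q = tens y q" "q \<noteq> 0"
  shows "x = y"
proof (rule linear_functionals_separate)
  fix l :: "'a \<Rightarrow> complex" assume l: "clinear l"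
  obtain m where m: "clinear m" "m q = (1::complex)" using linear_functional_nonzero[OF assms(2)] .
  have "tens x q (\<lambda>x y. l x * m y) = tens y q (\<lambda>x y. l x * m y)" using assms(1) by simp
  then show "l x = l y" using m l by (simp add: tens_apply cbilinear_mult)
qed

lemma tensor_space_subspace [simp]: "csubspace (tensor_space A C)"
  by (simp add: tensor_space_def)

lemma tens_in_tensor_space: "x \<in> A \<Longrightarrow> y \<in> C \<Longrightarrow> tens x y \<in> tensor_space A C"
  unfolding tensor_space_def by (rule complex_vector.span_base) auto

lemma tensor_space_induct [consumes 1, case_names zero add scale tens]:
  assumes "t \<in> tensor_space A C" "P 0" "\<And>s t. P s \<Longrightarrow> P t \<Longrightarrow> P (s + t)" "\<And>a t. P t \<Longrightarrow> P (a *\<^sub>C t)"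
    "\<And>x y. x \<in> A \<Longrightarrow> y \<in> C \<Longrightarrow> P (tens x y)"
  shows "P t"
proof -
  have "csubspace {t. P t}" using assms(2-4) by (intro csubspaceI) auto
  then have "tensor_space A C \<subseteq> {t. P t}"
    unfolding tensor_space_def using assms(5) by (intro complex_vector.span_minimal) auto
  then show ?thesis using assms(1) by auto
qed

text \<open>\<open>C\<close> is kept as a space of coefficients, so that nested tensor products can
  be peeled one factor at a time.\<close>

lemma tensor_space_expand_left:
  assumes "cbasis I b A" "csubspace C" "t \<in> tensor_space A C"
  shows "\<exists>y. (\<forall>i\<in>I. y i \<in> C) \<and> t = (\<Sum>i\<in>I. tens (b i) (y i))"
  using assms(3)
proof (induction rule: tensor_space_induct)
  case zero
  show ?case
    using complex_vector.subspace_0[OF assms(2)] by (intro exI[of _ "\<lambda>_. 0"]) (simp add: tens_simps)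
next
  case (add s t)
  then obtain y y' where "\<forall>i\<in>I. y i \<in> C" "s = (\<Sum>i\<in>I. tens (b i) (y i))"
    "\<forall>i\<in>I. y' i \<in> C" "t = (\<Sum>i\<in>I. tens (b i) (y' i))" by blast
  then show ?case
    using complex_vector.subspace_add[OF assms(2)]
    by (intro exI[of _ "\<lambda>i. y i + y' i"]) (simp only: tens_simps sum.distrib, blast)
next
  case (scale a t)
  then obtain y where "\<forall>i\<in>I. y i \<in> C" "t = (\<Sum>i\<in>I. tens (b i) (y i))" by blast
  then show ?case
    using complex_vector.subspace_scale[OF assms(2)]
    by (intro exI[of _ "\<lambda>i. a *\<^sub>C y i"]) (simp only: tens_simps complex_vector.scale_sum_right, blast)
next
  case (tens x y)
  show ?case
  proof (intro exI conjI)
    show "\<forall>i\<in>I. dual_family I b i x *\<^sub>C y \<in> C"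
      using tens complex_vector.subspace_scale[OF assms(2)] by auto
    have "tens (\<Sum>i\<in>I. dual_family I b i x *\<^sub>C b i) y = (\<Sum>i\<in>I. tens (b i) (dual_family I b i x *\<^sub>C y))"
      by (simp add: tens_simps)
    then show "tens x y = (\<Sum>i\<in>I. tens (b i) (dual_family I b i x *\<^sub>C y))"
      using dual_family_expand[OF assms(1) tens(1)] by simp
  qed
qed

lemma cbasis_tens:
  assumes "cbasis I b A" "cbasis J d C"
  shows "cbasis (I \<times> J) (\<lambda>(i, j). tens (b i) (d j)) (tensor_space A C)"
proof (rule cbasisI)
  note I = cbasisD[OF assms(1)] and J = cbasisD[OF assms(2)]
  show "finite (I \<times> J)" using I J by simp
  show "csubspace (tensor_space A C)" by simp
  show "(case p of (i, j) \<Rightarrow> tens (b i) (d j)) \<in> tensor_space A C" if "p \<in> I \<times> J" for p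
    using that I(6) J(6) by (auto simp: tens_in_tensor_space)
  have sum: "(\<Sum>p\<in>I \<times> J. a p *\<^sub>C (case p of (i, j) \<Rightarrow> tens (b i) (d j))) =
      (\<Sum>i\<in>I. tens (b i) (\<Sum>j\<in>J. a (i, j) *\<^sub>C d j))" for a
    by (simp add: tens_simps sum.cartesian_product case_prod_beta)
  fix a assume "(\<Sum>p\<in>I \<times> J. a p *\<^sub>C (case p of (i, j) \<Rightarrow> tens (b i) (d j))) = 0"
  then have *: "(\<Sum>i\<in>I. tens (b i) (\<Sum>j\<in>J. a (i, j) *\<^sub>C d j)) = (\<Sum>i\<in>I. tens (b i) 0)"
    by (simp add: sum tens_simps)
  show "\<forall>p\<in>I \<times> J. a p = 0"
  proof clarify
    fix i j assume ij: "i \<in> I" "j \<in> J"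
    have "(\<Sum>j\<in>J. a (i, j) *\<^sub>C d j) = 0" using tens_sum_unique[OF I(1-3) * ij(1)] .
    then show "a (i, j) = 0" using cbasis_independent[OF assms(2), of "\<lambda>j. a (i, j)"] ij by blast
  qed
next
  fix t assume "t \<in> tensor_space A C"
  then obtain y where y: "\<forall>i\<in>I. y i \<in> C" "t = (\<Sum>i\<in>I. tens (b i) (y i))"
    using tensor_space_expand_left[OF assms(1) cbasisD(5)[OF assms(2)]] by metis
  have "t = (\<Sum>i\<in>I. tens (b i) (\<Sum>j\<in>J. dual_family J d j (y i) *\<^sub>C d j))"
    unfolding y(2) by (intro sum.cong refl arg_cong[of _ _ "tens _"] dual_family_expand[OF assms(2)]) (use y in auto)
  also have "\<dots> = (\<Sum>p\<in>I \<times> J. dual_family J d (snd p) (y (fst p)) *\<^sub>C (case p of (i, j) \<Rightarrow> tens (b i) (d j)))"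
    by (simp add: tens_simps sum.cartesian_product case_prod_beta)
  finally show "\<exists>a. t = (\<Sum>p\<in>I \<times> J. a p *\<^sub>C (case p of (i, j) \<Rightarrow> tens (b i) (d j)))"
    by (rule exI[of _ "\<lambda>p. dual_family J d (snd p) (y (fst p))"])
qed

text \<open>Once a generator \<open>q\<close> of a line is chosen, a twisted fibre is a copy of the
  untwisted one. This is how the fibres twisted by \<open>O(1)\<close> and \<open>O(2)\<close> are
  parametrised.\<close>

lemma tensor_space_line:
  assumes "csubspace A" "t \<in> tensor_space A (cspan {q})"
  shows "\<exists>x\<in>A. t = tens x q"
  using assms(2)
proof (induction rule: tensor_space_induct)
  case zero
  show ?case
    using complex_vector.subspace_0[OF assms(1)] by (intro bexI[of _ 0]) (auto simp: tens_simps)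
next
  case (add s t)
  then obtain x y where "x \<in> A" "s = tens x q" "y \<in> A" "t = tens y q" by blast
  then show ?case
    using complex_vector.subspace_add[OF assms(1)] by (intro bexI[of _ "x + y"]) (auto simp: tens_simps)
next
  case (scale a t)
  then obtain x where "x \<in> A" "t = tens x q" by blast
  then show ?case
    using complex_vector.subspace_scale[OF assms(1)] by (intro bexI[of _ "a *\<^sub>C x"]) (auto simp: tens_simps)
next
  case (tens x y)
  then obtain z where "y = z *\<^sub>C q" by (auto simp: complex_vector.span_singleton)
  then show ?case
    using tens complex_vector.subspace_scale[OF assms(1)]
    by (intro bexI[of _ "z *\<^sub>C x"]) (auto simp: tens_simps)
qed

text \<open>Tensors are functionals on bilinear forms, so a pair of maps acts by pulling the form
  back. The zero branch keeps the convention of \<open>tens\<close> off bilinear forms.\<close>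

definition tensor_map :: "('a::complex_vector \<Rightarrow> 'c::complex_vector) \<Rightarrow> ('b::complex_vector \<Rightarrow> 'd::complex_vector) \<Rightarrow>
    ('a, 'b) tensor \<Rightarrow> ('c, 'd) tensor"
  where "tensor_map f g t = (\<lambda>\<beta>. if cbilinear \<beta> then t (\<lambda>x y. \<beta> (f x) (g y)) else 0)"

lemma tensor_map_tens:
  "clinear f \<Longrightarrow> clinear g \<Longrightarrow> tensor_map f g (tens x y) = tens (f x) (g y)"
  by (auto simp: tensor_map_def tens_def cbilinear_compose)

lemma clinear_tensor_map: "clinear (tensor_map f g)"
  by (auto simp: clinear_iff tensor_map_def fun_eq_iff)

lemma sym2_space_subspace [simp]: "csubspace (sym2_space A)"
  by (simp add: sym2_space_def)

lemma sym2_space_square: "x \<in> A \<Longrightarrow> tens x x \<in> sym2_space A"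
  unfolding sym2_space_def by (rule complex_vector.span_base) auto

text \<open>Polarisation of the square of \<open>x + y\<close>.\<close>

lemma sym2_space_sym:
  assumes "csubspace A" "x \<in> A" "y \<in> A" shows "tens x y + tens y x \<in> sym2_space A"
proof -
  have "tens x y + tens y x = tens (x + y) (x + y) - tens x x - tens y y"
    by (simp add: tens_simps)
  also have "\<dots> \<in> sym2_space A"
    using assms complex_vector.subspace_add[OF assms(1)]
    by (intro complex_vector.subspace_diff sym2_space_subspace sym2_space_square) auto
  finally show ?thesis .
qed

lemma sym2_space_induct [consumes 1, case_names zero add scale square]:
  assumes "t \<in> sym2_space A" "P 0" "\<And>s t. P s \<Longrightarrow> P t \<Longrightarrow> P (s + t)" "\<And>a t. P t \<Longrightarrow> P (a *\<^sub>C t)"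
    "\<And>x. x \<in> A \<Longrightarrow> P (tens x x)"
  shows "P t"
proof -
  have "csubspace {t. P t}" using assms(2-4) by (intro csubspaceI) auto
  then have "sym2_space A \<subseteq> {t. P t}"
    unfolding sym2_space_def using assms(5) by (intro complex_vector.span_minimal) auto
  then show ?thesis using assms(1) by auto
qed

lemma sym2_space_le_tensor_space: "sym2_space A \<subseteq> tensor_space A A"
  unfolding sym2_space_def
  by (intro complex_vector.span_minimal) (auto simp: tens_in_tensor_space)

lemma sym2_space_flip:
  assumes "t \<in> sym2_space A" "cbilinear \<beta>"
  shows "t (\<lambda>x y. \<beta> y x) = t \<beta>"
  using assms(1)
  by (induction rule: sym2_space_induct)
    (auto intro!: csubspaceI simp: tens_apply assms(2) cbilinear_flip)

text \<open>A combination of squares takes the same value on a form and on its flip. The forms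
  \<open>m i x * m j y\<close> built from coordinates read off the coefficients, and the flip
  exchanges \<open>i\<close> and \<open>j\<close>.\<close>

lemma sym2_coefficients:
  assumes "cbasis I b A" "(\<Sum>i\<in>I. \<Sum>j\<in>I. x i j *\<^sub>C tens (b i) (b j)) \<in> sym2_space A'" "i \<in> I" "j \<in> I"
  shows "x i j = x j i"
proof -
  note I = cbasisD[OF assms(1)]
  let ?t = "\<Sum>i\<in>I. \<Sum>j\<in>I. x i j *\<^sub>C tens (b i) (b j)"
  obtain m where m: "\<And>k. clinear (m k)" "\<And>k j. j \<in> I \<Longrightarrow> m k (b j) = (if j = k then 1 else (0::complex))"
  proof -
    have "\<exists>l. clinear l \<and> (\<forall>j\<in>I. l (b j) = (if j = k then 1 else 0 :: complex))" for k
      using linear_functional_family[OF I(3,2), of "\<lambda>j. if j = k then 1 else 0"] .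
    then obtain m where "\<And>k. clinear (m k) \<and> (\<forall>j\<in>I. m k (b j) = (if j = k then 1 else (0 :: complex)))"
      by (metis (no_types, lifting))
    then show ?thesis by (intro that[of m]) simp_all
  qed
  let ?b = "\<lambda>k l x y. m k x * m l y"
  have *: "?t (?b k l) = x k l" if "k \<in> I" "l \<in> I" for k l
  proof -
    have "?t (?b k l) = (\<Sum>i\<in>I. \<Sum>j\<in>I. x i j * (m k (b i) * m l (b j)))"
      by (simp add: sum_fun_apply tens_apply cbilinear_mult m(1))
    also have "\<dots> = (\<Sum>i\<in>I. if i = k then (\<Sum>j\<in>I. if j = l then x i j else 0) else 0)"
      by (intro sum.cong refl) (auto simp: m(2) intro!: sum.cong)
    also have "\<dots> = x k l" using that I(1) by simp
    finally show ?thesis .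
  qed
  have "?t (\<lambda>x y. ?b i j y x) = ?t (?b i j)"
    by (rule sym2_space_flip[OF assms(2)]) (simp add: cbilinear_mult m(1))
  moreover have "(\<lambda>x y. ?b i j y x) = ?b j i" by (simp add: fun_eq_iff mult.commute)
  ultimately have "?t (?b j i) = ?t (?b i j)" by simp
  then show ?thesis unfolding *[OF assms(3,4)] *[OF assms(4,3)] by simp
qed

subsection \<open>Local frames\<close>

text \<open>These are the facts about the structure sheaf on which the bundle constructions rest;
  isolating them keeps Pluecker coordinates out of the sheaf arguments.\<close>

locale ringed_variety =
  fixes M :: "'x variety"
  assumes regular_const: "openin (zariski M) W \<Longrightarrow> (\<lambda>_. a) \<in> regular M W"
    and regular_add: "openin (zariski M) W \<Longrightarrow> f \<in> regular M W \<Longrightarrow> g \<in> regular M W \<Longrightarrow>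
      (\<lambda>x. f x + g x) \<in> regular M W"
    and regular_mult: "openin (zariski M) W \<Longrightarrow> f \<in> regular M W \<Longrightarrow> g \<in> regular M W \<Longrightarrow>
      (\<lambda>x. f x * g x) \<in> regular M W"
    and regular_restrict: "openin (zariski M) W \<Longrightarrow> openin (zariski M) W' \<Longrightarrow> W' \<subseteq> W \<Longrightarrow>
      f \<in> regular M W \<Longrightarrow> f \<in> regular M W'"
    and regular_glue: "openin (zariski M) W \<Longrightarrow>
      (\<And>x. x \<in> W \<Longrightarrow> \<exists>N. openin (zariski M) N \<and> x \<in> N \<and> N \<subseteq> W \<and> f \<in> regular M N) \<Longrightarrow> f \<in> regular M W"
    and regular_cong: "openin (zariski M) W \<Longrightarrow> f \<in> regular M W \<Longrightarrow> (\<And>x. x \<in> W \<Longrightarrow> f x = g x) \<Longrightarrow>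
      g \<in> regular M W"

text \<open>The first two clauses of \<open>vector_bundle\<close>. They pass through sub, dual and
  tensor constructions on their own, before any local basis is known.\<close>

definition bundle_sheaf :: "'x variety \<Rightarrow> ('x, 'a) vbundle \<Rightarrow> bool"
  where "bundle_sheaf M E \<longleftrightarrow>
    (\<forall>W W' s. openin (zariski M) W \<and> openin (zariski M) W' \<and> W' \<subseteq> W \<and> s \<in> sections E W
        \<longrightarrow> s \<in> sections E W') \<and>
    (\<forall>W s. openin (zariski M) W \<and>
        (\<forall>x\<in>W. \<exists>N. openin (zariski M) N \<and> x \<in> N \<and> N \<subseteq> W \<and> s \<in> sections E N)
        \<longrightarrow> s \<in> sections E W)"

lemma bundle_sheafD:
  assumes "bundle_sheaf M E"
  shows "openin (zariski M) W \<Longrightarrow> openin (zariski M) W' \<Longrightarrow> W' \<subseteq> W \<Longrightarrow> s \<in> sections E W \<Longrightarrow> s \<in> sections E W'"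
    and "openin (zariski M) W \<Longrightarrow>
      (\<And>x. x \<in> W \<Longrightarrow> \<exists>N. openin (zariski M) N \<and> x \<in> N \<and> N \<subseteq> W \<and> s \<in> sections E N) \<Longrightarrow> s \<in> sections E W"
  using assms unfolding bundle_sheaf_def by blast+

lemma bundle_sheafI:
  assumes "\<And>W W' s. openin (zariski M) W \<Longrightarrow> openin (zariski M) W' \<Longrightarrow> W' \<subseteq> W \<Longrightarrow> s \<in> sections E W \<Longrightarrow>
      s \<in> sections E W'"
    and "\<And>W s. openin (zariski M) W \<Longrightarrow>
      (\<And>x. x \<in> W \<Longrightarrow> \<exists>N. openin (zariski M) N \<and> x \<in> N \<and> N \<subseteq> W \<and> s \<in> sections E N) \<Longrightarrow> s \<in> sections E W"
  shows "bundle_sheaf M E"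
  unfolding bundle_sheaf_def
proof (intro conjI allI impI; elim conjE)
  show "s \<in> sections E W'" if "openin (zariski M) W" "openin (zariski M) W'" "W' \<subseteq> W" "s \<in> sections E W"
    for W W' s using assms(1)[OF that] .
  show "s \<in> sections E W" if "openin (zariski M) W"
    "\<forall>x\<in>W. \<exists>N. openin (zariski M) N \<and> x \<in> N \<and> N \<subseteq> W \<and> s \<in> sections E N" for W s
    using assms(2)[OF that(1)] that(2) by simp
qed

text \<open>The local basis clause of \<open>vector_bundle\<close> with an arbitrary finite index
  set, so that tensor products are indexed by pairs and symmetric squares by ordered pairs.\<close>

definition local_frame ::
    "'x variety \<Rightarrow> ('x, 'a::complex_vector) vbundle \<Rightarrow> 'x set \<Rightarrow> 'i set \<Rightarrow> ('i \<Rightarrow> 'x \<Rightarrow> 'a) \<Rightarrow> bool"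
  where "local_frame M E N I e \<longleftrightarrow> openin (zariski M) N \<and> finite I \<and>
    (\<forall>y\<in>N. cbasis I (\<lambda>i. e i y) (fibre E y)) \<and>
    (\<forall>W s. openin (zariski M) W \<and> W \<subseteq> N \<longrightarrow>
       (s \<in> sections E W \<longleftrightarrow>
         (\<exists>a. (\<forall>i\<in>I. a i \<in> regular M W) \<and> (\<forall>y\<in>W. s y = (\<Sum>i\<in>I. a i y *\<^sub>C e i y)))))"

lemma local_frameD:
  assumes "local_frame M E N I e"
  shows "openin (zariski M) N" "finite I" "\<And>y. y \<in> N \<Longrightarrow> cbasis I (\<lambda>i. e i y) (fibre E y)"
    "\<And>W s. openin (zariski M) W \<Longrightarrow> W \<subseteq> N \<Longrightarrow> s \<in> sections E W \<longleftrightarrow>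
       (\<exists>a. (\<forall>i\<in>I. a i \<in> regular M W) \<and> (\<forall>y\<in>W. s y = (\<Sum>i\<in>I. a i y *\<^sub>C e i y)))"
  using assms unfolding local_frame_def by blast+

lemma local_frameI:
  assumes "openin (zariski M) N" "finite I" "\<And>y. y \<in> N \<Longrightarrow> cbasis I (\<lambda>i. e i y) (fibre E y)"
    and "\<And>W s. openin (zariski M) W \<Longrightarrow> W \<subseteq> N \<Longrightarrow> s \<in> sections E W \<Longrightarrow>
       \<exists>a. (\<forall>i\<in>I. a i \<in> regular M W) \<and> (\<forall>y\<in>W. s y = (\<Sum>i\<in>I. a i y *\<^sub>C e i y))"
    and "\<And>W s a. openin (zariski M) W \<Longrightarrow> W \<subseteq> N \<Longrightarrow> (\<And>i. i \<in> I \<Longrightarrow> a i \<in> regular M W) \<Longrightarrow>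
       (\<And>y. y \<in> W \<Longrightarrow> s y = (\<Sum>i\<in>I. a i y *\<^sub>C e i y)) \<Longrightarrow> s \<in> sections E W"
  shows "local_frame M E N I e"
  unfolding local_frame_def
proof (intro conjI allI impI ballI iffI)
  fix W s assume W: "openin (zariski M) W \<and> W \<subseteq> N"
  {
    assume "s \<in> sections E W"
    then show "\<exists>a. (\<forall>i\<in>I. a i \<in> regular M W) \<and> (\<forall>y\<in>W. s y = (\<Sum>i\<in>I. a i y *\<^sub>C e i y))"
      using assms(4) W by blast
  next
    assume "\<exists>a. (\<forall>i\<in>I. a i \<in> regular M W) \<and> (\<forall>y\<in>W. s y = (\<Sum>i\<in>I. a i y *\<^sub>C e i y))"
    then obtain a where "\<forall>i\<in>I. a i \<in> regular M W" "\<forall>y\<in>W. s y = (\<Sum>i\<in>I. a i y *\<^sub>C e i y)" by blast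
    then show "s \<in> sections E W" using assms(5)[of W a s] W by blast
  }
qed (use assms(1-3) in auto)

lemma local_frame_sectionI:
  assumes "local_frame M E N I e" "openin (zariski M) W" "W \<subseteq> N"
    and "\<And>i. i \<in> I \<Longrightarrow> a i \<in> regular M W" "\<And>y. y \<in> W \<Longrightarrow> s y = (\<Sum>i\<in>I. a i y *\<^sub>C e i y)"
  shows "s \<in> sections E W"
  unfolding local_frameD(4)[OF assms(1-3)] by (rule exI[of _ a]) (simp add: assms(4,5))

lemma local_frame_sectionE:
  assumes "local_frame M E N I e" "openin (zariski M) W" "W \<subseteq> N" "s \<in> sections E W"
  obtains a where "\<And>i. i \<in> I \<Longrightarrow> a i \<in> regular M W" "\<And>y. y \<in> W \<Longrightarrow> s y = (\<Sum>i\<in>I. a i y *\<^sub>C e i y)"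
  using assms(4) unfolding local_frameD(4)[OF assms(1-3)] by (elim exE conjE) (rule that; simp)

lemma local_frame_in_fibre:
  assumes "local_frame M E N I e" "openin (zariski M) W" "W \<subseteq> N" "s \<in> sections E W" "y \<in> W"
  shows "s y \<in> fibre E y"
proof -
  obtain a where "s y = (\<Sum>i\<in>I. a i y *\<^sub>C e i y)"
    using local_frame_sectionE[OF assms(1-4)] assms(5) by metis
  moreover have "cbasis I (\<lambda>i. e i y) (fibre E y)" using local_frameD(3)[OF assms(1)] assms(3,5) by blast
  ultimately show ?thesis
    using cbasisD(6) by (auto intro!: complex_vector.subspace_sum complex_vector.subspace_scale dest: cbasisD(5))
qed

text \<open>\<open>vector_bundle\<close> asks for a basis numbered by an initial segment; a
  bijection \<open>h\<close> from \<open>{..<card I}\<close> to \<open>I\<close> transports the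
  frame.\<close>

lemma vector_bundleI:
  fixes M :: "'x variety" and E :: "('x, 'a::complex_vector) vbundle"
  assumes "bundle_sheaf M E"
    and "\<And>x. x \<in> topspace (zariski M) \<Longrightarrow> \<exists>N (I::'i set) e. x \<in> N \<and> local_frame M E N I e"
  shows "vector_bundle M E"
  unfolding vector_bundle_def
proof (intro conjI ballI)
  fix x assume "x \<in> topspace (zariski M)"
  then obtain N I and e :: "'i \<Rightarrow> 'x \<Rightarrow> 'a" where x: "x \<in> N" and lf: "local_frame M E N I e"
    using assms(2) by blast
  note fr = local_frameD[OF lf]
  obtain h where h: "bij_betw h {..<card I} I"
    using ex_bij_betw_nat_finite[OF fr(2)] by (auto simp: atLeast0LessThan)
  have sum: "(\<Sum>i<card I. g (h i)) = (\<Sum>i\<in>I. g i)" for g :: "'i \<Rightarrow> 'a"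
    by (rule sum.reindex_bij_betw[OF h])
  have basis: "cbasis {..<card I} (\<lambda>i. e (h i) y) (fibre E y)" if "y \<in> N" for y
    using cbasis_reindex[OF fr(3)[OF that] h] .
  show "\<exists>N (n::nat) e. openin (zariski M) N \<and> x \<in> N \<and>
        (\<forall>y\<in>N. inj_on (\<lambda>i. e i y) {..<n} \<and> cindependent ((\<lambda>i. e i y) ` {..<n}) \<and>
                cspan ((\<lambda>i. e i y) ` {..<n}) = fibre E y) \<and>
        (\<forall>W s. openin (zariski M) W \<and> W \<subseteq> N \<longrightarrow>
           (s \<in> sections E W \<longleftrightarrow>
             (\<exists>a. (\<forall>i<n. a i \<in> regular M W) \<and> (\<forall>y\<in>W. s y = (\<Sum>i<n. a i y *\<^sub>C e i y)))))"
  proof (rule exI[of _ N], rule exI[of _ "card I"], rule exI[of _ "\<lambda>i. e (h i)"], intro conjI ballI allI impI iffI)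
    fix W s assume W: "openin (zariski M) W \<and> W \<subseteq> N"
    {
      assume "s \<in> sections E W"
      then obtain a where a: "\<forall>i\<in>I. a i \<in> regular M W" "\<forall>y\<in>W. s y = (\<Sum>i\<in>I. a i y *\<^sub>C e i y)"
        using fr(4) W by blast
      show "\<exists>a. (\<forall>i<card I. a i \<in> regular M W) \<and> (\<forall>y\<in>W. s y = (\<Sum>i<card I. a i y *\<^sub>C e (h i) y))"
      proof (rule exI[of _ "\<lambda>i. a (h i)"], intro conjI ballI allI impI)
        show "a (h i) \<in> regular M W" if "i < card I" for i
          using a(1) bij_betwE[OF h] that by auto
        show "s y = (\<Sum>i<card I. a (h i) y *\<^sub>C e (h i) y)" if "y \<in> W" for y
          using a(2) that sum[of "\<lambda>i. a i y *\<^sub>C e i y"] by simp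
      qed
    next
      assume "\<exists>a. (\<forall>i<card I. a i \<in> regular M W) \<and> (\<forall>y\<in>W. s y = (\<Sum>i<card I. a i y *\<^sub>C e (h i) y))"
      then obtain a where a: "\<forall>i<card I. a i \<in> regular M W"
        "\<forall>y\<in>W. s y = (\<Sum>i<card I. a i y *\<^sub>C e (h i) y)" by blast
      \<comment> \<open>Coefficients indexed by numbers are carried back to \<open>I\<close> along
        the inverse of \<open>h\<close>.\<close>
      let ?g = "the_inv_into {..<card I} h"
      have g: "?g (h i) = i" if "i < card I" for i
        using h that by (simp add: bij_betw_def the_inv_into_f_f)
      show "s \<in> sections E W"
      proof (rule local_frame_sectionI[OF lf])
        show "openin (zariski M) W" "W \<subseteq> N" using W by auto
        fix i assume "i \<in> I"
        then have "?g i < card I" using h by (metis bij_betw_def lessThan_iff order_refl the_inv_into_into)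
        then show "a (?g i) \<in> regular M W" using a(1) by blast
      next
        fix y assume "y \<in> W"
        then show "s y = (\<Sum>i\<in>I. a (?g i) y *\<^sub>C e i y)"
          using a(2) sum[of "\<lambda>i. a (?g i) y *\<^sub>C e i y"] g by simp
      qed
    }
  qed (use fr(1) x basis in \<open>auto simp: cbasis_def\<close>)
qed (use bundle_sheafD[OF assms(1)] in \<open>blast+\<close>)

lemma vector_bundle_sheaf: "vector_bundle M E \<Longrightarrow> bundle_sheaf M E"
  unfolding vector_bundle_def bundle_sheaf_def by (elim conjE) (intro conjI)

lemma vector_bundle_frame:
  assumes "vector_bundle M E" "x \<in> topspace (zariski M)"
  obtains N and n :: nat and e where "x \<in> N" "local_frame M E N {..<n} e"
proof -
  obtain N and n :: nat and e where *: "openin (zariski M) N \<and> x \<in> N \<and>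
        (\<forall>y\<in>N. inj_on (\<lambda>i. e i y) {..<n} \<and> cindependent ((\<lambda>i. e i y) ` {..<n}) \<and>
                cspan ((\<lambda>i. e i y) ` {..<n}) = fibre E y) \<and>
        (\<forall>W s. openin (zariski M) W \<and> W \<subseteq> N \<longrightarrow>
           (s \<in> sections E W \<longleftrightarrow>
             (\<exists>a. (\<forall>i<n. a i \<in> regular M W) \<and> (\<forall>y\<in>W. s y = (\<Sum>i<n. a i y *\<^sub>C e i y)))))"
    using bspec[OF conjunct2[OF conjunct2[OF assms(1)[unfolded vector_bundle_def]]] assms(2)]
    by (elim exE) (rule that)
  have "local_frame M E N {..<n} e"
  proof (unfold local_frame_def, intro conjI)
    show "openin (zariski M) N" by (rule conjunct1[OF *])
    show "\<forall>y\<in>N. cbasis {..<n} (\<lambda>i. e i y) (fibre E y)"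
      using conjunct1[OF conjunct2[OF conjunct2[OF *]]] by (simp add: cbasis_def)
    show "\<forall>W s. openin (zariski M) W \<and> W \<subseteq> N \<longrightarrow> (s \<in> sections E W) =
       (\<exists>a. (\<forall>i\<in>{..<n}. a i \<in> regular M W) \<and> (\<forall>y\<in>W. s y = (\<Sum>i<n. a i y *\<^sub>C e i y)))"
      using conjunct2[OF conjunct2[OF conjunct2[OF *]]] by (simp only: Ball_def[of "{..<n}"] lessThan_iff)
  qed simp
  then show ?thesis by (rule that[OF conjunct1[OF conjunct2[OF *]]])
qed

context ringed_variety
begin

lemma regular_sum:
  assumes "openin (zariski M) W" "\<And>i. i \<in> I \<Longrightarrow> f i \<in> regular M W"
  shows "(\<lambda>x. \<Sum>i\<in>I. f i x) \<in> regular M W"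
  using assms(2)
proof (induction I rule: infinite_finite_induct)
  case (insert i I)
  then have "(\<lambda>x. f i x + (\<Sum>i\<in>I. f i x)) \<in> regular M W"
    by (intro regular_add assms(1)) auto
  then show ?case using insert by simp
qed (use assms(1) regular_const in auto)

lemma local_frame_scaled_section:
  assumes "local_frame M E N I e" "openin (zariski M) W" "W \<subseteq> N" "i \<in> I" "a \<in> regular M W"
  shows "(\<lambda>y. a y *\<^sub>C e i y) \<in> sections E W"
proof -
  let ?a = "\<lambda>j. if j = i then a else (\<lambda>_. 0)"
  have "(\<Sum>j\<in>I. ?a j y *\<^sub>C e j y) = (\<Sum>j\<in>I. if j = i then a y *\<^sub>C e j y else 0)" for y
    by (intro sum.cong) auto
  then have sum: "a y *\<^sub>C e i y = (\<Sum>j\<in>I. ?a j y *\<^sub>C e j y)" for y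
    using local_frameD(2)[OF assms(1)] assms(4) by simp
  show ?thesis
    by (rule local_frame_sectionI[OF assms(1-3), of ?a])
      (use assms(2,5) regular_const sum in auto)
qed

lemma local_frame_section:
  assumes "local_frame M E N I e" "openin (zariski M) W" "W \<subseteq> N" "i \<in> I"
  shows "e i \<in> sections E W"
  using local_frame_scaled_section[OF assms regular_const[OF assms(2), of 1]] by simp

text \<open>Coefficients are unique, so the pointwise coordinate agrees with the regular coefficient
  that the frame provides.\<close>

lemma local_frame_coefficient:
  assumes "local_frame M E N I e" "openin (zariski M) W" "W \<subseteq> N" "s \<in> sections E W" "i \<in> I"
  shows "(\<lambda>y. dual_family I (\<lambda>i. e i y) i (s y)) \<in> regular M W"
proof -
  obtain a where a: "\<And>i. i \<in> I \<Longrightarrow> a i \<in> regular M W" "\<And>y. y \<in> W \<Longrightarrow> s y = (\<Sum>i\<in>I. a i y *\<^sub>C e i y)"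
    using local_frame_sectionE[OF assms(1-4)] by blast
  have *: "a i y = dual_family I (\<lambda>i. e i y) i (s y)" if "y \<in> W" for y
  proof -
    have "cbasis I (\<lambda>i. e i y) (fibre E y)"
      using local_frameD(3)[OF assms(1)] that assms(3) by blast
    from dual_family_sum[OF this assms(5), of "\<lambda>i. a i y"] show ?thesis using a(2) that by simp
  qed
  show ?thesis by (rule regular_cong[OF assms(2) a(1)[OF assms(5)] *])
qed

text \<open>\<open>W\<close> itself may carry no frame. Near each point the \<open>s i\<close> are
  expanded in a frame, the coefficients are multiplied out, and the results are glued.\<close>

lemma section_combination:
  assumes "vector_bundle M E" "openin (zariski M) W" "finite I"
    and "\<And>i. i \<in> I \<Longrightarrow> a i \<in> regular M W" "\<And>i. i \<in> I \<Longrightarrow> s i \<in> sections E W"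
    and "\<And>y. y \<in> W \<Longrightarrow> t y = (\<Sum>i\<in>I. a i y *\<^sub>C s i y)"
  shows "t \<in> sections E W"
proof (rule bundle_sheafD(2)[OF vector_bundle_sheaf[OF assms(1)] assms(2)])
  note sh = bundle_sheafD[OF vector_bundle_sheaf[OF assms(1)]]
  fix x assume x: "x \<in> W"
  then have "x \<in> topspace (zariski M)" using assms(2) openin_subset by blast
  then obtain N and n :: nat and e where N: "x \<in> N" "local_frame M E N {..<n} e"
    using vector_bundle_frame[OF assms(1)] by blast
  note fr = local_frameD[OF N(2)]
  have NW: "openin (zariski M) (N \<inter> W)" using fr(1) assms(2) by blast
  have "\<exists>b. (\<forall>k<n. b k \<in> regular M (N \<inter> W)) \<and> (\<forall>y\<in>N \<inter> W. s i y = (\<Sum>k<n. b k y *\<^sub>C e k y))"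
    if "i \<in> I" for i
  proof -
    have "s i \<in> sections E (N \<inter> W)" using sh(1)[OF assms(2) NW] assms(5)[OF that] by blast
    then show ?thesis using fr(4)[OF NW] by auto
  qed
  then obtain b where b: "\<And>i k. i \<in> I \<Longrightarrow> k < n \<Longrightarrow> b i k \<in> regular M (N \<inter> W)"
    "\<And>i y. i \<in> I \<Longrightarrow> y \<in> N \<inter> W \<Longrightarrow> s i y = (\<Sum>k<n. b i k y *\<^sub>C e k y)" by metis
  have "(\<lambda>y. \<Sum>i\<in>I. a i y * b i k y) \<in> regular M (N \<inter> W)" if "k < n" for k
    using that b(1) regular_restrict[OF assms(2) NW _ assms(4)]
    by (intro regular_sum regular_mult NW) auto
  moreover have "t y = (\<Sum>k<n. (\<Sum>i\<in>I. a i y * b i k y) *\<^sub>C e k y)" if "y \<in> N \<inter> W" for y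
  proof -
    have "t y = (\<Sum>i\<in>I. \<Sum>k<n. (a i y * b i k y) *\<^sub>C e k y)"
      using that assms(6) b(2) by (simp add: complex_vector.scale_sum_right)
    then show ?thesis by (simp add: complex_vector.scale_sum_left sum.swap[of _ _ I])
  qed
  ultimately have "\<exists>c. (\<forall>k\<in>{..<n}. c k \<in> regular M (N \<inter> W)) \<and> (\<forall>y\<in>N \<inter> W. t y = (\<Sum>k<n. c k y *\<^sub>C e k y))"
    by (intro exI[of _ "\<lambda>k y. \<Sum>i\<in>I. a i y * b i k y"]) simp
  then have "t \<in> sections E (N \<inter> W)" using fr(4)[OF NW] by blast
  then show "\<exists>N. openin (zariski M) N \<and> x \<in> N \<and> N \<subseteq> W \<and> t \<in> sections E N"
    using NW N(1) x by blast
qed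

text \<open>Fibrewise linearity reduces regularity to the images of a frame near each point, since
  any section is a regular combination of the frame.\<close>

lemma bundle_morphismI:
  assumes "vector_bundle M E" "vector_bundle M F"
    and "\<And>x. x \<in> topspace (zariski M) \<Longrightarrow> clinear_on (fibre E x) (\<phi> x)"
    and "\<And>x v. x \<in> topspace (zariski M) \<Longrightarrow> v \<in> fibre E x \<Longrightarrow> \<phi> x v \<in> fibre F x"
    and "\<And>x. x \<in> topspace (zariski M) \<Longrightarrow> \<exists>N (I::'i set) e. x \<in> N \<and> local_frame M E N I e \<and>
      (\<forall>i\<in>I. (\<lambda>y. \<phi> y (e i y)) \<in> sections F N)"
  shows "bundle_morphism M E F \<phi>"
  unfolding bundle_morphism_def
proof (intro conjI ballI allI impI)
  fix W s assume "openin (zariski M) W \<and> s \<in> sections E W"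
  then have W: "openin (zariski M) W" "s \<in> sections E W" by auto
  show "(\<lambda>x. \<phi> x (s x)) \<in> sections F W"
  proof (rule bundle_sheafD(2)[OF vector_bundle_sheaf[OF assms(2)] W(1)])
    fix x assume x: "x \<in> W"
    have xt: "x \<in> topspace (zariski M)" using W(1) x openin_subset by blast
    obtain N and I :: "'i set" and e where N: "x \<in> N" "local_frame M E N I e"
      "\<forall>i\<in>I. (\<lambda>y. \<phi> y (e i y)) \<in> sections F N" using assms(5)[OF xt] by (elim exE conjE) (rule that)
    note fr = local_frameD[OF N(2)]
    have NW: "openin (zariski M) (N \<inter> W)" using fr(1) W(1) by blast
    have "s \<in> sections E (N \<inter> W)"
      using bundle_sheafD(1)[OF vector_bundle_sheaf[OF assms(1)] W(1) NW] W(2) by blast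
    then obtain a where a: "\<forall>i\<in>I. a i \<in> regular M (N \<inter> W)"
      "\<forall>y\<in>N \<inter> W. s y = (\<Sum>i\<in>I. a i y *\<^sub>C e i y)" using fr(4)[OF NW] by blast
    have "(\<lambda>x. \<phi> x (s x)) \<in> sections F (N \<inter> W)"
    proof (rule section_combination[OF assms(2) NW fr(2)])
      show "a i \<in> regular M (N \<inter> W)" if "i \<in> I" for i using a that by blast
      show "(\<lambda>y. \<phi> y (e i y)) \<in> sections F (N \<inter> W)" if "i \<in> I" for i
        using bundle_sheafD(1)[OF vector_bundle_sheaf[OF assms(2)] fr(1) NW _ bspec[OF N(3) that]] by blast
      fix y assume y: "y \<in> N \<inter> W"
      then have "y \<in> topspace (zariski M)" using W(1) openin_subset by blast
      from clinear_onD_sum[OF assms(3)[OF this], of I "\<lambda>i. e i y" "\<lambda>i. a i y"]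
      show "\<phi> y (s y) = (\<Sum>i\<in>I. a i y *\<^sub>C \<phi> y (e i y))"
        using a(2) y cbasisD(5,6)[OF fr(3)[of y]] by auto
    qed
    then show "\<exists>N. openin (zariski M) N \<and> x \<in> N \<and> N \<subseteq> W \<and> (\<lambda>x. \<phi> x (s x)) \<in> sections F N"
      using NW N(1) x by blast
  qed
qed (use assms(3,4) in auto)

subsection \<open>Constructions of bundles\<close>

lemma bundle_sheaf_trivial:
  fixes A :: "'a::complex_vector set"
  shows "bundle_sheaf M (trivial_bundle M A)"
proof (rule bundle_sheafI)
  fix W W' s assume "openin (zariski M) W" "openin (zariski M) W'" "W' \<subseteq> W" "s \<in> sections (trivial_bundle M A) W"
  then show "s \<in> sections (trivial_bundle M A) W'"
    using regular_restrict[of W W'] by (auto simp: trivial_bundle_def)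
next
  fix W s assume W: "openin (zariski M) W"
    and loc: "\<And>x. x \<in> W \<Longrightarrow> \<exists>N. openin (zariski M) N \<and> x \<in> N \<and> N \<subseteq> W \<and> s \<in> sections (trivial_bundle M A) N"
  show "s \<in> sections (trivial_bundle M A) W"
    unfolding trivial_bundle_def
  proof (clarsimp, intro conjI ballI allI impI)
    show "s x \<in> A" if "x \<in> W" for x using loc[OF that] by (auto simp: trivial_bundle_def)
    fix l :: "'a \<Rightarrow> complex" assume l: "clinear l"
    show "(\<lambda>x. l (s x)) \<in> regular M W"
    proof (rule regular_glue[OF W])
      fix x assume "x \<in> W"
      then show "\<exists>N. openin (zariski M) N \<and> x \<in> N \<and> N \<subseteq> W \<and> (\<lambda>x. l (s x)) \<in> regular M N"
        using loc[of x] l by (auto simp: trivial_bundle_def)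
    qed
  qed
qed

lemma trivial_sections_iff:
  "s \<in> sections (trivial_bundle M A) W \<longleftrightarrow>
    (\<forall>x\<in>W. s x \<in> A) \<and> (\<forall>l::_ \<Rightarrow> complex. clinear l \<longrightarrow> (\<lambda>x. l (s x)) \<in> regular M W)"
  by (simp add: trivial_bundle_def)

lemma trivial_section_const:
  "openin (zariski M) W \<Longrightarrow> v \<in> A \<Longrightarrow> (\<lambda>_. v) \<in> sections (trivial_bundle M A) W"
  by (simp add: trivial_sections_iff regular_const)

lemma trivial_section_clinear:
  assumes "s \<in> sections (trivial_bundle M A) W" "clinear f" "\<And>x. x \<in> W \<Longrightarrow> f (s x) \<in> A'"
  shows "(\<lambda>x. f (s x)) \<in> sections (trivial_bundle M A') W"
  using assms clinear_compose[OF assms(2)] by (auto simp: trivial_sections_iff)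

lemma trivial_section_sum:
  fixes A :: "'a::complex_vector set"
  assumes "openin (zariski M) W" "csubspace A"
    and "\<And>i. i \<in> I \<Longrightarrow> a i \<in> regular M W" "\<And>i. i \<in> I \<Longrightarrow> s i \<in> sections (trivial_bundle M A) W"
    and "\<And>y. y \<in> W \<Longrightarrow> t y = (\<Sum>i\<in>I. a i y *\<^sub>C s i y)"
  shows "t \<in> sections (trivial_bundle M A) W"
  unfolding trivial_sections_iff
proof (intro conjI ballI allI impI)
  show "t x \<in> A" if "x \<in> W" for x
    unfolding assms(5)[OF that] using assms(4) that
    by (intro complex_vector.subspace_sum complex_vector.subspace_scale assms(2)) (auto simp: trivial_sections_iff)
  fix l :: "'a \<Rightarrow> complex" assume l: "clinear l"
  have "(\<lambda>y. \<Sum>i\<in>I. a i y * l (s i y)) \<in> regular M W"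
    using assms(3,4) l by (intro regular_sum regular_mult assms(1)) (auto simp: trivial_sections_iff)
  then show "(\<lambda>x. l (t x)) \<in> regular M W"
    by (rule regular_cong[OF assms(1)]) (simp add: assms(5) clinear_sum[OF l] clinear_scale[OF l])
qed

lemma local_frame_trivial:
  assumes "cbasis J b A" "openin (zariski M) N"
  shows "local_frame M (trivial_bundle M A) N J (\<lambda>j _. b j)"
proof (rule local_frameI)
  note J = cbasisD[OF assms(1)]
  show "cbasis J b (fibre (trivial_bundle M A) y)" for y using assms(1) by (simp add: trivial_bundle_def)
  fix W s assume W: "openin (zariski M) W" "W \<subseteq> N"
  {
    assume s: "s \<in> sections (trivial_bundle M A) W"
    have "(\<lambda>y. dual_family J b j (s y)) \<in> regular M W" if j: "j \<in> J" for j
    proof -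
      \<comment> \<open>Sections of a trivial bundle are tested by forms on the ambient space, so
        the coordinate along \<open>b j\<close> is replaced by a form defined everywhere that agrees
        with it on \<open>A\<close>.\<close>
      obtain l where l: "clinear l" "\<forall>i\<in>J. l (b i) = (if i = j then 1 else 0 :: complex)"
        using linear_functional_family[OF J(3,2), of "\<lambda>i. if i = j then 1 else 0"]
        by (elim exE conjE) (rule that)
      have "l (s y) = dual_family J b j (s y)" if "y \<in> W" for y
      proof -
        have "l (\<Sum>i\<in>J. dual_family J b i (s y) *\<^sub>C b i) = (\<Sum>i\<in>J. if i = j then dual_family J b i (s y) else 0)"
          using l by (auto simp: clinear_sum clinear_scale intro!: sum.cong)
        then show ?thesis
          using dual_family_expand[OF assms(1), of "s y"] s that j J(1) by (auto simp: trivial_sections_iff)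
      qed
      note eq = this
      have "(\<lambda>y. l (s y)) \<in> regular M W" using s l(1) by (simp add: trivial_sections_iff)
      then show ?thesis by (rule regular_cong[OF W(1) _ eq])
    qed
    moreover have "s y = (\<Sum>j\<in>J. dual_family J b j (s y) *\<^sub>C b j)" if "y \<in> W" for y
      using s that by (intro dual_family_expand[OF assms(1)]) (auto simp: trivial_sections_iff)
    ultimately show "\<exists>a. (\<forall>i\<in>J. a i \<in> regular M W) \<and> (\<forall>y\<in>W. s y = (\<Sum>i\<in>J. a i y *\<^sub>C b i))"
      by (intro exI[of _ "\<lambda>j y. dual_family J b j (s y)"]) blast
  next
    fix a assume a: "\<And>i. i \<in> J \<Longrightarrow> a i \<in> regular M W" "\<And>y. y \<in> W \<Longrightarrow> s y = (\<Sum>i\<in>J. a i y *\<^sub>C b i)"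
    show "s \<in> sections (trivial_bundle M A) W"
      by (rule trivial_section_sum[OF W(1) J(5) a(1) trivial_section_const[OF W(1) J(6)] a(2)])
  }
qed (use assms cbasisD(1) in auto)

lemma bundle_sheaf_sub:
  assumes "bundle_sheaf M E" shows "bundle_sheaf M (sub_bundle E F)"
proof (rule bundle_sheafI)
  fix W W' s assume "openin (zariski M) W" "openin (zariski M) W'" "W' \<subseteq> W" "s \<in> sections (sub_bundle E F) W"
  then show "s \<in> sections (sub_bundle E F) W'"
    using bundle_sheafD(1)[OF assms, of W W' s] by (auto simp: sub_bundle_def)
next
  fix W s assume W: "openin (zariski M) W"
    and loc: "\<And>x. x \<in> W \<Longrightarrow> \<exists>N. openin (zariski M) N \<and> x \<in> N \<and> N \<subseteq> W \<and> s \<in> sections (sub_bundle E F) N"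
  have "s \<in> sections E W"
    by (rule bundle_sheafD(2)[OF assms W]) (use loc in \<open>fastforce simp: sub_bundle_def\<close>)
  moreover have "\<forall>x\<in>W. s x \<in> F x" using loc by (fastforce simp: sub_bundle_def)
  ultimately show "s \<in> sections (sub_bundle E F) W" by (simp add: sub_bundle_def)
qed

text \<open>The forms \<open>l i\<close> do not vary with the point and are dual to the frame, so
  \<open>l i (s y)\<close> is at once the coefficient of \<open>s\<close> and regular. It is applied
  to the tautological bundle and to the line of pure spinors.\<close>

lemma local_frame_sub_trivial:
  assumes "openin (zariski M) N" "\<And>y. y \<in> N \<Longrightarrow> cbasis I (\<lambda>i. e i y) (F y)" "finite I"
    and "\<And>i. i \<in> I \<Longrightarrow> e i \<in> sections (trivial_bundle M UNIV) N"
    and "\<And>i. i \<in> I \<Longrightarrow> clinear (l i)" "\<And>i j y. i \<in> I \<Longrightarrow> j \<in> I \<Longrightarrow> y \<in> N \<Longrightarrow> l i (e j y) = (if i = j then 1 else 0 :: complex)"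
  shows "local_frame M (sub_bundle (trivial_bundle M UNIV) F) N I e"
proof (rule local_frameI)
  show "cbasis I (\<lambda>i. e i y) (fibre (sub_bundle (trivial_bundle M UNIV) F) y)" if "y \<in> N" for y
    using assms(2)[OF that] by (simp add: sub_bundle_def)
  fix W s assume W: "openin (zariski M) W" "W \<subseteq> N"
  {
    assume "s \<in> sections (sub_bundle (trivial_bundle M UNIV) F) W"
    then have s: "s \<in> sections (trivial_bundle M UNIV) W" "\<And>y. y \<in> W \<Longrightarrow> s y \<in> F y"
      by (auto simp: sub_bundle_def)
    have "s y = (\<Sum>i\<in>I. l i (s y) *\<^sub>C e i y)" if y: "y \<in> W" for y
    proof -
      have yN: "y \<in> N" using y W by blast
      note ex = dual_family_expand[OF assms(2)[OF yN] s(2)[OF y]]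
      have "l i (s y) = dual_family I (\<lambda>i. e i y) i (s y)" if i: "i \<in> I" for i
      proof -
        have "l i (s y) = (\<Sum>j\<in>I. dual_family I (\<lambda>i. e i y) j (s y) * l i (e j y))"
          using arg_cong[OF ex, of "l i"]
          by (simp only: clinear_sum[OF assms(5)[OF i]] clinear_scale[OF assms(5)[OF i]] scaleC_complex)
        also have "\<dots> = (\<Sum>j\<in>I. if i = j then dual_family I (\<lambda>i. e i y) j (s y) else 0)"
          by (intro sum.cong) (use assms(6) i yN in auto)
        finally show ?thesis using i assms(3) by simp
      qed
      then show ?thesis using ex by simp
    qed
    moreover have "(\<lambda>y. l i (s y)) \<in> regular M W" if "i \<in> I" for i
      using s(1) assms(5)[OF that] by (simp add: trivial_sections_iff)
    ultimately show "\<exists>a. (\<forall>i\<in>I. a i \<in> regular M W) \<and> (\<forall>y\<in>W. s y = (\<Sum>i\<in>I. a i y *\<^sub>C e i y))"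
      by (intro exI[of _ "\<lambda>i y. l i (s y)"]) blast
  next
    fix a assume a: "\<And>i. i \<in> I \<Longrightarrow> a i \<in> regular M W" "\<And>y. y \<in> W \<Longrightarrow> s y = (\<Sum>i\<in>I. a i y *\<^sub>C e i y)"
    have eW: "e i \<in> sections (trivial_bundle M UNIV) W" if "i \<in> I" for i
      using bundle_sheafD(1)[OF bundle_sheaf_trivial assms(1) W assms(4)[OF that]] .
    have "s \<in> sections (trivial_bundle M UNIV) W"
      by (rule trivial_section_sum[OF W(1) complex_vector.subspace_UNIV a(1) eW a(2)])
    moreover have "s y \<in> F y" if "y \<in> W" for y
    proof -
      have "y \<in> N" using that W by blast
      from cbasisD(5,6)[OF assms(2)[OF this]] show ?thesis
        unfolding a(2)[OF that] by (intro complex_vector.subspace_sum complex_vector.subspace_scale) auto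
    qed
    ultimately show "s \<in> sections (sub_bundle (trivial_bundle M UNIV) F) W" by (simp add: sub_bundle_def)
  }
qed (use assms in auto)

lemma bundle_sheaf_dual:
  assumes "bundle_sheaf M E" shows "bundle_sheaf M (dual_bundle M E)"
proof (rule bundle_sheafI)
  fix W W' f assume "openin (zariski M) W" "openin (zariski M) W'" "W' \<subseteq> W" "f \<in> sections (dual_bundle M E) W"
  then show "f \<in> sections (dual_bundle M E) W'" by (fastforce simp: dual_bundle_def)
next
  fix W f assume W: "openin (zariski M) W"
    and loc: "\<And>x. x \<in> W \<Longrightarrow> \<exists>N. openin (zariski M) N \<and> x \<in> N \<and> N \<subseteq> W \<and> f \<in> sections (dual_bundle M E) N"
  have "f x \<in> dual_space (fibre E x)" if "x \<in> W" for x
    using loc[OF that] by (auto simp: dual_bundle_def)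
  moreover have "(\<lambda>x. f x (s x)) \<in> regular M W'"
    if W': "openin (zariski M) W'" "W' \<subseteq> W" "s \<in> sections E W'" for W' s
  proof (rule regular_glue[OF W'(1)])
    fix x assume x: "x \<in> W'"
    then obtain N where N: "openin (zariski M) N" "x \<in> N" "f \<in> sections (dual_bundle M E) N"
      using loc[of x] W' by blast
    \<comment> \<open>Test sections live on smaller open sets, so the regularity is first obtained
      on the overlap with a neighbourhood where \<open>f\<close> is known to be a section.\<close>
    have NW: "openin (zariski M) (N \<inter> W')" using N W' by blast
    have "s \<in> sections E (N \<inter> W')" using bundle_sheafD(1)[OF assms W'(1) NW] W'(3) by blast
    then have "(\<lambda>x. f x (s x)) \<in> regular M (N \<inter> W')" using N(3) NW by (auto simp: dual_bundle_def)
    then show "\<exists>N. openin (zariski M) N \<and> x \<in> N \<and> N \<subseteq> W' \<and> (\<lambda>x. f x (s x)) \<in> regular M N"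
      using NW N x by blast
  qed
  ultimately show "f \<in> sections (dual_bundle M E) W" by (simp add: dual_bundle_def)
qed

lemma local_frame_dual:
  assumes "local_frame M E N I e"
  shows "local_frame M (dual_bundle M E) N I (\<lambda>i y. dual_family I (\<lambda>i. e i y) i)"
proof (rule local_frameI)
  note fr = local_frameD[OF assms]
  show "openin (zariski M) N" "finite I" by fact+
  show "cbasis I (\<lambda>i. dual_family I (\<lambda>i. e i y) i) (fibre (dual_bundle M E) y)" if "y \<in> N" for y
    using cbasis_dual[OF fr(3)[OF that]] by (simp add: dual_bundle_def)
  fix W f assume W: "openin (zariski M) W" "W \<subseteq> N"
  {
    assume f: "f \<in> sections (dual_bundle M E) W"
    have "(\<lambda>y. f y (e i y)) \<in> regular M W" if "i \<in> I" for i
      using f W local_frame_section[OF assms W that] by (auto simp: dual_bundle_def)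
    moreover have "f y = (\<Sum>i\<in>I. f y (e i y) *\<^sub>C dual_family I (\<lambda>i. e i y) i)" if "y \<in> W" for y
    proof -
      have "y \<in> N" using that W by blast
      then show ?thesis using f that by (intro dual_space_expand[OF fr(3)]) (auto simp: dual_bundle_def)
    qed
    ultimately show "\<exists>a. (\<forall>i\<in>I. a i \<in> regular M W) \<and> (\<forall>y\<in>W. f y = (\<Sum>i\<in>I. a i y *\<^sub>C dual_family I (\<lambda>i. e i y) i))"
      by (intro exI[of _ "\<lambda>i y. f y (e i y)"]) blast
  next
    fix a assume a: "\<And>i. i \<in> I \<Longrightarrow> a i \<in> regular M W"
      "\<And>y. y \<in> W \<Longrightarrow> f y = (\<Sum>i\<in>I. a i y *\<^sub>C dual_family I (\<lambda>i. e i y) i)"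
    have "f y \<in> dual_space (fibre E y)" if "y \<in> W" for y
    proof -
      have "y \<in> N" using that W by blast
      from dual_family_in_dual[OF fr(3)[OF this]] show ?thesis
        unfolding a(2)[OF that]
        by (intro complex_vector.subspace_sum complex_vector.subspace_scale dual_space_subspace)
    qed
    moreover have "(\<lambda>x. f x (s x)) \<in> regular M W'"
      if W': "openin (zariski M) W'" "W' \<subseteq> W" "s \<in> sections E W'" for W' s
    proof -
      have "(\<lambda>y. \<Sum>i\<in>I. a i y * dual_family I (\<lambda>i. e i y) i (s y)) \<in> regular M W'"
        using W W' regular_restrict[OF W(1) W'(1,2) a(1)] local_frame_coefficient[OF assms W'(1)]
        by (intro regular_sum regular_mult W') auto
      then show ?thesis
        by (rule regular_cong[OF W'(1)]) (use a(2) W'(2) in \<open>auto simp: sum_fun_apply\<close>)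
    qed
    ultimately show "f \<in> sections (dual_bundle M E) W" by (auto simp: dual_bundle_def)
  }
qed

lemma tensor_sectionE:
  assumes "t \<in> sections (tensor_bundle M E F) W" "x \<in> W"
  obtains N and n :: nat and e f where "openin (zariski M) N" "x \<in> N" "N \<subseteq> W"
    "\<And>k. k < n \<Longrightarrow> e k \<in> sections E N" "\<And>k. k < n \<Longrightarrow> f k \<in> sections F N"
    "\<And>y. y \<in> N \<Longrightarrow> t y = (\<Sum>k<n. tens (e k y) (f k y))"
proof -
  have "\<forall>x\<in>W. \<exists>N (n::nat) e f. openin (zariski M) N \<and> x \<in> N \<and> N \<subseteq> W \<and>
       (\<forall>i<n. e i \<in> sections E N \<and> f i \<in> sections F N) \<and>
       (\<forall>y\<in>N. t y = (\<Sum>i<n. tens (e i y) (f i y)))"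
    using assms(1) by (simp only: tensor_bundle_def vbundle.select_convs mem_Collect_eq)
  from bspec[OF this assms(2)] obtain N and n :: nat and e f where
    "openin (zariski M) N" "x \<in> N" "N \<subseteq> W" "\<forall>i<n. e i \<in> sections E N \<and> f i \<in> sections F N"
    "\<forall>y\<in>N. t y = (\<Sum>i<n. tens (e i y) (f i y))"
    by (elim exE conjE) (rule that)
  then show ?thesis by (intro that[of N n e f]) simp_all
qed

lemma bundle_sheaf_tensor:
  assumes "bundle_sheaf M E" "bundle_sheaf M F" shows "bundle_sheaf M (tensor_bundle M E F)"
proof (rule bundle_sheafI)
  fix W W' t assume W: "openin (zariski M) W" "openin (zariski M) W'" "W' \<subseteq> W"
    and t: "t \<in> sections (tensor_bundle M E F) W"
  show "t \<in> sections (tensor_bundle M E F) W'"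
    unfolding tensor_bundle_def
  proof (clarsimp)
    fix x assume x: "x \<in> W'"
    with W(3) have "x \<in> W" by blast
    from tensor_sectionE[OF t this] obtain N and n :: nat and e f
      where N: "openin (zariski M) N" "x \<in> N" "N \<subseteq> W"
        "\<And>k. k < n \<Longrightarrow> e k \<in> sections E N" "\<And>k. k < n \<Longrightarrow> f k \<in> sections F N"
        "\<And>y. y \<in> N \<Longrightarrow> t y = (\<Sum>k<n. tens (e k y) (f k y))" by blast
    have NW: "openin (zariski M) (N \<inter> W')" using N W by blast
    have ef: "\<forall>i<n. e i \<in> sections E (N \<inter> W') \<and> f i \<in> sections F (N \<inter> W')"
      using N(4,5) bundle_sheafD(1)[OF assms(1) N(1) NW] bundle_sheafD(1)[OF assms(2) N(1) NW] by auto
    show "\<exists>N. openin (zariski M) N \<and> x \<in> N \<and> N \<subseteq> W' \<and>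
        (\<exists>(n::nat) e f. (\<forall>i<n. e i \<in> sections E N \<and> f i \<in> sections F N) \<and> (\<forall>y\<in>N. t y = (\<Sum>i<n. tens (e i y) (f i y))))"
    proof (rule exI[of _ "N \<inter> W'"], intro conjI)
      show "\<exists>(n::nat) e f. (\<forall>i<n. e i \<in> sections E (N \<inter> W') \<and> f i \<in> sections F (N \<inter> W')) \<and>
          (\<forall>y\<in>N \<inter> W'. t y = (\<Sum>i<n. tens (e i y) (f i y)))"
        by (rule exI[of _ n], rule exI[of _ e], rule exI[of _ f]) (use ef N(6) in simp)
    qed (use NW N(2) x in auto)
  qed
next
  fix W t assume W: "openin (zariski M) W"
    and loc: "\<And>x. x \<in> W \<Longrightarrow> \<exists>N. openin (zariski M) N \<and> x \<in> N \<and> N \<subseteq> W \<and> t \<in> sections (tensor_bundle M E F) N"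
  show "t \<in> sections (tensor_bundle M E F) W"
    unfolding tensor_bundle_def
  proof (clarsimp)
    fix x assume "x \<in> W"
    then obtain N where N: "x \<in> N" "N \<subseteq> W" "t \<in> sections (tensor_bundle M E F) N" using loc by blast
    from tensor_sectionE[OF N(3,1)] obtain N' and n :: nat and e f
      where N': "openin (zariski M) N'" "x \<in> N'" "N' \<subseteq> N"
        "\<And>k. k < n \<Longrightarrow> e k \<in> sections E N'" "\<And>k. k < n \<Longrightarrow> f k \<in> sections F N'"
        "\<And>y. y \<in> N' \<Longrightarrow> t y = (\<Sum>k<n. tens (e k y) (f k y))" by blast
    show "\<exists>N. openin (zariski M) N \<and> x \<in> N \<and> N \<subseteq> W \<and>
        (\<exists>(n::nat) e f. (\<forall>i<n. e i \<in> sections E N \<and> f i \<in> sections F N) \<and> (\<forall>y\<in>N. t y = (\<Sum>i<n. tens (e i y) (f i y))))"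
    proof (rule exI[of _ N'], intro conjI)
      show "\<exists>(n::nat) e f. (\<forall>i<n. e i \<in> sections E N' \<and> f i \<in> sections F N') \<and>
          (\<forall>y\<in>N'. t y = (\<Sum>i<n. tens (e i y) (f i y)))"
        by (rule exI[of _ n], rule exI[of _ e], rule exI[of _ f]) (use N' in simp)
    qed (use N' N(2) in auto)
  qed
qed

lemma tensor_sectionI:
  assumes "openin (zariski M) W" "finite K"
    and "\<And>k. k \<in> K \<Longrightarrow> e k \<in> sections E W" "\<And>k. k \<in> K \<Longrightarrow> f k \<in> sections F W"
    and "\<And>y. y \<in> W \<Longrightarrow> t y = (\<Sum>k\<in>K. tens (e k y) (f k y))"
  shows "t \<in> sections (tensor_bundle M E F) W"
proof -
  obtain h where h: "bij_betw h {..<card K} K"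
    using ex_bij_betw_nat_finite[OF assms(2)] by (auto simp: atLeast0LessThan)
  have mem: "h i \<in> K" if "i < card K" for i using bij_betwE[OF h] that by auto
  have "t y = (\<Sum>i<card K. tens (e (h i) y) (f (h i) y))" if "y \<in> W" for y
    using assms(5)[OF that] sum.reindex_bij_betw[OF h, of "\<lambda>k. tens (e k y) (f k y)"] by simp
  then show ?thesis
    unfolding tensor_bundle_def using assms mem
    by (auto intro!: exI[of _ W] exI[of _ "card K"] exI[of _ "\<lambda>i. e (h i)"] exI[of _ "\<lambda>i. f (h i)"])
qed

lemma tensor_section_tens:
  assumes "openin (zariski M) W" "e \<in> sections E W" "f \<in> sections F W"
  shows "(\<lambda>y. tens (e y) (f y)) \<in> sections (tensor_bundle M E F) W"
  using assms by (intro tensor_sectionI[of W "{()}" "\<lambda>_. e" E "\<lambda>_. f"]) auto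

text \<open>A section of a tensor product is only locally a sum of pure tensors, with no uniform
  number of terms. Its coordinates are nevertheless determined in each fibre, so they can be defined
  at once over \<open>W\<close> and shown regular locally.\<close>

lemma local_frame_tensor:
  assumes "local_frame M E N I e" "local_frame M F N J f"
  shows "local_frame M (tensor_bundle M E F) N (I \<times> J) (\<lambda>(i, j) y. tens (e i y) (f j y))"
proof (rule local_frameI)
  note E = local_frameD[OF assms(1)] and F = local_frameD[OF assms(2)]
  show "openin (zariski M) N" "finite (I \<times> J)" using E F by auto
  have basis: "cbasis (I \<times> J) (\<lambda>p. case p of (i, j) \<Rightarrow> tens (e i y) (f j y)) (tensor_space (fibre E y) (fibre F y))"
    if "y \<in> N" for y using cbasis_tens[OF E(3)[OF that] F(3)[OF that]] .
  then show "cbasis (I \<times> J) (\<lambda>p. (case p of (i, j) \<Rightarrow> \<lambda>y. tens (e i y) (f j y)) y) (fibre (tensor_bundle M E F) y)"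
    if "y \<in> N" for y using that by (simp add: tensor_bundle_def case_prod_beta)
  fix W t assume W: "openin (zariski M) W" "W \<subseteq> N"
  let ?d = "\<lambda>p y. dual_family (I \<times> J) (\<lambda>p. case p of (i, j) \<Rightarrow> tens (e i y) (f j y)) p (t y)"
  {
    assume t: "t \<in> sections (tensor_bundle M E F) W"
    have loc: "\<exists>N'. openin (zariski M) N' \<and> x \<in> N' \<and> N' \<subseteq> W \<and> (\<forall>p\<in>I \<times> J. ?d p \<in> regular M N') \<and>
        t x = (\<Sum>p\<in>I \<times> J. ?d p x *\<^sub>C (case p of (i, j) \<Rightarrow> tens (e i x) (f j x)))" if x: "x \<in> W" for x
    proof -
      obtain N' and n :: nat and e' f' where N': "openin (zariski M) N'" "x \<in> N'" "N' \<subseteq> W"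
        "\<And>k. k < n \<Longrightarrow> e' k \<in> sections E N'" "\<And>k. k < n \<Longrightarrow> f' k \<in> sections F N'"
        "\<And>y. y \<in> N' \<Longrightarrow> t y = (\<Sum>k<n. tens (e' k y) (f' k y))"
        using tensor_sectionE[OF t x] by blast
      have N'N: "N' \<subseteq> N" using N' W by blast
      let ?a = "\<lambda>k i y. dual_family I (\<lambda>i. e i y) i (e' k y)"
      let ?b = "\<lambda>k j y. dual_family J (\<lambda>j. f j y) j (f' k y)"
      have in_E: "e' k y \<in> fibre E y" if "k < n" "y \<in> N'" for k y
        using local_frame_in_fibre[OF assms(1) N'(1) N'N N'(4)] that by blast
      have in_F: "f' k y \<in> fibre F y" if "k < n" "y \<in> N'" for k y
        using local_frame_in_fibre[OF assms(2) N'(1) N'N N'(5)] that by blast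
      \<comment> \<open>Each local pure tensor is expanded in both frames; collecting terms exhibits
        the coordinates as sums of products of regular functions.\<close>
      have ex: "t y = (\<Sum>p\<in>I \<times> J. (\<Sum>k<n. ?a k (fst p) y * ?b k (snd p) y) *\<^sub>C
          (case p of (i, j) \<Rightarrow> tens (e i y) (f j y)))" if y: "y \<in> N'" for y
      proof -
        have yN: "y \<in> N" using y N'N by blast
        have "tens (e' k y) (f' k y) = (\<Sum>p\<in>I \<times> J. (?a k (fst p) y * ?b k (snd p) y) *\<^sub>C
            (case p of (i, j) \<Rightarrow> tens (e i y) (f j y)))" if k: "k < n" for k
        proof -
          have "tens (e' k y) (f' k y) = tens (\<Sum>i\<in>I. ?a k i y *\<^sub>C e i y) (\<Sum>j\<in>J. ?b k j y *\<^sub>C f j y)"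
            using dual_family_expand[OF E(3)[OF yN] in_E[OF k y]] dual_family_expand[OF F(3)[OF yN] in_F[OF k y]]
            by simp
          also have "\<dots> = (\<Sum>i\<in>I. \<Sum>j\<in>J. (?a k i y * ?b k j y) *\<^sub>C tens (e i y) (f j y))"
            by (simp only: tens_simps complex_vector.scale_sum_right scaleC_scaleC)
              (subst sum.swap, simp only: mult.commute)
          finally show ?thesis by (simp add: sum.cartesian_product case_prod_beta)
        qed
        then have "t y = (\<Sum>k<n. \<Sum>p\<in>I \<times> J. (?a k (fst p) y * ?b k (snd p) y) *\<^sub>C
            (case p of (i, j) \<Rightarrow> tens (e i y) (f j y)))" using N'(6)[OF y] by simp
        then show ?thesis by (simp only: complex_vector.scale_sum_left sum.swap[of _ "{..<n}"])
      qed
      have d: "?d p y = (\<Sum>k<n. ?a k (fst p) y * ?b k (snd p) y)" if y: "y \<in> N'" "p \<in> I \<times> J" for p y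
      proof -
        have "y \<in> N" using y N'N by blast
        from dual_family_sum[OF basis[OF this] y(2), of "\<lambda>p. \<Sum>k<n. ?a k (fst p) y * ?b k (snd p) y"]
        show ?thesis unfolding ex[OF y(1), symmetric] .
      qed
      have "?d p \<in> regular M N'" if p: "p \<in> I \<times> J" for p
      proof (rule regular_cong[OF N'(1)])
        show "(\<lambda>y. \<Sum>k<n. ?a k (fst p) y * ?b k (snd p) y) \<in> regular M N'"
          using p N'(4,5) N'N
          by (intro regular_sum regular_mult N'(1) local_frame_coefficient[OF assms(1)]
              local_frame_coefficient[OF assms(2)]) auto
      qed (use d[OF _ p] in auto)
      moreover have "t x = (\<Sum>p\<in>I \<times> J. ?d p x *\<^sub>C (case p of (i, j) \<Rightarrow> tens (e i x) (f j x)))"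
        unfolding ex[OF N'(2)] by (rule sum.cong) (simp_all add: d[OF N'(2)] ex[OF N'(2), symmetric])
      ultimately show ?thesis using N'(1-3) by blast
    qed
    have "?d p \<in> regular M W" if "p \<in> I \<times> J" for p
      by (rule regular_glue[OF W(1)]) (use loc that in blast)
    moreover have "t x = (\<Sum>p\<in>I \<times> J. ?d p x *\<^sub>C (case p of (i, j) \<Rightarrow> tens (e i x) (f j x)))" if "x \<in> W" for x
      using loc[OF that] by blast
    ultimately show "\<exists>a. (\<forall>p\<in>I \<times> J. a p \<in> regular M W) \<and>
        (\<forall>y\<in>W. t y = (\<Sum>p\<in>I \<times> J. a p y *\<^sub>C (case p of (i, j) \<Rightarrow> \<lambda>y. tens (e i y) (f j y)) y))"
      by (intro exI[of _ ?d]) (simp add: case_prod_beta)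
  next
    fix a assume a: "\<And>p. p \<in> I \<times> J \<Longrightarrow> a p \<in> regular M W"
      "\<And>y. y \<in> W \<Longrightarrow> t y = (\<Sum>p\<in>I \<times> J. a p y *\<^sub>C (case p of (i, j) \<Rightarrow> \<lambda>y. tens (e i y) (f j y)) y)"
    show "t \<in> sections (tensor_bundle M E F) W"
    proof (rule tensor_sectionI[OF W(1), of "I \<times> J" "\<lambda>p y. a p y *\<^sub>C e (fst p) y" E "\<lambda>p. f (snd p)"])
      show "t y = (\<Sum>p\<in>I \<times> J. tens (a p y *\<^sub>C e (fst p) y) (f (snd p) y))" if "y \<in> W" for y
        unfolding a(2)[OF that] by (rule sum.cong) (auto simp: tens_simps)
    qed (use E F a W local_frame_scaled_section[OF assms(1) W] local_frame_section[OF assms(2) W] in auto)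
  }
qed

text \<open>Pairs with \<open>i \<le> j\<close> suffice by symmetry of the coefficients. On the
  diagonal the basis vector is twice a square, hence the factors 2 and 1/2 when passing to full
  coefficients and back.\<close>

lemma local_frame_sym2:
  fixes e :: "'i::linorder \<Rightarrow> 'x \<Rightarrow> 'a::complex_vector"
  assumes "local_frame M E N I e"
  shows "local_frame M (sym2_bundle M E) N {(i, j). i \<in> I \<and> j \<in> I \<and> i \<le> j}
    (\<lambda>(i, j) y. tens (e i y) (e j y) + tens (e j y) (e i y))"
proof -
  note E = local_frameD[OF assms] and T = local_frameD[OF local_frame_tensor[OF assms assms]]
  let ?K = "{(i, j). i \<in> I \<and> j \<in> I \<and> i \<le> j}"
  let ?s = "\<lambda>i j y. tens (e i y) (e j y) + tens (e j y) (e i y)"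
  have fin: "finite ?K" by (rule finite_subset[of _ "I \<times> I"]) (use E(2) in auto)
  \<comment> \<open>Passage from triangular to full coefficients: the pairs are split by
    \<open>i < j\<close>, \<open>i = j\<close> and \<open>j < i\<close>, and the last kind is
    reflected by \<open>prod.swap\<close>.\<close>
  have tri: "(\<Sum>p\<in>?K. x p *\<^sub>C (case p of (i, j) \<Rightarrow> ?s i j y)) =
      (\<Sum>p\<in>I \<times> I. (x (min (fst p) (snd p), max (fst p) (snd p)) * (if fst p = snd p then 2 else 1)) *\<^sub>C
        (case p of (i, j) \<Rightarrow> tens (e i y) (e j y)))" for x :: "'i \<times> 'i \<Rightarrow> complex" and y
  proof -
    let ?L = "{(i, j). i \<in> I \<and> j \<in> I \<and> i < j}" and ?D = "(\<lambda>i. (i, i)) ` I" and ?U = "{(i, j). i \<in> I \<and> j \<in> I \<and> j < i}"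
    let ?t = "\<lambda>i j. tens (e i y) (e j y)"
    let ?g = "\<lambda>p. (x (min (fst p) (snd p), max (fst p) (snd p)) * (if fst p = snd p then 2 else 1)) *\<^sub>C
        (case p of (i, j) \<Rightarrow> ?t i j)"
    have finL: "finite ?L" "finite ?D" "finite ?U"
      by (rule finite_subset[of _ "I \<times> I"]; use E(2) in auto)+
    have "(\<Sum>p\<in>?K. x p *\<^sub>C (case p of (i, j) \<Rightarrow> ?s i j y)) =
        (\<Sum>p\<in>?L. x p *\<^sub>C (case p of (i, j) \<Rightarrow> ?s i j y)) + (\<Sum>p\<in>?D. x p *\<^sub>C (case p of (i, j) \<Rightarrow> ?s i j y))"
      by (subst sum.union_disjoint[symmetric]) (use finL in \<open>auto intro!: sum.cong\<close>)
    also have "(\<Sum>p\<in>?L. x p *\<^sub>C (case p of (i, j) \<Rightarrow> ?s i j y)) = (\<Sum>p\<in>?L. ?g p) + (\<Sum>p\<in>?U. ?g p)"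
    proof -
      have "(\<Sum>p\<in>?U. ?g p) = (\<Sum>(i, j)\<in>?L. x (i, j) *\<^sub>C ?t j i)"
        by (rule sum.reindex_bij_witness[of _ prod.swap prod.swap]) (auto simp: min_def max_def)
      moreover have "(\<Sum>p\<in>?L. ?g p) = (\<Sum>(i, j)\<in>?L. x (i, j) *\<^sub>C ?t i j)"
        by (rule sum.cong) (auto simp: min_def max_def)
      ultimately show ?thesis
        by (simp only: sum.distrib[symmetric] case_prod_beta scaleC_add_right prod.collapse)
    qed
    also have "(\<Sum>p\<in>?D. x p *\<^sub>C (case p of (i, j) \<Rightarrow> ?s i j y)) = (\<Sum>p\<in>?D. ?g p)"
      by (rule sum.cong) (auto simp: scaleC_add_right scaleC_add_left[symmetric])
    also have "(\<Sum>p\<in>?L. ?g p) + (\<Sum>p\<in>?U. ?g p) + (\<Sum>p\<in>?D. ?g p) = (\<Sum>p\<in>(?L \<union> ?U) \<union> ?D. ?g p)"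
      by (subst sum.union_disjoint, use finL in auto)+
    also have "(?L \<union> ?U) \<union> ?D = I \<times> I" by auto
    finally show ?thesis .
  qed
  have basis: "cbasis (I \<times> I) (\<lambda>p. case p of (i, j) \<Rightarrow> tens (e i y) (e j y)) (tensor_space (fibre E y) (fibre E y))"
    if "y \<in> N" for y using cbasis_tens[OF E(3)[OF that] E(3)[OF that]] .
  have sym_coeff: "\<exists>x. (\<forall>p\<in>?K. x p = a p * (if fst p = snd p then 1 / 2 else 1)) \<and>
      t = (\<Sum>p\<in>?K. x p *\<^sub>C (case p of (i, j) \<Rightarrow> ?s i j y))"
    if y: "y \<in> N" and t: "t = (\<Sum>p\<in>I \<times> I. a p *\<^sub>C (case p of (i, j) \<Rightarrow> tens (e i y) (e j y)))"
      and sym: "t \<in> sym2_space (fibre E y)" for t a y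
  proof -
    have "t = (\<Sum>i\<in>I. \<Sum>j\<in>I. a (i, j) *\<^sub>C tens (e i y) (e j y))"
      unfolding t by (simp add: sum.cartesian_product case_prod_beta)
    then have s: "a (i, j) = a (j, i)" if "i \<in> I" "j \<in> I" for i j
      using sym2_coefficients[OF E(3)[OF y], of "\<lambda>i j. a (i, j)"] sym that by metis
    let ?x = "\<lambda>p. a p * (if fst p = snd p then 1 / 2 else 1)"
    have "(\<Sum>p\<in>?K. ?x p *\<^sub>C (case p of (i, j) \<Rightarrow> ?s i j y)) = t"
      unfolding tri t by (rule sum.cong) (use s in \<open>auto simp: min_def max_def\<close>)
    then show ?thesis by (intro exI[of _ ?x]) auto
  qed
  show ?thesis
  proof (rule local_frameI)
    fix y assume y: "y \<in> N"
    show "cbasis ?K (\<lambda>p. (case p of (i, j) \<Rightarrow> \<lambda>y. ?s i j y) y) (fibre (sym2_bundle M E) y)"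
    proof (rule cbasisI[OF fin])
      have F: "fibre (sym2_bundle M E) y = sym2_space (fibre E y)" by (simp add: sym2_bundle_def sub_bundle_def)
      show "csubspace (fibre (sym2_bundle M E) y)" by (simp add: F)
      show "(case p of (i, j) \<Rightarrow> \<lambda>y. ?s i j y) y \<in> fibre (sym2_bundle M E) y" if "p \<in> ?K" for p
        using that cbasisD(5,6)[OF E(3)[OF y]] by (auto simp: F sym2_space_sym)
      show "\<forall>p\<in>?K. a p = 0" if "(\<Sum>p\<in>?K. a p *\<^sub>C (case p of (i, j) \<Rightarrow> \<lambda>y. ?s i j y) y) = 0" for a
      proof -
        have "(\<Sum>p\<in>I \<times> I. (a (min (fst p) (snd p), max (fst p) (snd p)) * (if fst p = snd p then 2 else 1)) *\<^sub>C
          (case p of (i, j) \<Rightarrow> tens (e i y) (e j y))) = 0"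
          using that unfolding tri[of a y, symmetric] by (simp add: case_prod_beta)
        note z = cbasis_independent[OF basis[OF y] this]
        show ?thesis
        proof clarify
          fix i j assume "i \<in> I" "j \<in> I" "i \<le> j"
          then show "a (i, j) = 0" using z[of "(i, j)"] by (auto simp: min_def max_def split: if_splits)
        qed
      qed
      fix t assume "t \<in> fibre (sym2_bundle M E) y"
      then have t: "t \<in> sym2_space (fibre E y)" by (simp add: F)
      then have "t \<in> tensor_space (fibre E y) (fibre E y)" using sym2_space_le_tensor_space by blast
      from sym_coeff[OF y dual_family_expand[OF basis[OF y] this] t]
      show "\<exists>a. t = (\<Sum>p\<in>?K. a p *\<^sub>C (case p of (i, j) \<Rightarrow> \<lambda>y. ?s i j y) y)" by (auto simp: case_prod_beta)
    qed
  next
    fix W t assume W: "openin (zariski M) W" "W \<subseteq> N"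
    {
      assume "t \<in> sections (sym2_bundle M E) W"
      then have t: "t \<in> sections (tensor_bundle M E E) W" "\<And>y. y \<in> W \<Longrightarrow> t y \<in> sym2_space (fibre E y)"
        by (auto simp: sym2_bundle_def sub_bundle_def)
      obtain a where a: "\<forall>p\<in>I \<times> I. a p \<in> regular M W"
        "\<forall>y\<in>W. t y = (\<Sum>p\<in>I \<times> I. a p y *\<^sub>C (case p of (i, j) \<Rightarrow> \<lambda>y. tens (e i y) (e j y)) y)"
        using T(4)[OF W] t(1) by blast
      let ?x = "\<lambda>p y. a p y * (if fst p = snd p then 1 / 2 else 1)"
      have "t y = (\<Sum>p\<in>?K. ?x p y *\<^sub>C (case p of (i, j) \<Rightarrow> \<lambda>y. ?s i j y) y)" if y: "y \<in> W" for y
      proof -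
        have "y \<in> N" "t y = (\<Sum>p\<in>I \<times> I. a p y *\<^sub>C (case p of (i, j) \<Rightarrow> tens (e i y) (e j y)))"
          using a(2) y W(2) by (auto simp: case_prod_beta)
        from sym_coeff[OF this t(2)[OF y]] obtain x where
          x: "\<forall>p\<in>?K. x p = ?x p y" "t y = (\<Sum>p\<in>?K. x p *\<^sub>C (case p of (i, j) \<Rightarrow> ?s i j y))" by blast
        show ?thesis unfolding x(2) by (rule sum.cong[OF refl]) (use x(1) in auto)
      qed
      moreover have "?x p \<in> regular M W" if "p \<in> ?K" for p
        using a(1) that by (intro regular_mult regular_const W(1)) auto
      ultimately show "\<exists>a. (\<forall>p\<in>?K. a p \<in> regular M W) \<and>
          (\<forall>y\<in>W. t y = (\<Sum>p\<in>?K. a p y *\<^sub>C (case p of (i, j) \<Rightarrow> \<lambda>y. ?s i j y) y))"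
        by (intro exI[of _ ?x]) blast
    next
      fix a assume a: "\<And>p. p \<in> ?K \<Longrightarrow> a p \<in> regular M W"
        "\<And>y. y \<in> W \<Longrightarrow> t y = (\<Sum>p\<in>?K. a p y *\<^sub>C (case p of (i, j) \<Rightarrow> \<lambda>y. ?s i j y) y)"
      let ?b = "\<lambda>p y. a (min (fst p) (snd p), max (fst p) (snd p)) y * (if fst p = snd p then 2 else 1)"
      have "t y = (\<Sum>p\<in>I \<times> I. ?b p y *\<^sub>C (case p of (i, j) \<Rightarrow> \<lambda>y. tens (e i y) (e j y)) y)" if "y \<in> W" for y
        using a(2)[OF that] tri[of "\<lambda>p. a p y" y] by (simp add: case_prod_beta)
      moreover have "?b p \<in> regular M W" if "p \<in> I \<times> I" for p
        using that by (intro regular_mult regular_const W(1) a(1)) (auto simp: min_def max_def)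
      ultimately have "t \<in> sections (tensor_bundle M E E) W"
        unfolding T(4)[OF W] by (intro exI[of _ ?b]) blast
      moreover have "t y \<in> sym2_space (fibre E y)" if "y \<in> W" for y
      proof -
        have "y \<in> N" using that W by blast
        from cbasisD(5,6)[OF E(3)[OF this]] show ?thesis
          unfolding a(2)[OF that]
          by (intro complex_vector.subspace_sum complex_vector.subspace_scale sym2_space_subspace)
            (auto intro!: sym2_space_sym)
      qed
      ultimately show "t \<in> sections (sym2_bundle M E) W" by (simp add: sym2_bundle_def sub_bundle_def)
    }
  qed (use E fin in auto)
qed

end

section \<open>Quadratic spaces of dimension ten\<close>

locale quadratic_space =
  fixes B :: "'v::complex_vector \<Rightarrow> 'v \<Rightarrow> complex"
  assumes dim_space: "cdim (UNIV :: 'v set) = 10"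
    and nondegenerate: "nondegenerate_symmetric B"
begin

lemma bilinear_B: "cbilinear B" and B_commute: "B v w = B w v"
  and B_nondegenerate: "(\<And>w. B v w = 0) \<Longrightarrow> v = 0"
  using nondegenerate by (auto simp: nondegenerate_symmetric_def)

lemmas B_simps = cbilinear_simps[OF bilinear_B, unfolded scaleC_complex]

lemma finite_basis:
  obtains C :: "'v set" where "finite C" "cindependent C" "cspan C = UNIV" "card C = 10"
proof -
  obtain C where C: "C \<subseteq> UNIV" "cindependent C" "(UNIV :: 'v set) \<subseteq> cspan C" "card C = cdim (UNIV :: 'v set)"
    by (rule complex_vector.basis_exists)
  then show ?thesis using that[of C] dim_space card_ge_0_finite[of C] by auto
qed

lemma B_eqI: "(\<And>u. B u v = B u w) \<Longrightarrow> v = w"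
  using B_nondegenerate[of "v - w"] by (simp add: B_simps B_commute[of _ v] B_commute[of _ w] B_commute[of "v - w"])

text \<open>Nondegeneracy makes the map sending \<open>w\<close> to the vector with coordinates
  \<open>B b w\<close> injective; finite dimension makes it surjective.\<close>

lemma riesz:
  assumes "clinear (l :: 'v \<Rightarrow> complex)"
  obtains w where "\<And>v. B v w = l v"
proof -
  obtain C :: "'v set" where C: "finite C" "cindependent C" "cspan C = UNIV" "card C = 10" by (rule finite_basis)
  interpret fd: finite_dimensional_vector_space "scaleC :: complex \<Rightarrow> 'v \<Rightarrow> 'v" C
    by unfold_locales (use C in auto)
  let ?F = "\<lambda>w. \<Sum>b\<in>C. B b w *\<^sub>C b"
  have coeff: "x b = y b" if "(\<Sum>b\<in>C. x b *\<^sub>C b) = (\<Sum>b\<in>C. y b *\<^sub>C b)" "b \<in> C" for x y b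
    using cbasis_unique[of C "\<lambda>x. x" UNIV x y b] that C by (auto simp: cbasis_def)
  have agree: "l v = m v" if "clinear (l :: 'v \<Rightarrow> complex)" "clinear m" "\<And>b. b \<in> C \<Longrightarrow> l b = m b" for l m v
    using complex_vector_pair.linear_eq_on_span[of l m C v] that C by auto
  have lin: "clinear ?F"
    by (intro clinear_sum_fun clinear_scaleC_const cbilinear_right bilinear_B)
  have "w = 0" if w: "?F w = 0" for w
  proof (rule B_nondegenerate)
    have "B b w = 0" if "b \<in> C" for b using coeff[of "\<lambda>b. B b w" "\<lambda>_. 0" b] w that by simp
    then have "B v w = 0" for v
      using agree[OF cbilinear_left[OF bilinear_B, of w], of "\<lambda>_. 0" v] by (simp add: clinear_iff)
    then show "B w v = 0" for v using B_commute by metis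
  qed
  then have "inj ?F" by (simp add: complex_vector_pair.linear_inj_iff_eq_0[OF lin])
  then have "surj ?F" using fd.linear_inj_imp_surj[OF lin] by blast
  then obtain w where w: "?F w = (\<Sum>b\<in>C. l b *\<^sub>C b)"
    by (elim surjE[of ?F "\<Sum>b\<in>C. l b *\<^sub>C b"]) (metis that)
  have "B v w = l v" for v
    by (rule agree[OF cbilinear_left[OF bilinear_B] assms]) (rule coeff[OF w])
  then show ?thesis using that by blast
qed

text \<open>Orthonormality gives independence, and ten independent vectors span by
  dimension.\<close>

lemma orthonormal_expand:
  fixes g :: "'k::finite \<Rightarrow> 'v"
  assumes "\<And>a b. B (g a) (g b) = (if a = b then 1 else 0)" "CARD('k) = 10"
  shows "v = (\<Sum>a\<in>UNIV. B (g a) v *\<^sub>C g a)"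
proof -
  obtain C :: "'v set" where C: "finite C" "cindependent C" "cspan C = UNIV" "card C = 10" by (rule finite_basis)
  interpret fd: finite_dimensional_vector_space "scaleC :: complex \<Rightarrow> 'v \<Rightarrow> 'v" C
    by unfold_locales (use C in auto)
  have coeff: "B (g b) (\<Sum>a\<in>UNIV. x a *\<^sub>C g a) = x b" for x b
  proof -
    have "B (g b) (\<Sum>a\<in>UNIV. x a *\<^sub>C g a) = (\<Sum>a\<in>UNIV. if a = b then x a else 0)"
      unfolding B_simps by (intro sum.cong) (auto simp: assms(1))
    then show ?thesis by simp
  qed
  have zero: "\<forall>b\<in>UNIV. x b = 0" if "(\<Sum>a\<in>UNIV. x a *\<^sub>C g a) = 0" for x
    using coeff[of _ x] that by (simp add: B_simps)
  have ind: "inj g" "cindependent (range g)"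
    using independent_familyI[of UNIV g, OF finite zero] by auto
  have "UNIV \<subseteq> cspan (range g)"
    by (rule fd.card_ge_dim_independent) (use ind assms(2) dim_space in \<open>auto simp: card_image\<close>)
  then have basis: "cbasis UNIV g UNIV" using ind by (auto simp: cbasis_def)
  let ?x = "\<lambda>a. dual_family UNIV g a v"
  have ex: "v = (\<Sum>a\<in>UNIV. ?x a *\<^sub>C g a)" by (rule dual_family_expand[OF basis]) simp
  have "B (g b) v = ?x b" for b using coeff[of b ?x] ex by simp
  then show ?thesis using ex by simp
qed

text \<open>The value 1/2 is chosen because the Clifford relation involves \<open>2 * B\<close>:
  then \<open>c (e i)\<close> and \<open>c (f i)\<close> anticommute to the identity, without
  constants.\<close>

definition hyperbolic :: "(5 \<Rightarrow> 'v) \<Rightarrow> (5 \<Rightarrow> 'v) \<Rightarrow> bool"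
  where "hyperbolic e f \<longleftrightarrow> (\<forall>i j. B (e i) (e j) = 0) \<and> (\<forall>i j. B (f i) (f j) = 0) \<and>
    (\<forall>i j. B (e i) (f j) = (if i = j then 1 / 2 else 0))"

lemma hyperbolicD:
  assumes "hyperbolic e f"
  shows "B (e i) (e j) = 0" "B (f i) (f j) = 0" "B (e i) (f j) = (if i = j then 1 / 2 else 0)"
    "B (f i) (e j) = (if i = j then 1 / 2 else 0)"
  using assms B_commute by (auto simp: hyperbolic_def)

lemma hyperbolic_swap: "hyperbolic e f \<Longrightarrow> hyperbolic f e"
  unfolding hyperbolic_def using B_commute by auto

text \<open>For a hyperbolic pair \<open>e i + f i\<close> has square 1 and \<open>e i - f i\<close>
  has square -1, which the factor \<open>\<i>\<close> corrects.\<close>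

definition orthonormal :: "(5 \<Rightarrow> 'v) \<Rightarrow> (5 \<Rightarrow> 'v) \<Rightarrow> bool \<times> 5 \<Rightarrow> 'v"
  where "orthonormal e f = (\<lambda>(b, i). if b then \<i> *\<^sub>C (e i - f i) else e i + f i)"

lemma orthonormal_orthonormal:
  assumes "hyperbolic e f"
  shows "B (orthonormal e f a) (orthonormal e f b) = (if a = b then 1 else 0)"
  by (cases a; cases b) (auto simp: orthonormal_def B_simps hyperbolicD[OF assms])

lemma hyperbolic_expand:
  assumes "hyperbolic e f"
  shows "v = (\<Sum>i\<in>UNIV. (2 * B (f i) v) *\<^sub>C e i) + (\<Sum>i\<in>UNIV. (2 * B (e i) v) *\<^sub>C f i)"
proof -
  have "v = (\<Sum>a\<in>UNIV. B (orthonormal e f a) v *\<^sub>C orthonormal e f a)"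
    by (rule orthonormal_expand) (auto simp: orthonormal_orthonormal[OF assms])
  also have "\<dots> = (\<Sum>b\<in>UNIV. \<Sum>i\<in>UNIV. B (orthonormal e f (b, i)) v *\<^sub>C orthonormal e f (b, i))"
    by (simp add: sum.cartesian_product case_prod_beta UNIV_Times_UNIV)
  also have "\<dots> = (\<Sum>i\<in>UNIV. B (orthonormal e f (True, i)) v *\<^sub>C orthonormal e f (True, i) +
      B (orthonormal e f (False, i)) v *\<^sub>C orthonormal e f (False, i))"
    by (simp add: UNIV_bool sum.distrib add.commute)
  also have "\<dots> = (\<Sum>i\<in>UNIV. (2 * B (f i) v) *\<^sub>C e i + (2 * B (e i) v) *\<^sub>C f i)"
  proof (rule sum.cong[OF refl])
    fix i :: 5
    \<comment> \<open>Here \<open>b\<close> stands for \<open>B (e i) v\<close> and \<open>d\<close>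
      for \<open>B (f i) v\<close>; the mixed terms of the two orthonormal vectors cancel.\<close>
    have "(\<i> * (b - d)) *\<^sub>C \<i> *\<^sub>C (x - y) + (b + d) *\<^sub>C (x + y) = (2 * d) *\<^sub>C x + (2 * b) *\<^sub>C y" for b d and x y :: 'v
    proof -
      have "(\<i> * (b - d)) *\<^sub>C \<i> *\<^sub>C (x - y) = (d - b) *\<^sub>C (x - y)"
      proof -
        have "(\<i> * (b - d)) * \<i> = (\<i> * \<i>) * (b - d)" by (simp only: ac_simps)
        then have "(\<i> * (b - d)) * \<i> = d - b" by simp
        then show ?thesis by (simp only: scaleC_scaleC)
      qed
      then show ?thesis by (simp only: scaleC_algebra mult_2) (simp add: algebra_simps)
    qed
    then show "B (orthonormal e f (True, i)) v *\<^sub>C orthonormal e f (True, i) +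
      B (orthonormal e f (False, i)) v *\<^sub>C orthonormal e f (False, i) = (2 * B (f i) v) *\<^sub>C e i + (2 * B (e i) v) *\<^sub>C f i"
      by (simp only: orthonormal_def prod.case if_True if_False B_simps)
  qed
  finally show ?thesis by (simp add: sum.distrib)
qed

lemma hyperbolic_linear_eq:
  assumes "hyperbolic e f" "clinear l" "clinear m" "\<And>i. l (e i) = m (e i)" "\<And>i. l (f i) = m (f i)"
  shows "l v = m v"
proof -
  have "l v = (\<Sum>i\<in>UNIV. (2 * B (f i) v) *\<^sub>C l (e i)) + (\<Sum>i\<in>UNIV. (2 * B (e i) v) *\<^sub>C l (f i))"
    if "clinear l" for l :: "'v \<Rightarrow> 'c::complex_vector"
    using arg_cong[OF hyperbolic_expand[OF assms(1), of v], of l]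
    by (simp only: clinear_add[OF that] clinear_sum[OF that] clinear_scale[OF that])
  from this[OF assms(2)] this[OF assms(3)] show ?thesis using assms(4,5) by simp
qed

text \<open>A maximal isotropic subspace is its own orthogonal: in the hyperbolic expansion only the
  \<open>e\<close> part survives.\<close>

lemma hyperbolic_perp:
  assumes "hyperbolic e f" "\<And>i. B (e i) v = 0"
  shows "v \<in> cspan (range e)"
proof -
  have "v = (\<Sum>i\<in>UNIV. (2 * B (f i) v) *\<^sub>C e i)"
    using hyperbolic_expand[OF assms(1), of v] assms(2) by simp
  also have "\<dots> \<in> cspan (range e)"
    by (intro complex_vector.span_sum complex_vector.span_scale complex_vector.span_base) auto
  finally show ?thesis .
qed

lemma hyperbolic_cbasis:
  assumes "hyperbolic e f"
  shows "cbasis UNIV e (cspan (range e))"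
proof -
  have "B (f j) (\<Sum>i\<in>UNIV. a i *\<^sub>C e i) = a j / 2" for a j
    by (simp add: B_simps hyperbolicD[OF assms] if_distrib cong: if_cong)
  then have zero: "\<forall>j\<in>UNIV. a j = 0" if "(\<Sum>i\<in>UNIV. a i *\<^sub>C e i) = 0" for a
    using that by (metis B_simps(10) div_0 divide_eq_0_iff zero_neq_numeral)
  from independent_familyI[of UNIV e, OF finite zero] show ?thesis by (simp add: cbasis_def)
qed

text \<open>Dual vectors \<open>f'\<close> exist by \<open>riesz\<close>; they are then shifted by
  elements of \<open>U\<close>, which keeps them dual, until they are isotropic.\<close>

lemma OG5_hyperbolic:
  assumes "U \<in> OG5 B"
  obtains e f where "hyperbolic e f" "cspan (range e) = U"
proof -
  have U: "csubspace U" "cdim U = 5" "\<And>v w. v \<in> U \<Longrightarrow> w \<in> U \<Longrightarrow> B v w = 0"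
    using assms by (auto simp: OG5_def grassmannian5_def)
  obtain C where C: "C \<subseteq> U" "cindependent C" "U \<subseteq> cspan C" "card C = cdim U"
    by (rule complex_vector.basis_exists)
  have "finite C" using C(4) U(2) card_ge_0_finite[of C] by auto
  then obtain e where e: "bij_betw e (UNIV :: 5 set) C"
    using finite_same_card_bij[of "UNIV :: 5 set" C] C(4) U(2) by auto
  then have re: "range e = C" and inj: "inj e" by (auto simp: bij_betw_def)
  have span: "cspan (range e) = U"
    using C U(1) complex_vector.span_minimal[of C U] by (auto simp: re)
  have eU: "e i \<in> U" for i using C(1) re by auto
  have "\<exists>w. \<forall>i. B (e i) w = (if i = j then 1 / 2 else 0)" for j
  proof -
    obtain l where l: "clinear l" "\<forall>i\<in>UNIV. l (e i) = (if i = j then 1 / 2 else 0 :: complex)"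
      using linear_functional_family[OF C(2)[folded re] inj, of "\<lambda>i. if i = j then 1 / 2 else 0"]
      by (elim exE conjE) (rule that)
    obtain w where "\<And>v. B v w = l v" using riesz[OF l(1)] by blast
    then show ?thesis using l(2) by (intro exI[of _ w]) simp
  qed
  then obtain f' where f': "\<And>i j. B (e i) (f' j) = (if i = j then 1 / 2 else 0)" by metis
  have f'e: "B (f' j) (e i) = (if i = j then 1 / 2 else 0)" for i j using f' B_commute by metis
  \<comment> \<open>As \<open>f'\<close> and \<open>e\<close> pair to 1/2, subtracting the full
    \<open>B (f' j) (f' k)\<close> removes half of the defect in each argument of
    \<open>B\<close>.\<close>
  let ?f = "\<lambda>j. f' j - (\<Sum>k\<in>UNIV. B (f' j) (f' k) *\<^sub>C e k)"
  have ee: "B (e i) (e j) = 0" for i j using U(3) eU by blast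
  have ef: "B (e i) (?f j) = (if i = j then 1 / 2 else 0)" for i j
    by (simp add: B_simps f' ee)
  have fe: "B (?f i) (e k) = (if k = i then 1 / 2 else 0)" for i k
    using ef[of k i] by (simp only: B_commute[of "?f i"])
  have ff: "B (?f i) (?f j) = 0" for i j
  proof -
    have "B (?f i) (?f j) = B (?f i) (f' j) - (\<Sum>k\<in>UNIV. B (f' j) (f' k) * B (?f i) (e k))"
      by (simp only: B_simps)
    also have "(\<Sum>k\<in>UNIV. B (f' j) (f' k) * B (?f i) (e k)) = (\<Sum>k\<in>UNIV. if k = i then B (f' j) (f' k) / 2 else 0)"
      unfolding fe by (rule sum.cong) auto
    also have "\<dots> = B (f' j) (f' i) / 2" by simp
    also have "B (?f i) (f' j) = B (f' i) (f' j) - (\<Sum>k\<in>UNIV. if k = j then B (f' i) (f' k) / 2 else 0)"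
      unfolding B_simps by (intro arg_cong2[of _ _ _ _ "(-)"] refl sum.cong) (auto simp: f')
    also have "(\<Sum>k\<in>UNIV. if k = j then B (f' i) (f' k) / 2 else 0) = B (f' i) (f' j) / 2" by simp
    finally show ?thesis using B_commute[of "f' i" "f' j"] by simp
  qed
  have "hyperbolic e ?f" using ee ef ff unfolding hyperbolic_def by blast
  then show ?thesis using that span by blast
qed

end

section \<open>The Clifford module\<close>

text \<open>Another enumeration would change a product of five anticommuting factors only by a sign.
  The odd length matters: such a product exchanges the half-spin modules.\<close>

definition indices :: "5 list"
  where "indices = (SOME xs. distinct xs \<and> set xs = UNIV)"

lemma indices: "distinct indices" "set indices = UNIV" "length indices = 5"
proof -
  have "\<exists>xs :: 5 list. distinct xs \<and> set xs = UNIV" using finite_distinct_list[of "UNIV :: 5 set"] by auto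
  then show *: "distinct indices" "set indices = UNIV"
    using someI_ex[of "\<lambda>xs :: 5 list. distinct xs \<and> set xs = UNIV"] by (auto simp: indices_def)
  show "length indices = 5" using distinct_card[OF *(1)] *(2) by simp
qed

locale spinor_module = quadratic_space B for B :: "'v::complex_vector \<Rightarrow> 'v \<Rightarrow> complex" +
  fixes c :: "'v \<Rightarrow> 's::complex_vector \<Rightarrow> 's" and Sp Sm :: "'s set"
  assumes spin: "spin_module B c Sp Sm"
begin

lemma bilinear_c: "cbilinear c" and c_square: "c v (c v s) = B v v *\<^sub>C s"
  and half_spin_subspace: "csubspace Sp" "csubspace Sm"
  using spin by (auto simp: spin_module_def)

lemmas c_simps = cbilinear_simps[OF bilinear_c]

lemma clinear_c: "clinear (c v)" and clinear_c_left: "clinear (\<lambda>v. c v s)"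
  using bilinear_c by (auto simp: cbilinear_def)

text \<open>Polarisation of \<open>c_square\<close>.\<close>

lemma c_anticommute: "c v (c w s) = (2 * B v w) *\<^sub>C s - c w (c v s)"
proof -
  have "c (v + w) (c (v + w) s) = c v (c v s) + c w (c w s) + (c v (c w s) + c w (c v s))"
    by (simp add: c_simps)
  then have "B (v + w) (v + w) *\<^sub>C s = B v v *\<^sub>C s + B w w *\<^sub>C s + (c v (c w s) + c w (c v s))"
    by (simp only: c_square)
  moreover have "B (v + w) (v + w) = B v v + B w w + 2 * B v w" by (simp add: B_simps B_commute)
  ultimately show ?thesis by (simp add: scaleC_add_left algebra_simps)
qed

lemma spinor_finite_basis:
  obtains C :: "'s set" where "finite C" "cindependent C" "cspan C = UNIV" "card C = 32"
proof -
  obtain Cp where Cp: "Cp \<subseteq> Sp" "cindependent Cp" "Sp \<subseteq> cspan Cp" "card Cp = cdim Sp"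
    by (rule complex_vector.basis_exists)
  obtain Cm where Cm: "Cm \<subseteq> Sm" "cindependent Cm" "Sm \<subseteq> cspan Cm" "card Cm = cdim Sm"
    by (rule complex_vector.basis_exists)
  have dims: "cdim Sp = 16" "cdim Sm = 16" "Sp \<inter> Sm = {0}" and sum: "\<exists>p\<in>Sp. \<exists>m\<in>Sm. s = p + m" for s
    using spin by (auto simp: spin_module_def)
  have fin: "finite Cp" "finite Cm" using Cp(4) Cm(4) dims card_ge_0_finite[of Cp] card_ge_0_finite[of Cm] by auto
  have span: "cspan (Cp \<union> Cm) = UNIV"
  proof (rule UNIV_eq_I[symmetric])
    fix s
    obtain p m where "p \<in> Sp" "m \<in> Sm" "s = p + m" using sum[of s] by blast
    then show "s \<in> cspan (Cp \<union> Cm)"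
      using Cp(3) Cm(3) complex_vector.span_mono[of Cp "Cp \<union> Cm"] complex_vector.span_mono[of Cm "Cp \<union> Cm"]
      by (auto intro!: complex_vector.span_add)
  qed
  obtain C where C: "C \<subseteq> UNIV" "cindependent C" "(UNIV :: 's set) \<subseteq> cspan C" "card C = cdim (UNIV :: 's set)"
    by (rule complex_vector.basis_exists)
  have finC: "finite C" using complex_vector.independent_span_bound[of "Cp \<union> Cm" C] fin C span by auto
  interpret fd: finite_dimensional_vector_space "scaleC :: complex \<Rightarrow> 's \<Rightarrow> 's" C
    by unfold_locales (use C finC in auto)
  have "{x + y |x y. x \<in> Sp \<and> y \<in> Sm} = UNIV" using sum by blast
  then have "cdim (UNIV :: 's set) + cdim {0::'s} = 16 + 16"
    using fd.dim_sums_Int[OF half_spin_subspace] dims by (simp del: fd.dim_UNIV)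
  then have "card C = 32" using C(4) by (simp del: fd.dim_UNIV)
  then show ?thesis using that finC C by blast
qed

text \<open>Partial index sets \<open>A\<close> are allowed so that the vectors of a frame can be
  treated one at a time by induction.\<close>

definition annihilator :: "('i \<Rightarrow> 'v) \<Rightarrow> 'i set \<Rightarrow> 's set"
  where "annihilator e A = {t. \<forall>i\<in>A. c (e i) t = 0}"

lemma annihilator_subspace: "csubspace (annihilator e A)"
  by (rule csubspaceI) (auto simp: annihilator_def c_simps)

lemma pure_spinors_annihilator: "pure_spinors c (cspan (range e)) = annihilator e UNIV"
proof
  show "pure_spinors c (cspan (range e)) \<subseteq> annihilator e UNIV"
    by (auto simp: pure_spinors_def annihilator_def complex_vector.span_base)
  show "annihilator e UNIV \<subseteq> pure_spinors c (cspan (range e))"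
  proof
    fix t assume t: "t \<in> annihilator e UNIV"
    have "cspan (range e) \<subseteq> {v. c v t = 0}"
      by (rule complex_vector.span_minimal) (use t in \<open>auto intro!: csubspaceI simp: annihilator_def c_simps\<close>)
    then show "t \<in> pure_spinors c (cspan (range e))" by (auto simp: pure_spinors_def)
  qed
qed

text \<open>These are the canonical anticommutation relations: starting from a spinor killed by all
  \<open>e i\<close>, the \<open>c (f i)\<close> create and the \<open>c (e i)\<close>
  annihilate.\<close>

lemma hyperbolic_c:
  assumes "hyperbolic e f"
  shows "c (e i) (c (e j) t) = - c (e j) (c (e i) t)" "c (f i) (c (f j) t) = - c (f j) (c (f i) t)"
    "c (e i) (c (f j) t) = (if i = j then t else 0) - c (f j) (c (e i) t)"
    "c (f i) (c (e j) t) = (if i = j then t else 0) - c (e j) (c (f i) t)"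
    "c (e i) (c (e i) t) = 0" "c (f i) (c (f i) t) = 0"
  using c_anticommute[of "e i" "e j" t] c_anticommute[of "f i" "f j" t] c_anticommute[of "e i" "f j" t]
    c_anticommute[of "f i" "e j" t] c_square[of "e i" t] c_square[of "f i" t] hyperbolicD[OF assms]
  by auto

text \<open>Each further condition \<open>c (e i) t = 0\<close> halves the dimension, because
  \<open>c (f i)\<close> maps the new kernel isomorphically onto a complement of it in the old one.
  After five steps 32 has become 1.\<close>

lemma annihilator_dim:
  assumes hyp: "hyperbolic e f"
  shows "cdim (annihilator e A) * 2 ^ card A = 32"
proof -
  obtain C :: "'s set" where C: "finite C" "cindependent C" "cspan C = UNIV" "card C = 32"
    by (rule spinor_finite_basis)
  interpret fd: finite_dimensional_vector_space "scaleC :: complex \<Rightarrow> 's \<Rightarrow> 's" C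
    by unfold_locales (use C in auto)
  interpret fdp: finite_dimensional_vector_space_pair_1 "scaleC :: complex \<Rightarrow> 's \<Rightarrow> 's" C "scaleC :: complex \<Rightarrow> 's \<Rightarrow> 's" ..
  have "finite A" by simp
  then show ?thesis
  proof (induction A rule: finite_induct)
    case empty
    have "annihilator e {} = UNIV" by (simp add: annihilator_def)
    then show ?case using C(4) by simp
  next
    case (insert i A)
    let ?K = "annihilator e (insert i A)"
    let ?L = "c (f i) ` ?K"
    have K: "c (e i) t = 0" "\<And>j. j \<in> A \<Longrightarrow> c (e j) t = 0" if "t \<in> ?K" for t
      using that by (auto simp: annihilator_def)
    have inverse: "c (e i) (c (f i) t) = t" if "t \<in> ?K" for t using hyperbolic_c(3)[OF hyp, of i i t] K[OF that] c_simps by simp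
    have inj: "inj_on (c (f i)) ?K" by (rule inj_onI) (metis inverse)
    have L: "csubspace ?L"
      using complex_vector_pair.linear_subspace_image[OF clinear_c annihilator_subspace] .
    have sum: "annihilator e A = {x + y |x y. x \<in> ?K \<and> y \<in> ?L}"
    proof (intro equalityI subsetI)
      fix t assume t: "t \<in> annihilator e A"
      have ei: "c (e i) t \<in> ?K"
        unfolding annihilator_def
      proof (intro CollectI ballI)
        fix j assume "j \<in> insert i A"
        then show "c (e j) (c (e i) t) = 0"
          using t hyperbolic_c(1)[OF hyp, of j i t] hyperbolic_c(5)[OF hyp] by (auto simp: annihilator_def c_simps)
      qed
      have "c (e j) (c (f i) (c (e i) t)) = (if i = j then c (e i) t else 0)" if "j \<in> insert i A" for j
        using that t hyperbolic_c(3)[OF hyp, of j i "c (e i) t"] K[OF ei] insert(2) c_simps by auto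
      \<comment> \<open>\<open>c (f i) (c (e i) t)\<close> is the component of \<open>t\<close> in
        the complement; what remains is killed by \<open>e i\<close> as well.\<close>
      then have "t - c (f i) (c (e i) t) \<in> ?K"
        using t insert(2) by (auto simp: annihilator_def c_simps)
      then show "t \<in> {x + y |x y. x \<in> ?K \<and> y \<in> ?L}" using ei by force
    next
      fix t assume "t \<in> {x + y |x y. x \<in> ?K \<and> y \<in> ?L}"
      then obtain x y where xy: "x \<in> ?K" "y \<in> ?K" "t = x + c (f i) y" by blast
      have "c (e j) (c (f i) y) = 0" if "j \<in> A" for j
        using hyperbolic_c(3)[OF hyp, of j i y] K[OF xy(2)] that insert(2) c_simps by auto
      then show "t \<in> annihilator e A" using xy K[OF xy(1)] by (auto simp: annihilator_def c_simps)
    qed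
    have "?K \<inter> ?L \<subseteq> {0}"
    proof
      fix t assume "t \<in> ?K \<inter> ?L"
      then obtain y where "y \<in> ?K" "t = c (f i) y" "c (e i) t = 0" using K by auto
      then have "y = 0" using inverse by auto
      then show "t \<in> {0}" using \<open>t = c (f i) y\<close> c_simps by simp
    qed
    then have "cdim (?K \<inter> ?L) = 0" by simp
    moreover have "cdim ?L = cdim ?K"
      using inj by (intro fdp.dim_image_eq clinear_c) (simp add: complex_vector.span_eq_iff[THEN iffD2, OF annihilator_subspace])
    moreover have "cdim (annihilator e A) + cdim (?K \<inter> ?L) = cdim ?K + cdim ?L"
      unfolding sum by (rule fd.dim_sums_Int[OF annihilator_subspace L])
    ultimately have "cdim (annihilator e A) = 2 * cdim ?K" by (simp del: fd.dim_eq_0)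
    then show ?case using insert by simp
  qed
qed

lemma annihilator_line:
  assumes "hyperbolic e f"
  obtains s where "s \<noteq> 0" "annihilator e UNIV = range (\<lambda>z. z *\<^sub>C s)"
proof -
  have dim: "cdim (annihilator e UNIV) = 1" using annihilator_dim[OF assms, of UNIV] by simp
  obtain C where C: "C \<subseteq> annihilator e UNIV" "cindependent C" "annihilator e UNIV \<subseteq> cspan C"
    "card C = cdim (annihilator e UNIV)"
    by (rule complex_vector.basis_exists)
  then obtain s where s: "C = {s}" using dim card_1_singletonE by metis
  then have "s \<noteq> 0" using C(2) complex_vector.dependent_zero by auto
  moreover have "annihilator e UNIV = cspan C"
    using C(1,3) complex_vector.span_minimal[OF C(1) annihilator_subspace] by blast
  ultimately show ?thesis using that by (simp add: s complex_vector.span_singleton)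
qed

lemma annihilator_multiple:
  assumes "hyperbolic e f" "s \<in> annihilator e UNIV" "s \<noteq> 0" "t \<in> annihilator e UNIV"
  obtains z where "t = z *\<^sub>C s"
proof -
  obtain s0 where s0: "annihilator e UNIV = range (\<lambda>z. z *\<^sub>C s0)" using annihilator_line[OF assms(1)] by metis
  then obtain x y where "s = x *\<^sub>C s0" "t = y *\<^sub>C s0" using assms(2,4) by auto
  moreover from this have "x \<noteq> 0" using assms(3) by auto
  ultimately have "t = (y / x) *\<^sub>C s" by simp
  then show ?thesis using that by blast
qed

subsection \<open>Parity\<close>

text \<open>Lets \<open>P\<close> name the half that contains a given spinor, whichever of the two
  it is.\<close>

definition half_spins :: "'s set \<Rightarrow> 's set \<Rightarrow> bool"
  where "half_spins P Q \<longleftrightarrow> (P, Q) = (Sp, Sm) \<or> (P, Q) = (Sm, Sp)"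

lemma half_spinsD:
  assumes "half_spins P Q"
  shows "csubspace P" "csubspace Q" "P \<inter> Q = {0}" "\<exists>p\<in>P. \<exists>q\<in>Q. t = p + q"
    "t \<in> P \<Longrightarrow> c v t \<in> Q" "t \<in> Q \<Longrightarrow> c v t \<in> P"
  using assms half_spin_subspace spin unfolding half_spins_def spin_module_def image_subset_iff
  by (auto simp: Int_commute) (metis add.commute)

text \<open>Multiplication by \<open>e i\<close> sends the two components of a generator into
  different halves, so each component is annihilated separately. Both then lie on the one line,
  which forces one of them to be zero.\<close>

lemma annihilator_parity:
  assumes "hyperbolic e f"
  shows "annihilator e UNIV \<subseteq> Sp \<or> annihilator e UNIV \<subseteq> Sm"
proof -
  obtain s where s: "s \<noteq> 0" "annihilator e UNIV = range (\<lambda>z. z *\<^sub>C s)" using annihilator_line[OF assms] .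
  have hs: "half_spins Sp Sm" by (simp add: half_spins_def)
  obtain p m where pm: "p \<in> Sp" "m \<in> Sm" "s = p + m" using half_spinsD(4)[OF hs, of s] by blast
  have zero: "c (e i) p = 0 \<and> c (e i) m = 0" for i
  proof -
    have "s \<in> annihilator e UNIV" using s(2) by (metis rangeI scaleC_one)
    then have "c (e i) p = - c (e i) m"
      using pm(3) by (simp add: annihilator_def c_simps eq_neg_iff_add_eq_0)
    moreover have "c (e i) p \<in> Sm" "c (e i) m \<in> Sp" using half_spinsD(5,6)[OF hs] pm by auto
    ultimately have "c (e i) p \<in> Sp \<inter> Sm"
      using complex_vector.subspace_neg[OF half_spin_subspace(1)] by auto
    then show ?thesis using half_spinsD(3)[OF hs] \<open>c (e i) p = - c (e i) m\<close> by auto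
  qed
  then have "p \<in> annihilator e UNIV" by (auto simp: annihilator_def)
  then obtain z where z: "p = z *\<^sub>C s" using s(2) by auto
  show ?thesis
  proof (cases "z = 0")
    case True
    then have "p = 0" using z by simp
    then have "s \<in> Sm" using pm(2,3) by simp
    then show ?thesis unfolding s(2) using complex_vector.subspace_scale[OF half_spin_subspace(2)] by blast
  next
    case False
    then have "s = (1 / z) *\<^sub>C p" using z by simp
    then have "s \<in> Sp" using pm complex_vector.subspace_scale[OF half_spin_subspace(1)] by metis
    then show ?thesis unfolding s(2) using complex_vector.subspace_scale[OF half_spin_subspace(1)] by blast
  qed
qed

definition word :: "('i \<Rightarrow> 'v) \<Rightarrow> 'i list \<Rightarrow> 's \<Rightarrow> 's"
  where "word e xs t = foldr (\<lambda>i. c (e i)) xs t"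

lemma word_simps [simp]: "word e [] t = t" "word e (x # xs) t = c (e x) (word e xs t)"
  "word e (xs @ ys) t = word e xs (word e ys t)"
  by (simp_all add: word_def)

lemma clinear_word: "clinear (word e xs)"
proof (induction xs)
  case Nil
  then show ?case using clinear_id by (simp add: word_def id_def)
next
  case (Cons x xs)
  then show ?case using clinear_compose[OF Cons clinear_c] by (simp add: clinear_iff)
qed

text \<open>A vector already present in the word is moved next to its copy and squares to zero; a
  dual vector without partner in the word passes through to \<open>t\<close>.\<close>

lemma word_kill:
  assumes "hyperbolic e f"
  shows "i \<in> set xs \<Longrightarrow> c (e i) (word e xs t) = 0"
    and "i \<notin> set xs \<Longrightarrow> c (f i) t = 0 \<Longrightarrow> c (f i) (word e xs t) = 0"
proof (induction xs)
  case (Cons x xs)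
  {
    case 1
    then show ?case
      using Cons(1) hyperbolic_c(1)[OF assms, of i x "word e xs t"] hyperbolic_c(5)[OF assms]
      by (cases "i = x") (auto simp: c_simps)
  next
    case 2
    then show ?case
      using Cons(2) hyperbolic_c(4)[OF assms, of i x "word e xs t"] by (auto simp: c_simps)
  }
qed auto

text \<open>Each \<open>c (f x)\<close> cancels the matching \<open>c (e x)\<close> because the
  spinor behind that factor is killed by \<open>c (f x)\<close>.\<close>

lemma word_inverse:
  assumes "hyperbolic e f" "distinct xs" "\<And>i. c (f i) t = 0"
  shows "word f (rev xs) (word e xs t) = t"
  using assms(2)
proof (induction xs)
  case (Cons x xs)
  have "c (f x) (word e xs t) = 0" using word_kill(2)[OF assms(1)] Cons(2) assms(3) by auto
  then have "c (f x) (c (e x) (word e xs t)) = word e xs t"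
    using hyperbolic_c(4)[OF assms(1), of x x] c_simps by simp
  then show ?case using Cons by simp
qed auto

lemma word_parity:
  assumes "half_spins P Q" "t \<in> P"
  shows "word e xs t \<in> (if even (length xs) then P else Q)"
  by (induction xs) (use assms half_spinsD(5,6)[OF assms(1)] in auto)

subsection \<open>The invariant pairing of spinors\<close>

text \<open>For an orthonormal basis \<open>g\<close>, the operators \<open>\<beta> \<mapsto> \<beta> (c (g a) _) (c (g a) _)\<close> on bilinear forms are
  commuting involutions. A joint eigenform is invariant up to signs, and composing it with \<open>c (g j)\<close> flips
  every sign but the \<open>j\<close>-th one, so all signs can be made equal.\<close>

lemma invariant_form:
  assumes hyp: "hyperbolic e f"
  obtains \<beta> :: "'s \<Rightarrow> 's \<Rightarrow> complex" and \<eta> where "cbilinear \<beta>" "\<exists>x y. \<beta> x y \<noteq> 0" "\<eta> \<noteq> 0"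
    "\<forall>v x y. \<beta> (c v x) y = \<eta> * \<beta> x (c v y)"
proof -
  let ?g = "orthonormal e f"
  have orth: "c (?g a) (c (?g b) t) = (if a = b then t else - c (?g b) (c (?g a) t))" for a b t
    using c_anticommute[of "?g a" "?g b" t] c_square[of "?g a" t] orthonormal_orthonormal[OF hyp, of a b] by auto
  \<comment> \<open>\<open>\<epsilon>\<close> records the eigenvalues on \<open>A\<close>; its
    values elsewhere are unconstrained, so the induction can overwrite them.\<close>
  define eigen where "eigen A \<beta> \<epsilon> \<longleftrightarrow> cbilinear \<beta> \<and> (\<exists>x y. \<beta> x y \<noteq> 0) \<and>
      (\<forall>a\<in>A. (\<epsilon> a = 1 \<or> \<epsilon> a = -1) \<and> (\<forall>x y. \<beta> (c (?g a) x) (c (?g a) y) = \<epsilon> a * \<beta> x y))"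
    for A and \<beta> :: "'s \<Rightarrow> 's \<Rightarrow> complex" and \<epsilon> :: "bool \<times> 5 \<Rightarrow> complex"
  have ex: "\<exists>\<beta> \<epsilon>. eigen A \<beta> \<epsilon>" for A
  proof -
    have "finite A" by simp
    then show ?thesis
    proof (induction A rule: finite_induct)
      case empty
      obtain s :: 's where "s \<noteq> 0" using annihilator_line[OF hyp] .
      then obtain l where "clinear l" "l s = (1::complex)" by (rule linear_functional_nonzero)
      then have "eigen {} (\<lambda>x y. l x * l y) \<epsilon>" for \<epsilon>
        unfolding eigen_def by (auto intro!: cbilinear_mult exI[of _ s])
      then show ?case by blast
    next
      case (insert a A)
      then obtain \<beta> \<epsilon> where E: "eigen A \<beta> \<epsilon>" by blast
      have bil: "cbilinear \<beta>" using E by (simp add: eigen_def)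
      obtain x y where xy: "\<beta> x y \<noteq> 0" using E by (auto simp: eigen_def)
      \<comment> \<open>For both signs \<open>\<delta>\<close> this is an eigenform for
        \<open>a\<close>; the two forms add up to \<open>2 * \<beta>\<close>, so one of them is
        nonzero.\<close>
      define \<beta>' where "\<beta>' \<delta> x y = \<beta> x y + \<delta> * \<beta> (c (?g a) x) (c (?g a) y)" for \<delta> x y
      have "\<beta>' 1 x y + \<beta>' (-1) x y \<noteq> 0" using xy by (simp add: \<beta>'_def)
      then obtain \<delta> where \<delta>: "\<delta> = 1 \<or> \<delta> = -1" "\<beta>' \<delta> x y \<noteq> 0" by (metis add_0)
      have "cbilinear (\<beta>' \<delta>)"
        by (simp add: cbilinear_iff \<beta>'_def cbilinear_simps[OF bil] c_simps algebra_simps)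
      moreover have "\<beta>' \<delta> (c (?g b) x) (c (?g b) y) = (\<epsilon>(a := \<delta>)) b * \<beta>' \<delta> x y" if "b \<in> insert a A" for b x y
      proof (cases "b = a")
        case True
        then show ?thesis using \<delta>(1) by (auto simp: \<beta>'_def orth)
      next
        case False
        then have ev: "\<beta> (c (?g b) x) (c (?g b) y) = \<epsilon> b * \<beta> x y" for x y
          using E that unfolding eigen_def by blast
        have neg: "\<beta> (- x) (- y) = \<beta> x y" for x y
          using cbilinear_scale_left[OF bil, of "-1" x "- y"] cbilinear_scale_right[OF bil, of x "-1" y] by simp
        \<comment> \<open>Moving \<open>?g b\<close> past \<open>?g a\<close> changes the sign of
          both arguments, so the added term keeps the eigenvalue
          \<open>\<epsilon> b\<close>.\<close>
        show ?thesis using False ev by (simp add: \<beta>'_def orth[of a b] neg algebra_simps)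
      qed
      ultimately have "eigen (insert a A) (\<beta>' \<delta>) (\<epsilon>(a := \<delta>))"
        unfolding eigen_def using \<delta> E by (auto simp: eigen_def)
      then show ?case by blast
    qed
  qed
  have flip: "eigen UNIV (\<lambda>x y. \<beta> x (c (?g j) y)) (\<lambda>a. if a = j then \<epsilon> a else - \<epsilon> a)" if E: "eigen UNIV \<beta> \<epsilon>" for \<beta> \<epsilon> j
  proof -
    have bil: "cbilinear \<beta>" using E by (simp add: eigen_def)
    have ev: "\<beta> (c (?g b) x) (c (?g b) y) = \<epsilon> b * \<beta> x y" for b x y
      using E unfolding eigen_def by blast
    have neg: "\<beta> x (- y) = - \<beta> x y" for x y using cbilinear_scale_right[OF bil, of x "-1" y] by simp
    obtain x y where "\<beta> x y \<noteq> 0" using E by (auto simp: eigen_def)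
    then have "\<beta> x (c (?g j) (c (?g j) y)) \<noteq> 0" by (simp add: orth)
    moreover have "\<beta> (c (?g a) x) (c (?g j) (c (?g a) y)) = (if a = j then \<epsilon> a else - \<epsilon> a) * \<beta> x (c (?g j) y)" for a x y
    proof (cases "a = j")
      case False
      then have "c (?g j) (c (?g a) y) = - c (?g a) (c (?g j) y)" by (simp add: orth[of j a])
      then show ?thesis using ev[of a x "c (?g j) y"] False by (simp add: neg)
    qed (use ev in simp)
    moreover have "(if a = j then \<epsilon> a else - \<epsilon> a) = 1 \<or> (if a = j then \<epsilon> a else - \<epsilon> a) = -1" for a
      using E unfolding eigen_def by (metis minus_minus UNIV_I)
    moreover have "cbilinear (\<lambda>x y. \<beta> x (c (?g j) y))"
      by (rule cbilinear_compose[OF bil clinear_id clinear_c])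
    ultimately show ?thesis unfolding eigen_def by blast
  qed
  have uniform: "\<exists>\<beta> \<epsilon>. eigen UNIV \<beta> \<epsilon> \<and> (\<forall>a b. \<epsilon> a = \<epsilon> b)" if "eigen UNIV \<beta> \<epsilon>" for \<beta> \<epsilon>
    using that
  proof (induction "card {a. \<epsilon> a = -1}" arbitrary: \<beta> \<epsilon> rule: less_induct)
    case less
    have pm: "\<epsilon> a = 1 \<or> \<epsilon> a = -1" for a
      using less(2) unfolding eigen_def by blast
    show ?case
    proof (cases "\<exists>j k. j \<noteq> k \<and> \<epsilon> j = -1 \<and> \<epsilon> k = -1")
      case True
      then obtain j k where jk: "j \<noteq> k" "\<epsilon> j = -1" "\<epsilon> k = -1" by blast
      \<comment> \<open>Flips at \<open>j\<close> and then at \<open>k\<close> change exactly the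
        signs at \<open>j\<close> and \<open>k\<close>: two minus signs disappear and the count
        drops.\<close>
      let ?e = "\<lambda>a. if a = k then (if a = j then \<epsilon> a else - \<epsilon> a) else - (if a = j then \<epsilon> a else - \<epsilon> a)"
      have "\<epsilon> a = -1" if "?e a = -1" for a
        using that jk by (cases "a = j"; cases "a = k") auto
      moreover have "?e j \<noteq> -1" using jk by simp
      ultimately have "{a. ?e a = -1} \<subset> {a. \<epsilon> a = -1}" using jk(2) by blast
      then have "card {a. ?e a = -1} < card {a. \<epsilon> a = -1}" by (intro psubset_card_mono) auto
      then show ?thesis using less(1)[OF _ flip[OF flip[OF less(2)]]] by blast
    next
      case one: False
      show ?thesis
      proof (cases "\<exists>j. \<epsilon> j = -1")
        case True
        then obtain j where j: "\<epsilon> j = -1" by blast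
        \<comment> \<open>A single remaining minus sign at \<open>j\<close> survives the flip at
          \<open>j\<close>, which turns all other signs into minus.\<close>
        have "(if a = j then \<epsilon> a else - \<epsilon> a) = -1" for a
        proof (cases "a = j")
          case False
          then have "\<epsilon> a \<noteq> -1" using one j by blast
          then show ?thesis using False pm[of a] by simp
        qed (use j in simp)
        then show ?thesis
          by (intro exI conjI allI) (rule flip[OF less(2), of j], simp only:)
      next
        case False
        then show ?thesis using less(2) pm by metis
      qed
    qed
  qed
  obtain \<beta> \<epsilon> where E: "eigen UNIV \<beta> \<epsilon>" and same: "\<And>a b. \<epsilon> a = \<epsilon> b" using ex uniform by metis
  \<comment> \<open>All signs agree, so any index may be used to read off the common one.\<close>
  define \<eta> where "\<eta> = \<epsilon> undefined"
  have bil: "cbilinear \<beta>" using E by (simp add: eigen_def)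
  have g: "\<beta> (c (?g a) x) y = \<eta> * \<beta> x (c (?g a) y)" for a x y
  proof -
    \<comment> \<open>Replacing \<open>y\<close> by \<open>c (?g a) y\<close> and using that
      \<open>?g a\<close> squares to 1 moves the factor from one argument to the other.\<close>
    have "\<beta> (c (?g a) x) (c (?g a) (c (?g a) y)) = \<epsilon> a * \<beta> x (c (?g a) y)"
      using E unfolding eigen_def by blast
    then show ?thesis using same[of a undefined] by (simp add: orth \<eta>_def)
  qed
  have "\<beta> (c v x) y = \<eta> * \<beta> x (c v y)" for v x y
  proof -
    have v: "v = (\<Sum>a\<in>UNIV. B (?g a) v *\<^sub>C ?g a)"
      by (rule orthonormal_expand) (auto simp: orthonormal_orthonormal[OF hyp])
    have "\<beta> (c (\<Sum>a\<in>UNIV. z a *\<^sub>C ?g a) x) y = \<eta> * \<beta> x (c (\<Sum>a\<in>UNIV. z a *\<^sub>C ?g a) y)" for z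
      by (simp add: c_simps cbilinear_simps[OF bil] g sum_distrib_left mult.left_commute)
    then show ?thesis using v by metis
  qed
  moreover have "\<eta> = 1 \<or> \<eta> = -1" using E unfolding eigen_def \<eta>_def by blast
  then have "\<eta> \<noteq> 0" by auto
  moreover have "\<exists>x y. \<beta> x y \<noteq> 0" using E unfolding eigen_def by blast
  ultimately show ?thesis using that[of \<beta> \<eta>] bil by blast
qed

end

subsection \<open>Spinors and a Lagrangian subspace\<close>

text \<open>\<open>P\<close> is the half containing \<open>s\<close>, so parity is measured relative
  to \<open>s\<close> rather than to the names \<open>Sp\<close> and \<open>Sm\<close>.\<close>

locale adapted_spinor = spinor_module B c Sp Sm
  for B :: "'v::complex_vector \<Rightarrow> 'v \<Rightarrow> complex" and c :: "'v \<Rightarrow> 's::complex_vector \<Rightarrow> 's" and Sp Sm +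
  fixes \<beta> :: "'s \<Rightarrow> 's \<Rightarrow> complex" and \<eta> :: complex and e f :: "5 \<Rightarrow> 'v" and s :: 's and P Q :: "'s set"
  assumes bil: "cbilinear \<beta>" and nonzero: "\<exists>x y. \<beta> x y \<noteq> 0" and eta: "\<eta> \<noteq> 0"
    and inv: "\<beta> (c v x) y = \<eta> * \<beta> x (c v y)"
    and hyp: "hyperbolic e f" and pure: "s \<in> annihilator e UNIV" and s_nonzero: "s \<noteq> 0"
    and halves: "half_spins P Q" and parity: "s \<in> P"
begin

lemmas \<beta>_simps = cbilinear_simps[OF bil, unfolded scaleC_complex]
lemmas e_f = hyperbolic_c[OF hyp]

lemma e_s [simp]: "c (e i) s = 0"
  using pure by (simp add: annihilator_def)

lemma inv': "\<beta> x (c v y) = \<beta> (c v x) y / \<eta>"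
  using eta by (simp add: inv)

lemma kill [simp]: "\<beta> s (c (e i) t) = 0"
  by (simp add: inv' \<beta>_simps)

text \<open>Applying \<open>c (e i)\<close> to \<open>c v s\<close> leaves
  \<open>2 * B (e i) v\<close> times \<open>s\<close>, so the kernel is orthogonal to all
  \<open>e i\<close>.\<close>

lemma c_s_eq_0_iff: "c v s = 0 \<longleftrightarrow> v \<in> cspan (range e)"
proof
  assume v: "c v s = 0"
  have "B (e i) v = 0" for i
    using c_anticommute[of "e i" v s] v s_nonzero by (simp add: c_simps)
  then show "v \<in> cspan (range e)" by (rule hyperbolic_perp[OF hyp])
next
  assume "v \<in> cspan (range e)"
  then have "s \<in> pure_spinors c (cspan (range e)) \<Longrightarrow> c v s = 0" by (simp add: pure_spinors_def)
  then show "c v s = 0" using pure by (simp add: pure_spinors_annihilator)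
qed

text \<open>The half in which products of \<open>n\<close> vectors applied to \<open>s\<close>
  lie.\<close>

definition par :: "nat \<Rightarrow> 's set"
  where "par n = (if even n then P else Q)"

lemma par_c: "t \<in> par n \<Longrightarrow> c v t \<in> par (Suc n)"
  using half_spinsD(5,6)[OF halves] by (auto simp: par_def)

lemma par_subspace: "csubspace (par n)"
  using half_spinsD(1,2)[OF halves] by (simp add: par_def)

text \<open>The filtration by number of Clifford factors with parity built in: step \<open>k\<close>
  contains step \<open>k - 2\<close>, as \<open>words_add_2\<close> shows, and stays in one
  half.\<close>

primrec words :: "nat \<Rightarrow> 's set"
  where "words 0 = range (\<lambda>z. z *\<^sub>C s)"
  | "words (Suc k) = cspan {c v x | v x. x \<in> words k}"

lemma words_subspace: "csubspace (words k)"
proof (cases k)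
  case 0
  then show ?thesis
    using complex_vector.subspace_span[of "{s}"] by (simp add: complex_vector.span_singleton)
qed simp

lemma words_c: "x \<in> words k \<Longrightarrow> c v x \<in> words (Suc k)"
  by (auto intro: complex_vector.span_base)

lemma words_Suc_induct:
  assumes "x \<in> words (Suc k)" "csubspace {x. R x}" "\<And>v y. y \<in> words k \<Longrightarrow> R (c v y)"
  shows "R x"
proof -
  have "words (Suc k) \<subseteq> {x. R x}"
    unfolding words.simps using assms(2,3) by (intro complex_vector.span_minimal) auto
  then show ?thesis using assms(1) by auto
qed

lemma csubspace_vimage: "csubspace A \<Longrightarrow> clinear l \<Longrightarrow> csubspace {x. l x \<in> A}"
  by (auto simp: complex_vector.subspace_def clinear_0 clinear_add clinear_scale)

lemma e_words_0: "x \<in> words 0 \<Longrightarrow> c (e i) x = 0"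
  by (auto simp: c_simps)

text \<open>Anticommuting \<open>c (e i)\<close> through a product contracts one factor at a time,
  and the last term reaches \<open>s\<close> and vanishes.\<close>

lemma e_words: "x \<in> words (Suc k) \<Longrightarrow> c (e i) x \<in> words k"
proof (induction k arbitrary: x)
  case 0
  show ?case
  proof (rule words_Suc_induct[OF 0])
    show "csubspace {x. c (e i) x \<in> words 0}" by (rule csubspace_vimage[OF words_subspace clinear_c])
    fix v y assume y: "y \<in> words 0"
    then have "c (e i) (c v y) = (2 * B (e i) v) *\<^sub>C y"
      using c_anticommute[of "e i" v y] e_words_0[of y i] c_simps by simp
    then show "c (e i) (c v y) \<in> words 0" using y words_subspace complex_vector.subspace_scale by metis
  qed
next
  case (Suc k)
  show ?case
  proof (rule words_Suc_induct[OF Suc(2)])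
    show "csubspace {x. c (e i) x \<in> words (Suc k)}" by (rule csubspace_vimage[OF words_subspace clinear_c])
    fix v y assume y: "y \<in> words (Suc k)"
    then have "c v (c (e i) y) \<in> words (Suc k)" using Suc(1) words_c by blast
    then show "c (e i) (c v y) \<in> words (Suc k)"
      unfolding c_anticommute[of "e i" v y]
      by (intro complex_vector.subspace_diff complex_vector.subspace_scale words_subspace y)
  qed
qed

text \<open>\<open>?v\<close> is a unit vector, so multiplying by it twice changes nothing.\<close>

lemma words_add_2: "x \<in> words k \<Longrightarrow> x \<in> words (Suc (Suc k))"
proof -
  assume x: "x \<in> words k"
  let ?v = "orthonormal e f (False, 0)"
  have "c ?v (c ?v x) = x" using orthonormal_orthonormal[OF hyp] by (simp add: c_square)
  then show ?thesis using words_c[OF words_c[OF x], of ?v ?v] by simp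
qed

text \<open>Only the \<open>c (f i)\<close> with \<open>i\<close> in \<open>A\<close> are available
  to build \<open>t\<close> from \<open>s\<close>, so at most \<open>card A\<close> factors occur,
  and one fewer if the parity is opposite. The zero case says that a multiple of \<open>s\<close> in
  the wrong half vanishes.\<close>

lemma annihilator_words:
  fixes A :: "5 set"
  shows "t \<in> annihilator e (- A) \<Longrightarrow>
    (t \<in> par (card A) \<longrightarrow> t \<in> words (card A)) \<and>
    (t \<in> par (Suc (card A)) \<longrightarrow> t \<in> (case card A of 0 \<Rightarrow> {0} | Suc k \<Rightarrow> words k))"
proof -
  have "finite A" by simp
  then show "t \<in> annihilator e (- A) \<Longrightarrow>
    (t \<in> par (card A) \<longrightarrow> t \<in> words (card A)) \<and>
    (t \<in> par (Suc (card A)) \<longrightarrow> t \<in> (case card A of 0 \<Rightarrow> {0} | Suc k \<Rightarrow> words k))"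
  proof (induction A arbitrary: t rule: finite_induct)
    case empty
    then obtain z where z: "t = z *\<^sub>C s"
      using annihilator_multiple[OF hyp pure s_nonzero] by auto
    then have "t \<in> P" using parity half_spinsD(1)[OF halves] complex_vector.subspace_scale by blast
    then have "t = 0" if "t \<in> Q" using that half_spinsD(3)[OF halves] by auto
    then show ?case using z by (auto simp: par_def)
  next
    case (insert i A)
    let ?n = "card A"
    \<comment> \<open>Splitting off the index \<open>i\<close>: both \<open>a\<close> and
      \<open>p\<close> are killed by all \<open>e j\<close> with \<open>j\<close> outside
      \<open>A\<close>, and \<open>t = p + c (f i) a\<close>.\<close>
    define a p where "a = c (e i) t" and "p = t - c (f i) a"
    have t_kill: "c (e j) t = 0" if "j \<notin> A" "j \<noteq> i" for j using insert(4) that by (auto simp: annihilator_def)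
    have a_kill: "c (e j) a = 0" if "j \<notin> A" for j
      using t_kill[OF that] e_f(1)[of j i t] e_f(5)[of i t] by (cases "j = i") (auto simp: a_def c_simps)
    then have a_ann: "a \<in> annihilator e (- A)" by (auto simp: annihilator_def)
    have "c (e j) p = 0" if "j \<notin> A" for j
      using t_kill[OF that] e_f(3)[of j i a] a_kill[OF that]
      by (cases "j = i") (auto simp: p_def c_simps, auto simp: a_def)
    then have p_ann: "p \<in> annihilator e (- A)" by (auto simp: annihilator_def)
    have t: "t = p + c (f i) a" by (simp add: p_def)
    note IHa = insert(3)[OF a_ann] and IHp = insert(3)[OF p_ann]
    have par2: "par (Suc (Suc k)) = par k" for k by (simp add: par_def)
    have card: "card (insert i A) = Suc ?n" using insert by simp
    show ?case
      unfolding card nat.case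
    proof (intro conjI impI)
      assume tp: "t \<in> par (Suc ?n)"
      have ap: "a \<in> par ?n" using par_c[OF tp, of "e i"] by (simp add: a_def par2)
      then have "p \<in> par (Suc ?n)"
        unfolding p_def using par_c[OF ap, of "f i"] tp by (intro complex_vector.subspace_diff par_subspace)
      then have "p \<in> words (Suc ?n)"
        using IHp words_add_2 complex_vector.subspace_0[OF words_subspace]
        by (cases ?n) (auto simp del: words.simps)
      moreover have "c (f i) a \<in> words (Suc ?n)" using IHa ap words_c by blast
      ultimately show "t \<in> words (Suc ?n)" using t complex_vector.subspace_add[OF words_subspace] by metis
    next
      assume "t \<in> par (Suc (Suc ?n))"
      then have tp: "t \<in> par ?n" by (simp add: par2)
      have ap: "a \<in> par (Suc ?n)" using par_c[OF tp, of "e i"] by (simp add: a_def)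
      have "p \<in> par ?n"
        unfolding p_def using par_c[OF ap, of "f i"] tp par2 by (intro complex_vector.subspace_diff par_subspace) auto
      then have "p \<in> words ?n" using IHp by blast
      moreover have "c (f i) a \<in> words ?n"
      proof (cases ?n)
        case 0
        then have "a = 0" using IHa ap by simp
        then show ?thesis using complex_vector.subspace_0[OF words_subspace] by (simp add: c_simps del: words.simps)
      next
        case (Suc k)
        then have "a \<in> words k" using IHa ap by simp
        then show ?thesis using words_c Suc by metis
      qed
      ultimately show "t \<in> words ?n" using t complex_vector.subspace_add[OF words_subspace] by metis
    qed
  qed
qed

text \<open>No annihilation condition is left for the full index set. Five factors have the parity
  of \<open>Q\<close>, so \<open>P\<close> is reached with four.\<close>

lemma P_words: "t \<in> P \<Longrightarrow> t \<in> words 4" and Q_words: "t \<in> Q \<Longrightarrow> t \<in> words 5"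
proof -
  have card: "card (UNIV :: 5 set) = Suc 4" by simp
  have "t \<in> annihilator e (- UNIV)" by (simp add: annihilator_def)
  from annihilator_words[OF this, unfolded card nat.case]
  show "t \<in> P \<Longrightarrow> t \<in> words 4" "t \<in> Q \<Longrightarrow> t \<in> words 5" by (auto simp: par_def simp del: words.simps)
qed

section \<open>Nondegeneracy of the pairing, deduced from pure spinors\<close>

lemma split_parity:
  obtains p q where "p \<in> P" "q \<in> Q" "t = p + q"
  using half_spinsD(4)[OF halves, of t] by blast

text \<open>The pure spinor of the opposite subspace spanned by \<open>f\<close>; five raising
  operators put it in \<open>Q\<close>.\<close>

definition top_spinor :: 's
  where "top_spinor = word f indices s"

lemma top_spinor: "c (f i) top_spinor = 0" "top_spinor \<in> Q" "top_spinor \<noteq> 0"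
proof -
  show "top_spinor \<in> Q"
    using word_parity[OF halves parity, of f indices] by (simp add: top_spinor_def indices(3))
  show "c (f i) top_spinor = 0"
    unfolding top_spinor_def using word_kill(1)[OF hyperbolic_swap[OF hyp]] indices(2) by blast
  have "word e (rev indices) top_spinor = s"
    unfolding top_spinor_def by (rule word_inverse[OF hyperbolic_swap[OF hyp] indices(1)]) simp
  then show "top_spinor \<noteq> 0" using s_nonzero clinear_0[OF clinear_word] by metis
qed

text \<open>The functional \<open>\<beta> s\<close> vanishes on the image of each
  \<open>c (e i)\<close>, so \<open>x\<close> may be replaced by \<open>c (f i) (c (e i) x)\<close>.
  Doing so for all \<open>i\<close> lands on the line of \<open>top_spinor\<close>, and two factors
  at a time preserve the half.\<close>

lemma pairing_top:
  obtains r z where "r = z *\<^sub>C top_spinor" "\<beta> s r = \<beta> s x" "x \<in> P \<Longrightarrow> r \<in> P"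
proof -
  have "\<exists>r. \<beta> s r = \<beta> s x \<and> (x \<in> P \<longrightarrow> r \<in> P) \<and> (\<forall>i\<in>A. c (f i) r = 0)" for A :: "5 set"
  proof -
    have "finite A" by simp
    then show ?thesis
    proof (induction A rule: finite_induct)
      case (insert i A)
      then obtain r where r: "\<beta> s r = \<beta> s x" "x \<in> P \<Longrightarrow> r \<in> P" "\<And>j. j \<in> A \<Longrightarrow> c (f j) r = 0" by blast
      let ?r = "c (f i) (c (e i) r)"
      have "\<beta> s ?r = \<beta> s r" using e_f(4)[of i i r] by (simp add: \<beta>_simps)
      moreover have "x \<in> P \<Longrightarrow> ?r \<in> P" using r(2) half_spinsD(5,6)[OF halves] by blast
      moreover have "c (f j) ?r = 0" if "j \<in> insert i A" for j
        using r(3)[of j] that insert(2) e_f(2)[of j i "c (e i) r"] e_f(4)[of j i r] e_f(6)[of i "c (e i) r"]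
        by (cases "j = i") (auto simp: c_simps)
      ultimately show ?case using r(1) by metis
    qed blast
  qed
  from this[of UNIV] obtain r where r: "\<beta> s r = \<beta> s x" "x \<in> P \<Longrightarrow> r \<in> P" "\<And>i. c (f i) r = 0" by blast
  have "r \<in> annihilator f UNIV" "top_spinor \<in> annihilator f UNIV" using r(3) top_spinor(1) by (auto simp: annihilator_def)
  then obtain z where "r = z *\<^sub>C top_spinor"
    using annihilator_multiple[OF hyperbolic_swap[OF hyp] _ top_spinor(3)] by metis
  then show ?thesis using that r by blast
qed

text \<open>The replacement from \<open>pairing_top\<close> stays in \<open>P\<close>, whereas
  \<open>top_spinor\<close> is in \<open>Q\<close>.\<close>

lemma pairing_even: "x \<in> P \<Longrightarrow> \<beta> s x = 0"
proof -
  assume x: "x \<in> P"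
  obtain r z where r: "r = z *\<^sub>C top_spinor" "\<beta> s r = \<beta> s x" "x \<in> P \<Longrightarrow> r \<in> P" using pairing_top[of x] by blast
  have "r \<in> Q" unfolding r(1) using top_spinor(2) half_spinsD(2)[OF halves] complex_vector.subspace_scale by blast
  then have "r = 0" using r(3)[OF x] half_spinsD(3)[OF halves] by blast
  then show "\<beta> s x = 0" using r(2) by (simp add: \<beta>_simps)
qed

lemma pairing_words_even: "x \<in> words k \<Longrightarrow> y \<in> par k \<Longrightarrow> \<beta> x y = 0"
proof (induction k arbitrary: x y)
  case 0
  then show ?case using pairing_even by (auto simp: \<beta>_simps par_def)
next
  case (Suc k)
  show ?case
  proof (rule words_Suc_induct[OF Suc(2)])
    show "csubspace {x. \<beta> x y = 0}" by (rule csubspaceI) (auto simp: \<beta>_simps)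
    fix v x assume "x \<in> words k"
    moreover have "c v y \<in> par k" using par_c[OF Suc(3), of v] by (simp add: par_def)
    ultimately show "\<beta> (c v x) y = 0" using Suc(1) inv by simp
  qed
qed

text \<open>The factors of \<open>x\<close> move to the other argument and leave \<open>s\<close> on
  the left. With \<open>P_words\<close> and \<open>Q_words\<close>, a left radical containing
  \<open>s\<close> would be everything.\<close>

lemma left_annihilator_words: "(\<And>y. \<beta> s y = 0) \<Longrightarrow> x \<in> words k \<Longrightarrow> \<beta> x y = 0"
proof (induction k arbitrary: x y)
  case 0
  then show ?case by (auto simp: \<beta>_simps)
next
  case (Suc k)
  show ?case
  proof (rule words_Suc_induct[OF Suc(3)])
    show "csubspace {x. \<beta> x y = 0}" by (rule csubspaceI) (auto simp: \<beta>_simps)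
    show "\<beta> (c v x) y = 0" if "x \<in> words k" for v x using Suc(1)[OF Suc(2) that] inv by simp
  qed
qed

lemma right_annihilator_words: "(\<And>y. \<beta> y s = 0) \<Longrightarrow> x \<in> words k \<Longrightarrow> \<beta> y x = 0"
proof (induction k arbitrary: x y)
  case 0
  then show ?case by (auto simp: \<beta>_simps)
next
  case (Suc k)
  show ?case
  proof (rule words_Suc_induct[OF Suc(3)])
    show "csubspace {x. \<beta> y x = 0}" by (rule csubspaceI) (auto simp: \<beta>_simps)
    show "\<beta> y (c v x) = 0" if "x \<in> words k" for v x using Suc(1)[OF Suc(2) that] inv' by simp
  qed
qed

lemma pairing_s_top: "\<beta> s top_spinor \<noteq> 0"
proof
  assume zero: "\<beta> s top_spinor = 0"
  have s0: "\<beta> s x = 0" for x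
  proof -
    obtain r z where "r = z *\<^sub>C top_spinor" "\<beta> s r = \<beta> s x" using pairing_top[of x] by blast
    then show ?thesis using zero by (auto simp: \<beta>_simps)
  qed
  have "\<beta> x y = 0" for x y
  proof -
    obtain p q where pq: "p \<in> P" "q \<in> Q" "x = p + q" by (rule split_parity)
    then show ?thesis
      using left_annihilator_words[OF s0 P_words[OF pq(1)]] left_annihilator_words[OF s0 Q_words[OF pq(2)]]
      by (simp add: \<beta>_simps)
  qed
  then show False using nonzero by blast
qed

lemma pairing_right_s: "\<exists>y. \<beta> y s \<noteq> 0"
proof (rule ccontr)
  assume "\<nexists>y. \<beta> y s \<noteq> 0"
  then have s0: "\<beta> y s = 0" for y by blast
  have "\<beta> y x = 0" for x y
  proof -
    obtain p q where pq: "p \<in> P" "q \<in> Q" "x = p + q" by (rule split_parity)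
    then show ?thesis
      using right_annihilator_words[OF s0 P_words[OF pq(1)]] right_annihilator_words[OF s0 Q_words[OF pq(2)]]
      by (simp add: \<beta>_simps)
  qed
  then show False using nonzero by blast
qed

text \<open>The radical is stable under every \<open>c (e i)\<close>. By induction on the set
  \<open>A\<close> of indices whose \<open>e i\<close> may fail to kill \<open>y\<close>, first
  \<open>c (e i) y\<close> and then \<open>y\<close> vanishes; the start is the line of
  \<open>s\<close>, settled by \<open>pairing_right_s\<close>.\<close>

lemma pairing_nondegenerate:
  assumes "\<And>x. \<beta> x y = 0"
  shows "y = 0"
proof -
  have "y = 0" if "y \<in> annihilator e (- A)" "\<And>x. \<beta> x y = 0" for A :: "5 set" and y
  proof -
    have "finite A" by simp
    then show ?thesis using that
    proof (induction A arbitrary: y rule: finite_induct)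
      case empty
      then obtain z where z: "y = z *\<^sub>C s" using annihilator_multiple[OF hyp pure s_nonzero] by auto
      obtain x where "\<beta> x s \<noteq> 0" using pairing_right_s by blast
      moreover have "z * \<beta> x s = 0" using empty(2)[of x] z by (simp add: \<beta>_simps)
      ultimately show ?case using z by simp
    next
      case (insert i A)
      have y: "c (e j) y = 0" if "j \<notin> A" "j \<noteq> i" for j using insert(4) that by (auto simp: annihilator_def)
      have "c (e j) (c (e i) y) = 0" if "j \<notin> A" for j
        using y[OF that] e_f(1)[of j i y] e_f(5)[of i y] by (cases "j = i") (auto simp: c_simps)
      then have "c (e i) y = 0"
        using insert(3)[of "c (e i) y"] insert(5) inv' by (auto simp: annihilator_def)
      then have "y \<in> annihilator e (- A)" using y by (auto simp: annihilator_def)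
      then show ?case using insert(3,5) by blast
    qed
  qed
  from this[of y UNIV] show ?thesis using assms by (simp add: annihilator_def)
qed

subsection \<open>The quadratic map of a spinor\<close>

text \<open>The hypothesis makes \<open>\<sigma>\<close> orthogonal to two-factor spinors, parity
  makes it orthogonal to three-factor ones. Two lowering operators bring every spinor into these, so
  all \<open>c (e i) (c (e j) \<sigma>)\<close> lie in the radical and vanish:
  \<open>\<sigma>\<close> has at most one factor over \<open>s\<close>.\<close>

lemma quadratic_kernel:
  assumes "\<sigma> \<in> Q" "\<And>v w. \<beta> s (c w (c v \<sigma>)) = 0"
  shows "\<exists>v. \<sigma> = c v s"
proof -
  have two: "\<beta> x \<sigma> = 0" if x: "x \<in> words (Suc (Suc 0))" for x
  proof (rule words_Suc_induct[OF x])
    show "csubspace {x. \<beta> x \<sigma> = 0}" by (rule csubspaceI) (auto simp: \<beta>_simps)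
    fix v y assume y: "y \<in> words (Suc 0)"
    show "\<beta> (c v y) \<sigma> = 0"
    proof (rule words_Suc_induct[OF y])
      show "csubspace {y. \<beta> (c v y) \<sigma> = 0}" by (rule csubspaceI) (auto simp: \<beta>_simps c_simps)
      show "\<beta> (c v (c w z)) \<sigma> = 0" if "z \<in> words 0" for w z
        using that assms(2) by (auto simp: inv \<beta>_simps)
    qed
  qed
  have three: "\<beta> x \<sigma> = 0" if "x \<in> words (Suc (Suc (Suc 0)))" for x
    using pairing_words_even[OF that] assms(1) by (simp add: par_def)
  have ee: "c (e i) (c (e j) \<sigma>) = 0" for i j
  proof (rule pairing_nondegenerate)
    fix x
    obtain p q where pq: "p \<in> P" "q \<in> Q" "x = p + q" by (rule split_parity)
    have "p \<in> words (Suc (Suc (Suc (Suc 0))))" "q \<in> words (Suc (Suc (Suc (Suc (Suc 0)))))"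
      using P_words[OF pq(1)] Q_words[OF pq(2)] by (simp_all add: eval_nat_numeral del: words.simps)
    then have "\<beta> (c (e j) (c (e i) p)) \<sigma> = 0" "\<beta> (c (e j) (c (e i) q)) \<sigma> = 0"
      using e_words two three by blast+
    then have "\<beta> (c (e j) (c (e i) x)) \<sigma> = 0" by (simp add: pq(3) c_simps \<beta>_simps)
    then show "\<beta> x (c (e i) (c (e j) \<sigma>)) = 0" by (simp add: inv')
  qed
  have "\<exists>z. c (e j) \<sigma> = z *\<^sub>C s" for j
  proof -
    have "c (e j) \<sigma> \<in> annihilator e UNIV" using ee by (simp add: annihilator_def)
    then show ?thesis using annihilator_multiple[OF hyp pure s_nonzero] by metis
  qed
  then obtain z where z: "\<And>j. c (e j) \<sigma> = z j *\<^sub>C s" by metis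
  \<comment> \<open>Chosen so that \<open>c ?v s\<close> has the same images as
    \<open>\<sigma>\<close> under all \<open>c (e j)\<close>; the difference is then a multiple of
    \<open>s\<close> lying in both halves.\<close>
  let ?v = "\<Sum>j\<in>UNIV. z j *\<^sub>C f j"
  have "c (e k) (\<sigma> - c ?v s) = 0" for k
  proof -
    have "c (e k) (c ?v s) = (\<Sum>j\<in>UNIV. z j *\<^sub>C c (e k) (c (f j) s))" by (simp add: c_simps)
    also have "\<dots> = (\<Sum>j\<in>UNIV. if k = j then z j *\<^sub>C s else 0)"
      by (intro sum.cong) (auto simp: e_f(3) c_simps)
    finally show ?thesis by (simp add: c_simps z)
  qed
  then have "\<sigma> - c ?v s \<in> annihilator e UNIV" by (simp add: annihilator_def)
  then obtain y where "\<sigma> - c ?v s = y *\<^sub>C s" using annihilator_multiple[OF hyp pure s_nonzero] by blast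
  then have "\<sigma> - c ?v s \<in> P" using parity half_spinsD(1)[OF halves] complex_vector.subspace_scale by metis
  moreover have "\<sigma> - c ?v s \<in> Q"
    using assms(1) half_spinsD(2)[OF halves] half_spinsD(5)[OF halves parity] complex_vector.subspace_diff by blast
  ultimately have "\<sigma> - c ?v s = 0" using half_spinsD(3)[OF halves] by blast
  then show ?thesis by (intro exI[of _ ?v]) simp
qed

text \<open>Then \<open>y = c (e l) (c (f l) y)\<close>, and \<open>\<beta> s\<close> vanishes on
  the image of \<open>c (e l)\<close>.\<close>

lemma pairing_annihilated: "c (e l) y = 0 \<Longrightarrow> \<beta> s y = 0"
  using e_f(3)[of l l y] kill[of l "c (f l) y"] by (simp add: c_simps)

text \<open>A product of at most three \<open>f\<close>'s leaves one of the five indices untouched,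
  so \<open>pairing_annihilated\<close> applies; an \<open>e\<close> in any slot contracts to a
  shorter product.\<close>

lemma quadratic_vanish: "\<beta> s (c w (c v (c x s))) = 0"
proof -
  have one: "\<beta> s (c w s) = 0" for w
  proof -
    have "(\<lambda>w. \<beta> s (c w s)) w = (\<lambda>_. 0) w"
    proof (rule hyperbolic_linear_eq[OF hyp])
      show "clinear (\<lambda>w. \<beta> s (c w s))" by (rule clinear_compose[OF clinear_c_left cbilinear_right[OF bil]])
      fix i :: 5
      obtain l where "l \<noteq> i" using ex_new_if_finite by (metis one_neq_zero)
      then have "c (e l) (c (f i) s) = 0" by (simp add: e_f(3) c_simps)
      then show "\<beta> s (c (f i) s) = 0" by (rule pairing_annihilated)
    qed (auto simp: clinear_iff \<beta>_simps)
    then show ?thesis by simp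
  qed
  have three: "\<beta> s (c (f i) (c (f j) (c (f k) s))) = 0" for i j k
  proof -
    have "card {i, j, k} \<le> 3" by (simp add: card_insert_if)
    then have "{i, j, k} \<noteq> UNIV" by auto
    then obtain l where l: "l \<noteq> i" "l \<noteq> j" "l \<noteq> k" by blast
    then have "c (e l) (c (f i) (c (f j) (c (f k) s))) = 0"
      using e_f(3)[of l i] e_f(3)[of l j] e_f(3)[of l k] by (simp add: c_simps)
    then show ?thesis by (rule pairing_annihilated)
  qed
  have lin: "clinear (\<lambda>w. \<beta> s (c w y))" "clinear (\<lambda>w. \<beta> s (c v (c w y)))" "clinear (\<lambda>w. \<beta> s (c u (c v (c w y))))" for u v y
    by (auto intro!: clinear_compose[OF clinear_c_left] clinear_compose[OF clinear_c] cbilinear_right[OF bil])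
  have zero: "clinear (\<lambda>_::'v. 0::complex)" by (simp add: clinear_iff)
  have f3: "\<beta> s (c w (c (f j) (c (f k) s))) = 0" for j k w
    by (rule hyperbolic_linear_eq[OF hyp lin(1) zero]) (simp_all add: three)
  have f2: "\<beta> s (c w (c v (c (f k) s))) = 0" for k v w
  proof (rule hyperbolic_linear_eq[OF hyp lin(2) zero])
    show "\<beta> s (c w (c (e i) (c (f k) s))) = 0" for i
      by (cases "i = k") (simp_all add: e_f(3) c_simps one \<beta>_simps)
  qed (rule f3)
  show ?thesis
    by (rule hyperbolic_linear_eq[OF hyp lin(3) zero]) (simp_all add: c_simps \<beta>_simps f2)
qed

text \<open>The values \<open>T v (f l)\<close> determine \<open>T\<close>. The scalar
  \<open>\<mu>\<close> accounts for \<open>v = e k\<close> and is carried by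
  \<open>top_spinor\<close>; the alternating matrix \<open>T (f i) (f j)\<close> is carried by pairs
  of lowering operators applied to it.\<close>

lemma quadratic_surjective:
  assumes T: "cbilinear T" "\<And>v i. T v (e i) = 0" "\<And>v w. T v w + T w v = 2 * \<mu> * B v w"
  shows "\<exists>\<sigma>\<in>Q. \<forall>v w. \<beta> (c w s) (c v \<sigma>) = T v w"
proof -
  let ?b = "\<beta> s top_spinor"
  \<comment> \<open>Normalises the pairing of \<open>s\<close> with \<open>top_spinor\<close> and
    the factor \<open>\<eta>\<close> acquired when a vector changes sides.\<close>
  let ?a = "1 / (\<eta> * ?b)"
  \<comment> \<open>The half compensates for each unordered pair of indices occurring twice in the
    double sum.\<close>
  let ?\<sigma> = "?a *\<^sub>C (\<mu> *\<^sub>C top_spinor + (\<Sum>i\<in>UNIV. \<Sum>j\<in>UNIV. (T (f i) (f j) / 2) *\<^sub>C c (e i) (c (e j) top_spinor)))"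
  have ftop: "c (f k) (c (e j) top_spinor) = (if k = j then top_spinor else 0)" for k j
    by (simp add: e_f(4) top_spinor(1) c_simps)
  have Q: "?\<sigma> \<in> Q"
    using half_spinsD(5,6)[OF halves] top_spinor(2)
    by (intro complex_vector.subspace_scale complex_vector.subspace_add complex_vector.subspace_sum
        half_spinsD(2)[OF halves]) auto
  have eval: "L ?\<sigma> = ?a * (\<mu> * L top_spinor +
      (\<Sum>i\<in>UNIV. \<Sum>j\<in>UNIV. (T (f i) (f j) / 2) * L (c (e i) (c (e j) top_spinor))))"
    if "clinear L" for L :: "'s \<Rightarrow> complex"
    by (simp only: clinear_add[OF that] clinear_scale[OF that] clinear_sum[OF that] scaleC_complex)
  have lin: "clinear (\<lambda>x. \<beta> s (c v (c w x)))" for v w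
    by (rule clinear_compose[OF clinear_c clinear_compose[OF clinear_c cbilinear_right[OF bil]]])
  have ef: "\<beta> s (c (f l) (c (e k) ?\<sigma>)) = ?a * (\<mu> * (if l = k then ?b else 0))" for k l
  proof -
    have "\<beta> s (c (f l) (c (e k) top_spinor)) = (if l = k then ?b else 0)"
      by (simp add: ftop \<beta>_simps)
    moreover have "\<beta> s (c (f l) (c (e k) (c (e i) x))) = 0" for i x
      by (simp add: e_f(4)[of l k "c (e i) x"] \<beta>_simps)
    ultimately show ?thesis unfolding eval[OF lin] by simp
  qed
  have ff: "\<beta> s (c (f l) (c (f k) ?\<sigma>)) = ?a * ((T (f k) (f l) - T (f l) (f k)) / 2 * ?b)" for k l
  proof -
    have ff1: "\<beta> s (c (f l) (c (f k) (c (e i) (c (e j) top_spinor)))) =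
        (if k = i \<and> l = j then ?b else 0) - (if k = j \<and> l = i then ?b else 0)" for i j
    proof -
      have "c (f k) (c (e i) (c (e j) top_spinor)) = (if k = i then c (e j) top_spinor else 0) -
          (if k = j then c (e i) top_spinor else 0)"
        unfolding e_f(4)[of k i] ftop by (cases "k = j") (simp_all add: c_simps)
      then show ?thesis
        by (cases "k = i"; cases "k = j") (simp_all add: c_simps \<beta>_simps ftop
            clinear_neg[OF clinear_c] clinear_neg[OF cbilinear_right[OF bil]])
    qed
    have distrib: "x * ((if A then y else 0) - (if A' then y else 0)) = (if A then x * y else 0) - (if A' then x * y else 0)"
      for x y :: complex and A A' by simp
    have "\<beta> s (c (f l) (c (f k) ?\<sigma>)) = ?a * (\<Sum>i\<in>UNIV. \<Sum>j\<in>UNIV. (T (f i) (f j) / 2) *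
        ((if k = i \<and> l = j then ?b else 0) - (if k = j \<and> l = i then ?b else 0)))"
      unfolding eval[OF lin] ff1 by (simp add: top_spinor(1) c_simps \<beta>_simps)
    also have "(\<Sum>i\<in>UNIV. \<Sum>j\<in>UNIV. (T (f i) (f j) / 2) *
        ((if k = i \<and> l = j then ?b else 0) - (if k = j \<and> l = i then ?b else 0))) =
        (\<Sum>i\<in>UNIV. \<Sum>j\<in>UNIV. (if k = i \<and> l = j then T (f i) (f j) / 2 * ?b else 0)) -
        (\<Sum>i\<in>UNIV. \<Sum>j\<in>UNIV. (if k = j \<and> l = i then T (f i) (f j) / 2 * ?b else 0))"
      by (simp only: distrib sum_subtractf)
    also have "(\<Sum>i\<in>UNIV. \<Sum>j\<in>UNIV. (if k = i \<and> l = j then T (f i) (f j) / 2 * ?b else 0)) =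
        (\<Sum>i\<in>UNIV. if k = i then T (f i) (f l) / 2 * ?b else 0)"
      by (intro sum.cong refl) simp
    also have "(\<Sum>i\<in>UNIV. \<Sum>j\<in>UNIV. (if k = j \<and> l = i then T (f i) (f j) / 2 * ?b else 0)) =
        (\<Sum>i\<in>UNIV. if l = i then T (f i) (f k) / 2 * ?b else 0)"
      by (intro sum.cong refl) simp
    finally show ?thesis by (simp add: algebra_simps diff_divide_distrib)
  qed
  have a: "\<eta> * (?a * (x * ?b)) = x" for x using eta pairing_s_top by simp
  have eval_f: "\<eta> * \<beta> s (c (f l) (c v ?\<sigma>)) = T v (f l)" for v l
  proof (rule hyperbolic_linear_eq[OF hyp, where l = "\<lambda>v. \<eta> * \<beta> s (c (f l) (c v ?\<sigma>))" and m = "\<lambda>v. T v (f l)"])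
    show "clinear (\<lambda>v. \<eta> * \<beta> s (c (f l) (c v ?\<sigma>)))"
      by (rule clinear_mult_left[OF clinear_compose[OF clinear_c_left clinear_compose[OF clinear_c cbilinear_right[OF bil]]]])
    show "clinear (\<lambda>v. T v (f l))" by (rule cbilinear_left[OF T(1)])
    show "\<eta> * \<beta> s (c (f l) (c (e k) ?\<sigma>)) = T (e k) (f l)" for k
      unfolding ef using T(3)[of "e k" "f l"] T(2)[of "f l" k] a[of \<mu>] hyperbolicD(3)[OF hyp] by auto
    show "\<eta> * \<beta> s (c (f l) (c (f k) ?\<sigma>)) = T (f k) (f l)" for k
    proof -
      have "T (f l) (f k) = - T (f k) (f l)"
        using T(3)[of "f k" "f l"] hyperbolicD(2)[OF hyp] by (simp add: eq_neg_iff_add_eq_0 add.commute)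
      then have "(T (f k) (f l) - T (f l) (f k)) / 2 = T (f k) (f l)" by simp
      then show ?thesis unfolding ff using a by simp
    qed
  qed
  have "\<beta> (c w s) (c v ?\<sigma>) = T v w" for v w
  proof (rule hyperbolic_linear_eq[OF hyp, where l = "\<lambda>w. \<beta> (c w s) (c v ?\<sigma>)" and m = "T v"])
    show "clinear (\<lambda>w. \<beta> (c w s) (c v ?\<sigma>))" by (rule clinear_compose[OF clinear_c_left cbilinear_left[OF bil]])
    show "clinear (T v)" by (rule cbilinear_right[OF T(1)])
    show "\<beta> (c (e i) s) (c v ?\<sigma>) = T v (e i)" for i using T(2) by (simp add: \<beta>_simps)
    show "\<beta> (c (f i) s) (c v ?\<sigma>) = T v (f i)" for i unfolding inv by (rule eval_f)
  qed
  then show ?thesis using Q by blast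
qed

end

section \<open>The maps of the sequence\<close>

text \<open>The pair \<open>e0\<close>, \<open>f0\<close> provides a basis of the constant bundle
  with fibre the vector representation; it does not vary with the point of the variety.\<close>

locale spinor_sequence = spinor_module B c Sp Sm
  for B :: "'v::complex_vector \<Rightarrow> 'v \<Rightarrow> complex" and c :: "'v \<Rightarrow> 's::complex_vector \<Rightarrow> 's" and Sp Sm +
  fixes \<beta> :: "'s \<Rightarrow> 's \<Rightarrow> complex" and \<eta> :: complex and e0 f0 :: "5 \<Rightarrow> 'v" and V4 :: "'s set"
  assumes bil: "cbilinear \<beta>" and nonzero: "\<exists>x y. \<beta> x y \<noteq> 0" and eta: "\<eta> \<noteq> 0"
    and inv: "\<beta> (c v x) y = \<eta> * \<beta> x (c v y)"
    and hyp0: "hyperbolic e0 f0" and V4: "V4 \<in> {Sp, Sm}"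
begin

lemmas \<beta>_simps = cbilinear_simps[OF bil, unfolded scaleC_complex]

definition g :: "bool \<times> 5 \<Rightarrow> 'v"
  where "g = orthonormal e0 f0"

lemma B_g: "B (g a) (g b) = (if a = b then 1 else 0)"
  unfolding g_def by (rule orthonormal_orthonormal[OF hyp0])

lemma g_expand: "(\<Sum>a\<in>UNIV. B (g a) v *\<^sub>C g a) = v"
  unfolding g_def by (rule orthonormal_expand[symmetric]) (simp_all add: orthonormal_orthonormal[OF hyp0])

lemma B_g_sum: "B (g b) (\<Sum>a\<in>UNIV. x a *\<^sub>C g a) = x b"
proof -
  have "B (g b) (\<Sum>a\<in>UNIV. x a *\<^sub>C g a) = (\<Sum>a\<in>UNIV. if a = b then x a else 0)"
    unfolding B_simps by (intro sum.cong) (auto simp: B_g)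
  then show ?thesis by simp
qed

lemma cbasis_g: "cbasis UNIV g UNIV"
proof (rule cbasisI)
  show "\<forall>a\<in>UNIV. x a = 0" if "(\<Sum>a\<in>UNIV. x a *\<^sub>C g a) = 0" for x
    using B_g_sum[of _ x] that by (simp add: B_simps)
  show "\<exists>x. v = (\<Sum>a\<in>UNIV. x a *\<^sub>C g a)" for v 
    by (rule exI[of _ "\<lambda>a. B (g a) v"]) (simp only: g_expand)
qed auto

lemma B_expand: "(\<Sum>a\<in>UNIV. B (g a) v * B (g a) w) = B v w"
proof -
  have "B (\<Sum>a\<in>UNIV. B (g a) v *\<^sub>C g a) w = (\<Sum>a\<in>UNIV. B (g a) v * B (g a) w)" by (simp only: B_simps)
  then show ?thesis unfolding g_expand by simp
qed

text \<open>The tensor of the inverse form of \<open>B\<close>: it has trace 10 and spans a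
  complement of \<open>V_2omega1 B\<close> in the symmetric square.\<close>

definition casimir :: "('v, 'v) tensor"
  where "casimir = (\<Sum>a\<in>UNIV. tens (g a) (g a))"

text \<open>The tensor is the same for every orthonormal basis. Written in a hyperbolic pair each
  summand has a factor in the isotropic subspace, which is why restriction will kill it.\<close>

lemma casimir_hyperbolic:
  assumes "hyperbolic e f"
  shows "casimir = (\<Sum>i\<in>UNIV. 2 *\<^sub>C (tens (e i) (f i) + tens (f i) (e i)))"
proof -
  let ?h = "orthonormal e f"
  have ex: "(\<Sum>b\<in>UNIV. B (?h b) v *\<^sub>C ?h b) = v" for v
    by (rule orthonormal_expand[symmetric]) (simp_all add: orthonormal_orthonormal[OF assms])
  have "casimir = (\<Sum>a\<in>UNIV. tens (g a) (\<Sum>b\<in>UNIV. B (?h b) (g a) *\<^sub>C ?h b))" by (simp only: casimir_def ex)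
  also have "\<dots> = (\<Sum>b\<in>UNIV. tens (\<Sum>a\<in>UNIV. B (g a) (?h b) *\<^sub>C g a) (?h b))"
    by (simp only: tens_simps B_commute[of "?h _"]) (rule sum.swap)
  also have "\<dots> = (\<Sum>b\<in>UNIV. tens (?h b) (?h b))" by (simp only: g_expand)
  also have "\<dots> = (\<Sum>b\<in>UNIV. \<Sum>i\<in>UNIV. tens (?h (b, i)) (?h (b, i)))"
    by (simp add: sum.cartesian_product case_prod_beta UNIV_Times_UNIV)
  also have "\<dots> = (\<Sum>i\<in>UNIV. tens (?h (True, i)) (?h (True, i)) + tens (?h (False, i)) (?h (False, i)))"
    by (simp add: UNIV_bool sum.distrib add.commute)
  also have "\<dots> = (\<Sum>i\<in>UNIV. 2 *\<^sub>C (tens (e i) (f i) + tens (f i) (e i)))"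
  proof (rule sum.cong[OF refl])
    fix i :: 5
    have "tens (\<i> *\<^sub>C (x - y)) (\<i> *\<^sub>C (x - y)) + tens (x + y) (x + y) = 2 *\<^sub>C (tens x y + tens y x)" for x y :: 'v
    proof -
      have two: "2 *\<^sub>C t = t + t" for t :: "('v, 'v) tensor"
        using scaleC_add_left[of 1 1 t] by simp
      have "tens (\<i> *\<^sub>C (x - y)) (\<i> *\<^sub>C (x - y)) = - (tens (x - y) (x - y))" by (simp add: tens_simps(5,6))
      then show ?thesis unfolding two by (simp add: tens_simps(1-4))
    qed
    then show "tens (?h (True, i)) (?h (True, i)) + tens (?h (False, i)) (?h (False, i)) =
        2 *\<^sub>C (tens (e i) (f i) + tens (f i) (e i))"
      by (simp only: orthonormal_def prod.case if_True if_False)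
  qed
  finally show ?thesis .
qed

text \<open>Through \<open>B\<close> the quotient by an isotropic \<open>U\<close> of maximal
  dimension becomes the dual of \<open>U\<close>; extension by zero is the convention of
  \<open>dual_space\<close>.\<close>

definition res :: "'v set \<Rightarrow> 'v \<Rightarrow> 'v \<Rightarrow> complex"
  where "res U v = (\<lambda>u. if u \<in> U then B v u else 0)"

lemma clinear_res: "clinear (res U)"
  by (auto simp: clinear_iff res_def B_simps fun_eq_iff)

lemma res_in_dual: "csubspace U \<Longrightarrow> res U v \<in> dual_space U"
  by (auto simp: dual_space_def clinear_on_def res_def B_simps complex_vector.subspace_add complex_vector.subspace_scale)

lemma dual_res:
  assumes "cbasis I b U" "h \<in> dual_space U"
  shows "\<exists>v. h = res U v"
proof -
  note b = cbasisD[OF assms(1)]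
  obtain l where l: "clinear l" "\<forall>i\<in>I. l (b i) = h (b i)"
    using linear_functional_family[OF b(3,2), of "\<lambda>i. h (b i)"] by (elim exE conjE) (rule that)
  obtain v where v: "\<And>u. B u v = l u" using riesz[OF l(1)] by blast
  have "h = res U v"
    by (rule dual_space_eqI[OF assms res_in_dual[OF b(5)]])
      (use l(2) v b(6) in \<open>auto simp: res_def B_commute[of v]\<close>)
  then show ?thesis by blast
qed

text \<open>The coordinate form on the line of \<open>s\<close>, a generator of the fibre of
  \<open>O(1)\<close> when \<open>s\<close> is a nonzero pure spinor.\<close>

definition spinor_dual :: "'s \<Rightarrow> 's \<Rightarrow> complex"
  where "spinor_dual s = dual_family UNIV (\<lambda>_::unit. s) ()"

text \<open>Slot \<open>a\<close> represents, through \<open>B\<close>, the form sending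
  \<open>w\<close> to \<open>\<beta> (c w s) (c (g a) \<sigma>)\<close>.\<close>

definition quad :: "'s \<Rightarrow> 's \<Rightarrow> bool \<times> 5 \<Rightarrow> 'v"
  where "quad s \<sigma> a = (\<Sum>b\<in>UNIV. \<beta> (c (g b) s) (c (g a) \<sigma>) *\<^sub>C g b)"

text \<open>Encodes an element of the third fibre as a tuple of ten vectors of \<open>U\<close>, one
  for each \<open>g a\<close>, times a generator \<open>p\<close> of the line.\<close>

definition embed :: "(bool \<times> 5 \<Rightarrow> 'v) \<Rightarrow> 'q::complex_vector \<Rightarrow> ('v, ('v, 'q) tensor) tensor"
  where "embed w p = (\<Sum>a\<in>UNIV. tens (g a) (tens (w a) p))"

text \<open>Symmetrisation followed by removal of the trace; the divisor 10 is the trace of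
  \<open>casimir\<close>.\<close>

definition proj :: "(bool \<times> 5 \<Rightarrow> 'v) \<Rightarrow> ('v, 'v) tensor"
  where "proj w = (\<Sum>a\<in>UNIV. (1 / 2) *\<^sub>C (tens (g a) (w a) + tens (w a) (g a))) -
    ((\<Sum>a\<in>UNIV. B (g a) (w a)) / 10) *\<^sub>C casimir"

definition v0 :: 'v
  where "v0 = g (False, 0)"

text \<open>Only the dimension of \<open>V4\<close> matters; \<open>\<kappa>\<close> identifies it with the half-spin module
  opposite to the pure spinors of \<open>U\<close>.\<close>

definition \<kappa> :: "'v set \<Rightarrow> 's \<Rightarrow> 's"
  where "\<kappa> U t = (if pure_spinors c U \<subseteq> V4 then c v0 t else t)"

definition point_spinor :: "'v set \<Rightarrow> 's"
  where "point_spinor U = (SOME s. s \<in> pure_spinors c U \<and> s \<noteq> 0)"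

definition qline :: "'s \<Rightarrow> ('s \<Rightarrow> complex, 's \<Rightarrow> complex) tensor"
  where "qline s = tens (spinor_dual s) (spinor_dual s)"

text \<open>The lift \<open>v\<close> is defined only modulo \<open>U\<close>, which annihilates the
  spinor, so the arbitrary choice has no effect.\<close>

definition \<phi>1 :: "'v set \<Rightarrow> ('v \<Rightarrow> complex) \<Rightarrow> ('s, 's \<Rightarrow> complex) tensor"
  where "\<phi>1 U h = tens (\<kappa> U (c (SOME v. h = res U v) (point_spinor U))) (spinor_dual (point_spinor U))"

text \<open>Replacing the spinor by \<open>z\<close> times it multiplies the preimage
  \<open>\<sigma>\<close> by \<open>z\<close>, hence \<open>quad\<close> by \<open>z\<close>
  squared, while \<open>qline\<close> is divided by \<open>z\<close> squared.\<close>

definition \<phi>2 :: "'v set \<Rightarrow> ('s, 's \<Rightarrow> complex) tensor \<Rightarrow>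
    ('v, ('v, ('s \<Rightarrow> complex, 's \<Rightarrow> complex) tensor) tensor) tensor"
  where "\<phi>2 U t = embed (quad (point_spinor U)
      (\<kappa> U (SOME \<sigma>. \<sigma> \<in> V4 \<and> t = tens \<sigma> (spinor_dual (point_spinor U))))) (qline (point_spinor U))"

definition \<phi>3 :: "'v set \<Rightarrow> ('v, ('v, ('s \<Rightarrow> complex, 's \<Rightarrow> complex) tensor) tensor) tensor \<Rightarrow>
    (('v, 'v) tensor, ('s \<Rightarrow> complex, 's \<Rightarrow> complex) tensor) tensor"
  where "\<phi>3 U t = tens (proj (SOME w. (\<forall>a. w a \<in> U) \<and> t = embed w (qline (point_spinor U))))
      (qline (point_spinor U))"

definition \<phi>4 :: "'v set \<Rightarrow> (('v, 'v) tensor, ('s \<Rightarrow> complex, 's \<Rightarrow> complex) tensor) tensor \<Rightarrow>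
    (('v \<Rightarrow> complex, 'v \<Rightarrow> complex) tensor, ('s \<Rightarrow> complex, 's \<Rightarrow> complex) tensor) tensor"
  where "\<phi>4 U t = tens (tensor_map (res U) (res U)
      (SOME \<tau>. \<tau> \<in> V_2omega1 B \<and> t = tens \<tau> (qline (point_spinor U)))) (qline (point_spinor U))"

lemma clinear_tens_left: "clinear (\<lambda>x. tens x y)" and clinear_tens_right: "clinear (tens x)"
  using cbilinear_tens by (auto simp: cbilinear_def)

lemma clinear_\<kappa>: "clinear (\<kappa> U)"
  unfolding \<kappa>_def using clinear_c clinear_id by (cases "pure_spinors c U \<subseteq> V4") auto

lemma \<kappa>_\<kappa>: "\<kappa> U (\<kappa> U t) = t"
  by (simp add: \<kappa>_def c_square v0_def B_g)

lemma clinear_quad: "clinear (\<lambda>\<sigma>. quad s \<sigma>)"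
  by (rule clinearI) (auto simp: fun_eq_iff quad_def c_simps \<beta>_simps scaleC_add_left sum.distrib
      complex_vector.scale_sum_right)

lemma clinear_embed: "clinear (\<lambda>w. embed w p)"
  unfolding embed_def
  by (intro clinear_sum_fun clinear_compose[OF clinear_apply]
      clinear_compose[OF clinear_tens_left clinear_tens_right])

lemma clinear_proj: "clinear proj"
proof -
  have "clinear (\<lambda>w. (\<Sum>a\<in>UNIV. (1 / 2) *\<^sub>C (tens (g a) (w a) + tens (w a) (g a))) -
    ((\<Sum>a\<in>UNIV. B (g a) (w a)) * (1 / 10)) *\<^sub>C casimir)"
    by (intro clinear_minus clinear_sum_fun clinear_const_scaleC clinear_plus clinear_scaleC_const clinear_mult_right
        clinear_compose[OF clinear_apply clinear_tens_right] clinear_compose[OF clinear_apply clinear_tens_left]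
        clinear_compose[OF clinear_apply cbilinear_right[OF bilinear_B]])
  then show ?thesis by (simp add: proj_def[abs_def])
qed

lemma embed_unique:
  assumes "embed w p = embed w' p" "p \<noteq> 0"
  shows "w = w'"
proof
  fix a
  have "tens (w a) p = tens (w' a) p"
    using tens_sum_unique[of UNIV g "\<lambda>a. tens (w a) p" "\<lambda>a. tens (w' a) p" a] assms(1) cbasisD(2,3)[OF cbasis_g]
    by (simp add: embed_def)
  then show "w a = w' a" using tens_eq_right_unique assms(2) by blast
qed

lemma V_2omega1_subspace: "csubspace (V_2omega1 B)"
  using complex_vector.subspace_0[OF sym2_space_subspace[of UNIV]]
    complex_vector.subspace_add[OF sym2_space_subspace[of UNIV]]
    complex_vector.subspace_scale[OF sym2_space_subspace[of UNIV]]
  by (intro csubspaceI) (auto simp: V_2omega1_def)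

lemma casimir_sym2: "casimir \<in> sym2_space UNIV"
  unfolding casimir_def by (intro complex_vector.subspace_sum sym2_space_subspace sym2_space_square) simp

lemma casimir_B: "casimir B = 10"
  by (simp add: casimir_def sum_fun_apply tens_apply bilinear_B B_g)

lemma proj_in: "proj w \<in> V_2omega1 B"
proof -
  have "proj w \<in> sym2_space UNIV"
    unfolding proj_def
    by (intro complex_vector.subspace_diff complex_vector.subspace_sum complex_vector.subspace_scale
        sym2_space_subspace sym2_space_sym casimir_sym2) auto
  moreover have "proj w B = 0"
    by (simp add: proj_def sum_fun_apply tens_apply bilinear_B casimir_B B_commute[of "w _"])
  ultimately show ?thesis by (simp add: V_2omega1_def)
qed

text \<open>In the basis of tensors of \<open>g a\<close> and \<open>g b\<close> the map
  \<open>proj\<close> becomes matrix symmetrisation minus the normalised trace on the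
  diagonal.\<close>

lemma proj_coefficients:
  "proj w = (\<Sum>a\<in>UNIV. \<Sum>b\<in>UNIV. ((B (g b) (w a) + B (g a) (w b)) / 2 -
    (if a = b then (\<Sum>d\<in>UNIV. B (g d) (w d)) / 10 else 0)) *\<^sub>C tens (g a) (g b))"
proof -
  let ?m = "\<lambda>a b. B (g b) (w a)" and ?k = "(\<Sum>d\<in>UNIV. B (g d) (w d)) / 10"
  have 1: "tens (g a) (w a) = (\<Sum>b\<in>UNIV. ?m a b *\<^sub>C tens (g a) (g b))" for a
    by (simp only: tens_simps(6,8)[symmetric] g_expand)
  have 2: "tens (w a) (g a) = (\<Sum>b\<in>UNIV. ?m a b *\<^sub>C tens (g b) (g a))" for a
    by (simp only: tens_simps(5,7)[symmetric] g_expand)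
  have swap: "(\<Sum>a\<in>UNIV. \<Sum>b\<in>UNIV. (?m a b / 2) *\<^sub>C tens (g b) (g a)) =
      (\<Sum>a\<in>UNIV. \<Sum>b\<in>UNIV. (?m b a / 2) *\<^sub>C tens (g a) (g b))" by (rule sum.swap)
  have diag: "?k *\<^sub>C casimir = (\<Sum>a\<in>UNIV. \<Sum>b\<in>UNIV. (if a = b then ?k else 0) *\<^sub>C tens (g a) (g b))"
  proof -
    have "(\<Sum>b\<in>UNIV. (if a = b then ?k else 0) *\<^sub>C tens (g a) (g b)) = ?k *\<^sub>C tens (g a) (g a)" for a
    proof -
      have "(\<Sum>b\<in>UNIV. (if a = b then ?k else 0) *\<^sub>C tens (g a) (g b)) =
          (\<Sum>b\<in>UNIV. if a = b then ?k *\<^sub>C tens (g a) (g b) else 0)" by (rule sum.cong) auto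
      then show ?thesis by simp
    qed
    then show ?thesis by (simp add: casimir_def complex_vector.scale_sum_right)
  qed
  have "(\<Sum>a\<in>UNIV. (1 / 2) *\<^sub>C (tens (g a) (w a) + tens (w a) (g a))) =
      (\<Sum>a\<in>UNIV. \<Sum>b\<in>UNIV. (?m a b / 2) *\<^sub>C tens (g a) (g b)) +
      (\<Sum>a\<in>UNIV. \<Sum>b\<in>UNIV. (?m a b / 2) *\<^sub>C tens (g b) (g a))"
    unfolding sum.distrib[symmetric]
  proof (rule sum.cong[OF refl])
    fix a
    have "(1 / 2) *\<^sub>C tens (g a) (w a) = (\<Sum>b\<in>UNIV. (?m a b / 2) *\<^sub>C tens (g a) (g b))"
      unfolding 1 by (simp add: complex_vector.scale_sum_right)
    moreover have "(1 / 2) *\<^sub>C tens (w a) (g a) = (\<Sum>b\<in>UNIV. (?m a b / 2) *\<^sub>C tens (g b) (g a))"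
      unfolding 2 by (simp add: complex_vector.scale_sum_right)
    ultimately show "(1 / 2) *\<^sub>C (tens (g a) (w a) + tens (w a) (g a)) =
      (\<Sum>b\<in>UNIV. (?m a b / 2) *\<^sub>C tens (g a) (g b) + (?m a b / 2) *\<^sub>C tens (g b) (g a))"
      by (simp only: scaleC_add_right sum.distrib)
  qed
  then have "proj w = (\<Sum>a\<in>UNIV. \<Sum>b\<in>UNIV. (?m a b / 2) *\<^sub>C tens (g a) (g b)) +
      (\<Sum>a\<in>UNIV. \<Sum>b\<in>UNIV. (?m b a / 2) *\<^sub>C tens (g a) (g b)) -
      (\<Sum>a\<in>UNIV. \<Sum>b\<in>UNIV. (if a = b then ?k else 0) *\<^sub>C tens (g a) (g b))"
    unfolding proj_def swap diag by simp
  then show ?thesis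
    by (simp only: sum.distrib[symmetric] sum_subtractf[symmetric] scaleC_algebra(2,4)[symmetric] add_divide_distrib)
qed

text \<open>The kernel thus consists of matrices that are alternating up to a scalar matrix, the
  shape that the Clifford relation produces.\<close>

lemma proj_eq_0_iff:
  "proj w = 0 \<longleftrightarrow> (\<forall>a b. (B (g b) (w a) + B (g a) (w b)) / 2 =
    (if a = b then (\<Sum>d\<in>UNIV. B (g d) (w d)) / 10 else 0))"
proof
  let ?x = "\<lambda>a b. (B (g b) (w a) + B (g a) (w b)) / 2 - (if a = b then (\<Sum>d\<in>UNIV. B (g d) (w d)) / 10 else 0)"
  assume "proj w = 0"
  then have "(\<Sum>p\<in>UNIV \<times> UNIV. ?x (fst p) (snd p) *\<^sub>C (case p of (a, b) \<Rightarrow> tens (g a) (g b))) = 0"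
    unfolding proj_coefficients by (simp add: sum.cartesian_product case_prod_beta del: UNIV_Times_UNIV)
  note zero = this
  have "?x a b = 0" for a b
    using cbasis_independent[OF cbasis_tens[OF cbasis_g cbasis_g] zero, of "(a, b)"] by simp
  then show "\<forall>a b. (B (g b) (w a) + B (g a) (w b)) / 2 =
    (if a = b then (\<Sum>d\<in>UNIV. B (g d) (w d)) / 10 else 0)" by (simp only: right_minus_eq) simp
next
  let ?x = "\<lambda>a b. (B (g b) (w a) + B (g a) (w b)) / 2 - (if a = b then (\<Sum>d\<in>UNIV. B (g d) (w d)) / 10 else 0)"
  assume "\<forall>a b. (B (g b) (w a) + B (g a) (w b)) / 2 = (if a = b then (\<Sum>d\<in>UNIV. B (g d) (w d)) / 10 else 0)"
  then have "?x a b = 0" for a b by (simp only: right_minus_eq)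
  then show "proj w = 0" unfolding proj_coefficients by (simp only: complex_vector.scale_zero_left sum.neutral_const)
qed

text \<open>Expanding \<open>w\<close> in the orthonormal basis reassembles the sum that defines
  \<open>quad\<close>.\<close>

lemma B_quad: "B (quad s \<sigma> a) w = \<beta> (c w s) (c (g a) \<sigma>)"
proof -
  have "B (quad s \<sigma> a) w = (\<Sum>b\<in>UNIV. B (g b) w * \<beta> (c (g b) s) (c (g a) \<sigma>))"
    unfolding quad_def B_simps by (simp add: mult.commute)
  also have "\<dots> = \<beta> (c (\<Sum>b\<in>UNIV. B (g b) w *\<^sub>C g b) s) (c (g a) \<sigma>)" by (simp only: c_simps \<beta>_simps)
  finally show ?thesis unfolding g_expand .
qed

text \<open>The bridge from a point of the variety to the computations in
  \<open>adapted_spinor\<close>, for any nonzero pure spinor and not only the chosen one.\<close>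

lemma pure_at:
  assumes "U \<in> OG5 B" "s \<in> pure_spinors c U" "s \<noteq> 0"
  obtains e f P Q where "adapted_spinor B c Sp Sm \<beta> \<eta> e f s P Q" "cspan (range e) = U"
proof -
  obtain e f where ef: "hyperbolic e f" "cspan (range e) = U" using OG5_hyperbolic[OF assms(1)] by blast
  have s: "s \<in> annihilator e UNIV" using assms(2) ef(2) pure_spinors_annihilator by metis
  obtain P Q where PQ: "half_spins P Q" "s \<in> P"
    using annihilator_parity[OF ef(1)] s unfolding half_spins_def by blast
  have "adapted_spinor B c Sp Sm \<beta> \<eta> e f s P Q"
    by unfold_locales (fact bil nonzero eta inv ef(1) s assms(3) PQ)+
  then show ?thesis using that ef(2) by blast
qed

lemma pure_line:
  assumes "U \<in> OG5 B" "s \<in> pure_spinors c U" "s \<noteq> 0"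
  shows "cbasis UNIV (\<lambda>_::unit. s) (pure_spinors c U)"
proof -
  obtain e f P Q where "adapted_spinor B c Sp Sm \<beta> \<eta> e f s P Q" and U: "cspan (range e) = U"
    using pure_at[OF assms] .
  then interpret adapted_spinor B c Sp Sm \<beta> \<eta> e f s P Q by simp
  have L: "pure_spinors c U = annihilator e UNIV" unfolding U[symmetric] by (rule pure_spinors_annihilator)
  show ?thesis
    unfolding L
  proof (rule cbasisI)
    show "\<exists>a. x = (\<Sum>i\<in>(UNIV :: unit set). a i *\<^sub>C s)" if x: "x \<in> annihilator e UNIV" for x
    proof -
      obtain z where "x = z *\<^sub>C s" using annihilator_multiple[OF hyp pure s_nonzero x] .
      then show ?thesis by (intro exI[of _ "\<lambda>_. z"]) (simp add: UNIV_unit)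
    qed
  qed (use pure s_nonzero annihilator_subspace in \<open>auto simp: UNIV_unit\<close>)
qed

lemma ex_pure:
  assumes "U \<in> OG5 B" shows "\<exists>s. s \<in> pure_spinors c U \<and> s \<noteq> 0"
proof -
  obtain e f where ef: "hyperbolic e f" "cspan (range e) = U" using OG5_hyperbolic[OF assms] by blast
  obtain s where "s \<noteq> 0" "annihilator e UNIV = range (\<lambda>z. z *\<^sub>C s)" using annihilator_line[OF ef(1)] .
  then show ?thesis using pure_spinors_annihilator[of e] ef(2) by (metis rangeI scaleC_one)
qed

lemma point_spinor: "U \<in> OG5 B \<Longrightarrow> point_spinor U \<in> pure_spinors c U \<and> point_spinor U \<noteq> 0"
  unfolding point_spinor_def by (rule someI_ex[OF ex_pure])

lemma spinor_dual_self: "s \<noteq> 0 \<Longrightarrow> spinor_dual s s = 1"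
proof -
  assume "s \<noteq> 0"
  then have "cindependent {s}" by (simp add: complex_vector.independent_insert)
  then have "cbasis UNIV (\<lambda>_::unit. s) (cspan {s})" by (simp add: cbasis_def UNIV_unit inj_on_def)
  from dual_family_basis[OF this, of "()" "()"] show ?thesis by (simp add: spinor_dual_def)
qed

lemma spinor_dual_nonzero: "s \<noteq> 0 \<Longrightarrow> spinor_dual s \<noteq> 0"
  using spinor_dual_self by fastforce

lemma qline_nonzero: "s \<noteq> 0 \<Longrightarrow> qline s \<noteq> 0"
  using tens_eq_right_unique[of "spinor_dual s" "spinor_dual s" 0] spinor_dual_nonzero
  by (auto simp: qline_def tens_simps)

lemma spinor_dual_scale:
  assumes "U \<in> OG5 B" "s \<in> pure_spinors c U" "s \<noteq> 0" "s' \<in> pure_spinors c U" "s' \<noteq> 0"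
  obtains z where "z \<noteq> 0" "s' = z *\<^sub>C s" "spinor_dual s' = (1 / z) *\<^sub>C spinor_dual s"
proof -
  note b = pure_line[OF assms(1-3)] and b' = pure_line[OF assms(1,4,5)]
  obtain z where z: "s' = z *\<^sub>C s" using dual_family_expand[OF b assms(4)] by (auto simp: UNIV_unit)
  then have nz: "z \<noteq> 0" using assms(5) by auto
  have "spinor_dual s' = (1 / z) *\<^sub>C spinor_dual s"
  proof (rule dual_space_eqI[OF b])
    show "spinor_dual s' \<in> dual_space (pure_spinors c U)" "(1 / z) *\<^sub>C spinor_dual s \<in> dual_space (pure_spinors c U)"
      unfolding spinor_dual_def
      by (intro complex_vector.subspace_scale dual_space_subspace dual_family_in_dual[OF b'] dual_family_in_dual[OF b])+
    have "clinear_on (pure_spinors c U) (spinor_dual s')"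
      using dual_family_in_dual[OF b'] by (simp add: spinor_dual_def dual_space_def)
    then have "spinor_dual s' (z *\<^sub>C s) = z * spinor_dual s' s" using assms(2) by (simp add: clinear_on_def)
    then have "z * spinor_dual s' s = 1" using spinor_dual_self[OF assms(5)] z by simp
    then show "spinor_dual s' s = ((1 / z) *\<^sub>C spinor_dual s) s"
      using nz by (simp add: spinor_dual_self[OF assms(3)] field_simps)
  qed
  then show ?thesis using that z nz by blast
qed

lemma dual_line:
  assumes "U \<in> OG5 B" "s \<in> pure_spinors c U" "s \<noteq> 0"
  shows "dual_space (pure_spinors c U) = cspan {spinor_dual s}"
  using cbasisD(4)[OF cbasis_dual[OF pure_line[OF assms]]] by (simp add: spinor_dual_def UNIV_unit)

lemma dual_line_square:
  assumes "U \<in> OG5 B" "s \<in> pure_spinors c U" "s \<noteq> 0"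
  shows "tensor_space (dual_space (pure_spinors c U)) (dual_space (pure_spinors c U)) = cspan {qline s}"
  using cbasisD(4)[OF cbasis_tens[OF cbasis_dual[OF pure_line[OF assms]] cbasis_dual[OF pure_line[OF assms]]]]
  by (simp add: spinor_dual_def qline_def UNIV_unit)

section \<open>Independence of the four maps from the chosen representatives\<close>

lemma V4_subspace: "csubspace V4"
  using V4 half_spin_subspace by auto

text \<open>Valid for every nonzero pure spinor and every lift; with a regular choice of
  \<open>s\<close> it becomes the formula in a chart.\<close>

lemma \<phi>1_eq:
  assumes "U \<in> OG5 B" "s \<in> pure_spinors c U" "s \<noteq> 0"
  shows "\<phi>1 U (res U v) = tens (\<kappa> U (c v s)) (spinor_dual s)"
proof -
  let ?s = "point_spinor U" and ?v = "SOME v'. res U v = res U v'"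
  have s: "?s \<in> pure_spinors c U" "?s \<noteq> 0" using point_spinor[OF assms(1)] by auto
  obtain z where z: "z \<noteq> 0" "?s = z *\<^sub>C s" "spinor_dual ?s = (1 / z) *\<^sub>C spinor_dual s"
    using spinor_dual_scale[OF assms s] .
  have "res U v = res U ?v" by (rule someI[of "\<lambda>v'. res U v = res U v'", OF refl])
  note eq = this
  have r: "res U x u = B x u" if "u \<in> U" for x u using that by (simp add: res_def)
  have res: "B v u = B ?v u" if "u \<in> U" for u using fun_cong[OF eq, of u] unfolding r[OF that] .
  obtain e f P Q where "adapted_spinor B c Sp Sm \<beta> \<eta> e f s P Q" and U: "cspan (range e) = U"
    using pure_at[OF assms] .
  then interpret adapted_spinor B c Sp Sm \<beta> \<eta> e f s P Q by simp
  \<comment> \<open>Two lifts with equal restriction differ by a vector orthogonal to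
    \<open>U\<close>, hence in \<open>U\<close>, hence killing \<open>s\<close>.\<close>
  have "c (?v - v) s = 0"
    unfolding c_s_eq_0_iff
    by (rule hyperbolic_perp[OF hyp]) (use res U in \<open>auto simp: B_simps B_commute[of "e _"] complex_vector.span_base\<close>)
  then have "c ?v s = c v s" by (simp add: c_simps)
  then show ?thesis
    using z by (simp add: \<phi>1_def c_simps clinear_scale[OF clinear_\<kappa>] tens_simps)
qed

lemma \<phi>2_eq:
  assumes "U \<in> OG5 B" "s \<in> pure_spinors c U" "s \<noteq> 0" "\<sigma> \<in> V4"
  shows "\<phi>2 U (tens \<sigma> (spinor_dual s)) = embed (quad s (\<kappa> U \<sigma>)) (qline s)"
proof -
  let ?s = "point_spinor U"
  have s: "?s \<in> pure_spinors c U" "?s \<noteq> 0" using point_spinor[OF assms(1)] by auto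
  obtain z where z: "z \<noteq> 0" "?s = z *\<^sub>C s" "spinor_dual ?s = (1 / z) *\<^sub>C spinor_dual s"
    using spinor_dual_scale[OF assms(1-3) s] .
  let ?\<sigma> = "SOME \<sigma>'. \<sigma>' \<in> V4 \<and> tens \<sigma> (spinor_dual s) = tens \<sigma>' (spinor_dual ?s)"
  \<comment> \<open>The dual spinor was divided by \<open>z\<close>, so the preimage for the chosen
    spinor must be \<open>z\<close> times \<open>\<sigma>\<close>; uniqueness then identifies the
    value of \<open>SOME\<close>.\<close>
  have "z *\<^sub>C \<sigma> \<in> V4 \<and> tens \<sigma> (spinor_dual s) = tens (z *\<^sub>C \<sigma>) (spinor_dual ?s)"
    using z assms(4) V4_subspace complex_vector.subspace_scale by (auto simp: tens_simps)
  note ex = this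
  have "?\<sigma> \<in> V4 \<and> tens \<sigma> (spinor_dual s) = tens ?\<sigma> (spinor_dual ?s)"
    by (rule someI[of "\<lambda>\<sigma>'. \<sigma>' \<in> V4 \<and> tens \<sigma> (spinor_dual s) = tens \<sigma>' (spinor_dual ?s)", OF ex])
  with ex have "tens ?\<sigma> (spinor_dual ?s) = tens (z *\<^sub>C \<sigma>) (spinor_dual ?s)" by (elim conjE) (erule (1) trans[OF sym])
  then have "?\<sigma> = z *\<^sub>C \<sigma>" using tens_eq_right_unique spinor_dual_nonzero[OF s(2)] by blast
  \<comment> \<open>One factor \<open>z\<close> comes from the spinor, the other from the rescaled
    preimage.\<close>
  moreover have "quad (z *\<^sub>C s) (z *\<^sub>C x) = (z * z) *\<^sub>C quad s x" for x
    by (simp add: fun_eq_iff quad_def c_simps \<beta>_simps complex_vector.scale_sum_right mult.assoc)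
  moreover have "qline ?s = (1 / (z * z)) *\<^sub>C qline s"
    unfolding qline_def z(3) by (simp add: tens_simps)
  ultimately show ?thesis
    using z(1,2) by (simp add: \<phi>2_def clinear_scale[OF clinear_\<kappa>] embed_def tens_simps)
qed

lemma qline_scale:
  assumes "U \<in> OG5 B" "s \<in> pure_spinors c U" "s \<noteq> 0" "s' \<in> pure_spinors c U" "s' \<noteq> 0"
  obtains y where "y \<noteq> 0" "qline s' = y *\<^sub>C qline s"
proof -
  obtain z where z: "z \<noteq> 0" "s' = z *\<^sub>C s" "spinor_dual s' = (1 / z) *\<^sub>C spinor_dual s"
    using spinor_dual_scale[OF assms] .
  have "qline s' = (1 / (z * z)) *\<^sub>C qline s"
    unfolding qline_def z(3) by (simp add: tens_simps)
  then show ?thesis using that[of "1 / (z * z)"] z(1) by simp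
qed

lemma \<phi>3_eq:
  assumes "U \<in> OG5 B" "s \<in> pure_spinors c U" "s \<noteq> 0" "\<And>a. w a \<in> U"
  shows "\<phi>3 U (embed w (qline s)) = tens (proj w) (qline s)"
proof -
  let ?s = "point_spinor U"
  have s: "?s \<in> pure_spinors c U" "?s \<noteq> 0" using point_spinor[OF assms(1)] by auto
  obtain y where y: "y \<noteq> 0" "qline s = y *\<^sub>C qline ?s" using qline_scale[OF assms(1) s assms(2,3)] .
  let ?w = "SOME w'. (\<forall>a. w' a \<in> U) \<and> embed w (qline s) = embed w' (qline ?s)"
  have U: "csubspace U" using assms(1) by (simp add: OG5_def grassmannian5_def)
  have "(\<forall>a. (y *\<^sub>C w) a \<in> U) \<and> embed w (qline s) = embed (y *\<^sub>C w) (qline ?s)"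
    using y(2) assms(4) complex_vector.subspace_scale[OF U] by (simp add: embed_def tens_simps)
  note ex = this
  have "(\<forall>a. ?w a \<in> U) \<and> embed w (qline s) = embed ?w (qline ?s)"
    by (rule someI[of "\<lambda>w'. (\<forall>a. w' a \<in> U) \<and> embed w (qline s) = embed w' (qline ?s)", OF ex])
  with ex have "embed ?w (qline ?s) = embed (y *\<^sub>C w) (qline ?s)" by (elim conjE) (erule (1) trans[OF sym])
  then have w: "?w = y *\<^sub>C w" by (rule embed_unique[OF _ qline_nonzero[OF s(2)]])
  have "\<phi>3 U (embed w (qline s)) = tens (proj (y *\<^sub>C w)) (qline ?s)" unfolding \<phi>3_def w ..
  then show ?thesis using y(2) by (simp add: clinear_scale[OF clinear_proj] tens_simps(5,6))
qed

lemma \<phi>4_eq: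
  assumes "U \<in> OG5 B" "s \<in> pure_spinors c U" "s \<noteq> 0" "\<tau> \<in> V_2omega1 B"
  shows "\<phi>4 U (tens \<tau> (qline s)) = tens (tensor_map (res U) (res U) \<tau>) (qline s)"
proof -
  let ?s = "point_spinor U"
  have s: "?s \<in> pure_spinors c U" "?s \<noteq> 0" using point_spinor[OF assms(1)] by auto
  obtain y where y: "y \<noteq> 0" "qline s = y *\<^sub>C qline ?s" using qline_scale[OF assms(1) s assms(2,3)] .
  let ?t = "SOME \<tau>'. \<tau>' \<in> V_2omega1 B \<and> tens \<tau> (qline s) = tens \<tau>' (qline ?s)"
  have "y *\<^sub>C \<tau> \<in> V_2omega1 B \<and> tens \<tau> (qline s) = tens (y *\<^sub>C \<tau>) (qline ?s)"
    using y(2) assms(4) complex_vector.subspace_scale[OF V_2omega1_subspace] by (simp add: tens_simps)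
  note ex = this
  have "?t \<in> V_2omega1 B \<and> tens \<tau> (qline s) = tens ?t (qline ?s)"
    by (rule someI[of "\<lambda>\<tau>'. \<tau>' \<in> V_2omega1 B \<and> tens \<tau> (qline s) = tens \<tau>' (qline ?s)", OF ex])
  with ex have "tens ?t (qline ?s) = tens (y *\<^sub>C \<tau>) (qline ?s)" by (elim conjE) (erule (1) trans[OF sym])
  then have t: "?t = y *\<^sub>C \<tau>" by (rule tens_eq_right_unique[OF _ qline_nonzero[OF s(2)]])
  have "\<phi>4 U (tens \<tau> (qline s)) = tens (tensor_map (res U) (res U) (y *\<^sub>C \<tau>)) (qline ?s)"
    unfolding \<phi>4_def t ..
  then show ?thesis using y(2) by (simp add: clinear_scale[OF clinear_tensor_map] tens_simps(5,6))
qed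

end

text \<open>For maps defined by choosing preimages: linearity follows once a linear parametrisation
  \<open>J\<close> of the domain turns the map into a linear formula \<open>F\<close>.\<close>

lemma clinear_on_param:
  assumes "csubspace A" "clinear J" "clinear F" "\<And>x. x \<in> E \<Longrightarrow> \<exists>a\<in>A. x = J a" "\<And>a. a \<in> A \<Longrightarrow> \<phi> (J a) = F a"
  shows "clinear_on E \<phi>"
  unfolding clinear_on_def
proof (intro conjI ballI allI)
  fix x y z assume x: "x \<in> E"
  obtain a where a: "a \<in> A" "x = J a" using assms(4)[OF x] by blast
  have "z *\<^sub>C a \<in> A" using a(1) assms(1) complex_vector.subspace_scale by blast
  then show "\<phi> (z *\<^sub>C x) = z *\<^sub>C \<phi> x"
    using a assms(5) by (simp add: clinear_scale[OF assms(2), symmetric] clinear_scale[OF assms(3), symmetric])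
  assume y: "y \<in> E"
  obtain b where b: "b \<in> A" "y = J b" using assms(4)[OF y] by blast
  have "a + b \<in> A" using a(1) b(1) assms(1) complex_vector.subspace_add by blast
  then show "\<phi> (x + y) = \<phi> x + \<phi> y"
    using a b assms(5) by (simp add: clinear_add[OF assms(2), symmetric] clinear_add[OF assms(3), symmetric])
qed

section \<open>Linearity, targets and exactness in the fibre over a fixed point\<close>

context spinor_sequence
begin

definition F2 :: "'v set \<Rightarrow> ('s, 's \<Rightarrow> complex) tensor set"
  where "F2 U = tensor_space V4 (dual_space (pure_spinors c U))"

definition O2 :: "'v set \<Rightarrow> ('s \<Rightarrow> complex, 's \<Rightarrow> complex) tensor set"
  where "O2 U = tensor_space (dual_space (pure_spinors c U)) (dual_space (pure_spinors c U))"

definition F3 :: "'v set \<Rightarrow> ('v, ('v, ('s \<Rightarrow> complex, 's \<Rightarrow> complex) tensor) tensor) tensor set"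
  where "F3 U = tensor_space UNIV (tensor_space U (O2 U))"

definition F4 :: "'v set \<Rightarrow> (('v, 'v) tensor, ('s \<Rightarrow> complex, 's \<Rightarrow> complex) tensor) tensor set"
  where "F4 U = tensor_space (V_2omega1 B) (O2 U)"

definition F5 :: "'v set \<Rightarrow> (('v \<Rightarrow> complex, 'v \<Rightarrow> complex) tensor, ('s \<Rightarrow> complex, 's \<Rightarrow> complex) tensor) tensor set"
  where "F5 U = tensor_space (sym2_space (dual_space U)) (O2 U)"

context
  fixes U and s :: 's
  assumes U: "U \<in> OG5 B" and s: "s \<in> pure_spinors c U" "s \<noteq> 0"
begin

lemma U_subspace: "csubspace U"
  using U by (simp add: OG5_def grassmannian5_def)

lemma res_isotropic: "w \<in> U \<Longrightarrow> res U w = 0"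
  using U by (auto simp: OG5_def res_def fun_eq_iff)

lemma U_basis: obtains e :: "5 \<Rightarrow> 'v" where "cbasis UNIV e U"
  using OG5_hyperbolic[OF U] hyperbolic_cbasis by metis

lemma F1_iff: "h \<in> dual_space U \<longleftrightarrow> (\<exists>v\<in>UNIV. h = res U v)"
  using U_basis dual_res res_in_dual[OF U_subspace] by (metis UNIV_I)

lemma F2_iff: "t \<in> F2 U \<longleftrightarrow> (\<exists>\<sigma>\<in>V4. t = tens \<sigma> (spinor_dual s))"
  unfolding F2_def dual_line[OF U s]
  by (auto dest: tensor_space_line[OF V4_subspace] intro!: tens_in_tensor_space complex_vector.span_base)

text \<open>The basis \<open>g\<close> resolves the first tensor factor and \<open>qline s\<close>
  spans the last one, so only a tuple in \<open>U\<close> remains.\<close>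

lemma F3_iff: "t \<in> F3 U \<longleftrightarrow> (\<exists>w\<in>{w. \<forall>a. w a \<in> U}. t = embed w (qline s))"
proof
  assume "t \<in> F3 U"
  then have "t \<in> tensor_space UNIV (tensor_space U (cspan {qline s}))"
    by (simp add: F3_def O2_def dual_line_square[OF U s])
  from tensor_space_expand_left[OF cbasis_g tensor_space_subspace this] obtain y where
    y: "\<And>a. y a \<in> tensor_space U (cspan {qline s})" "t = (\<Sum>a\<in>UNIV. tens (g a) (y a))" by auto
  obtain w where w: "\<And>a. w a \<in> U" "\<And>a. y a = tens (w a) (qline s)"
    using tensor_space_line[OF U_subspace y(1)] by metis
  then show "\<exists>w\<in>{w. \<forall>a. w a \<in> U}. t = embed w (qline s)" using y(2) by (auto simp: embed_def)
next
  assume "\<exists>w\<in>{w. \<forall>a. w a \<in> U}. t = embed w (qline s)"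
  then show "t \<in> F3 U"
    unfolding F3_def O2_def dual_line_square[OF U s] embed_def
    by (auto intro!: complex_vector.subspace_sum tensor_space_subspace tens_in_tensor_space complex_vector.span_base)
qed

lemma F4_iff: "t \<in> F4 U \<longleftrightarrow> (\<exists>\<tau>\<in>V_2omega1 B. t = tens \<tau> (qline s))"
  unfolding F4_def O2_def dual_line_square[OF U s]
  by (auto dest: tensor_space_line[OF V_2omega1_subspace] intro!: tens_in_tensor_space complex_vector.span_base)

lemma F5_iff: "t \<in> F5 U \<longleftrightarrow> (\<exists>\<tau>\<in>sym2_space (dual_space U). t = tens \<tau> (qline s))"
  unfolding F5_def O2_def dual_line_square[OF U s]
  by (auto dest: tensor_space_line[OF sym2_space_subspace] intro!: tens_in_tensor_space complex_vector.span_base)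

lemma \<phi>1_linear: "clinear_on (dual_space U) (\<phi>1 U)"
  by (rule clinear_on_param[OF complex_vector.subspace_UNIV clinear_res[of U]
        clinear_compose[OF clinear_compose[OF clinear_c_left clinear_\<kappa>] clinear_tens_left]])
    (simp add: F1_iff, rule \<phi>1_eq[OF U s])

lemma \<phi>2_linear: "clinear_on (F2 U) (\<phi>2 U)"
  by (rule clinear_on_param[OF V4_subspace clinear_tens_left
        clinear_compose[OF clinear_compose[OF clinear_\<kappa> clinear_quad] clinear_embed]])
    (simp add: F2_iff, rule \<phi>2_eq[OF U s])

lemma \<phi>3_linear: "clinear_on (F3 U) (\<phi>3 U)"
proof (rule clinear_on_param[OF _ clinear_embed clinear_compose[OF clinear_proj clinear_tens_left]])
  show "csubspace {w. \<forall>a. w a \<in> U}"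
    using U_subspace by (auto simp: complex_vector.subspace_def)
  show "\<exists>w\<in>{w. \<forall>a. w a \<in> U}. t = embed w (qline s)" if "t \<in> F3 U" for t using that F3_iff by blast
  show "\<phi>3 U (embed w (qline s)) = tens (proj w) (qline s)" if "w \<in> {w. \<forall>a. w a \<in> U}" for w
    by (rule \<phi>3_eq[OF U s]) (use that in blast)
qed

lemma \<phi>4_linear: "clinear_on (F4 U) (\<phi>4 U)"
  by (rule clinear_on_param[OF V_2omega1_subspace clinear_tens_left
        clinear_compose[OF clinear_tensor_map clinear_tens_left]])
    (simp add: F4_iff, rule \<phi>4_eq[OF U s])

text \<open>Where \<open>V4\<close> is the half of \<open>s\<close>, the unit vector
  \<open>v0\<close> exchanges the halves; where it is the other half, \<open>\<kappa>\<close> is the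
  identity.\<close>

lemma pure_at_parity:
  obtains e f P Q where "adapted_spinor B c Sp Sm \<beta> \<eta> e f s P Q" "cspan (range e) = U"
    "\<And>t. t \<in> V4 \<Longrightarrow> \<kappa> U t \<in> Q" "\<And>t. t \<in> Q \<Longrightarrow> \<kappa> U t \<in> V4"
proof -
  obtain e f P Q where ad: "adapted_spinor B c Sp Sm \<beta> \<eta> e f s P Q" and Ue: "cspan (range e) = U"
    using pure_at[OF U s] .
  interpret adapted_spinor B c Sp Sm \<beta> \<eta> e f s P Q by (rule ad)
  have "V4 = P \<or> V4 = Q" using V4 halves by (auto simp: half_spins_def)
  then have "(\<forall>t\<in>V4. \<kappa> U t \<in> Q) \<and> (\<forall>t\<in>Q. \<kappa> U t \<in> V4)"
  proof
    assume V: "V4 = P"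
    have "pure_spinors c U \<subseteq> V4"
    proof
      fix t assume "t \<in> pure_spinors c U"
      then obtain z where "t = z *\<^sub>C s"
        using dual_family_expand[OF pure_line[OF U s]] by (auto simp: UNIV_unit)
      then show "t \<in> V4" using V parity half_spinsD(1)[OF halves] complex_vector.subspace_scale by blast
    qed
    then have "\<kappa> U t = c v0 t" for t by (simp add: \<kappa>_def)
    then show ?thesis unfolding V using half_spinsD(5,6)[OF halves] by simp
  next
    assume V: "V4 = Q"
    have "s \<notin> V4" using V parity s(2) half_spinsD(3)[OF halves] by blast
    then have "\<not> pure_spinors c U \<subseteq> V4" using s(1) by blast
    then have "\<kappa> U t = t" for t by (simp add: \<kappa>_def)
    then show ?thesis unfolding V by simp
  qed
  then show ?thesis using that ad Ue by blast
qed

lemma \<kappa>_c: "\<kappa> U (c v s) \<in> V4"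
proof -
  obtain e f P Q where ad: "adapted_spinor B c Sp Sm \<beta> \<eta> e f s P Q" "\<And>t. t \<in> Q \<Longrightarrow> \<kappa> U t \<in> V4"
    using pure_at_parity by metis
  interpret adapted_spinor B c Sp Sm \<beta> \<eta> e f s P Q by (rule ad)
  show ?thesis using ad(2) parity half_spinsD(5)[OF halves] by blast
qed

text \<open>Pairing with \<open>e i\<close> produces \<open>c (e i) s = 0\<close>, and
  \<open>U\<close> is its own orthogonal.\<close>

lemma quad_in_U: "quad s \<sigma> a \<in> U"
proof -
  obtain e f P Q where ad: "adapted_spinor B c Sp Sm \<beta> \<eta> e f s P Q" "cspan (range e) = U"
    using pure_at_parity by metis
  interpret adapted_spinor B c Sp Sm \<beta> \<eta> e f s P Q by (rule ad)
  have "B (e i) (quad s \<sigma> a) = 0" for i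
    using B_quad[of s \<sigma> a "e i"] by (simp add: B_commute[of "e i"] \<beta>_simps)
  then show ?thesis using hyperbolic_perp[OF hyp] ad(2) by blast
qed

lemma \<phi>1_into: "h \<in> dual_space U \<Longrightarrow> \<phi>1 U h \<in> F2 U"
  unfolding F1_iff F2_iff using \<phi>1_eq[OF U s] \<kappa>_c by blast

lemma \<phi>2_into: "t \<in> F2 U \<Longrightarrow> \<phi>2 U t \<in> F3 U"
proof -
  assume "t \<in> F2 U"
  then obtain \<sigma> where "\<sigma> \<in> V4" "t = tens \<sigma> (spinor_dual s)" using F2_iff by blast
  then have "\<phi>2 U t = embed (quad s (\<kappa> U \<sigma>)) (qline s)" using \<phi>2_eq[OF U s] by blast
  then show "\<phi>2 U t \<in> F3 U" unfolding F3_iff using quad_in_U by blast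
qed

lemma \<phi>3_into: "t \<in> F3 U \<Longrightarrow> \<phi>3 U t \<in> F4 U"
  unfolding F3_iff F4_iff using \<phi>3_eq[OF U s] proj_in by blast

lemma tensor_map_res_in: "\<tau> \<in> V_2omega1 B \<Longrightarrow> tensor_map (res U) (res U) \<tau> \<in> sym2_space (dual_space U)"
proof -
  have "tensor_map (res U) (res U) t \<in> sym2_space (dual_space U)" if "t \<in> sym2_space UNIV" for t
    using that
  proof (induction rule: sym2_space_induct)
    case zero
    show ?case unfolding clinear_0[OF clinear_tensor_map] by (rule complex_vector.subspace_0[OF sym2_space_subspace])
  next
    case (add t t')
    then show ?case
      unfolding clinear_add[OF clinear_tensor_map] by (rule complex_vector.subspace_add[OF sym2_space_subspace])
  next
    case (scale a t)
    then show ?case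
      unfolding clinear_scale[OF clinear_tensor_map] by (rule complex_vector.subspace_scale[OF sym2_space_subspace])
  next
    case (square x)
    then show ?case
      using res_in_dual[OF U_subspace] by (simp add: tensor_map_tens clinear_res sym2_space_square)
  qed
  then show "\<tau> \<in> V_2omega1 B \<Longrightarrow> tensor_map (res U) (res U) \<tau> \<in> sym2_space (dual_space U)"
    by (simp add: V_2omega1_def)
qed

lemma \<phi>4_into: "t \<in> F4 U \<Longrightarrow> \<phi>4 U t \<in> F5 U"
  unfolding F4_iff F5_iff using \<phi>4_eq[OF U s] tensor_map_res_in by blast

text \<open>\<open>\<kappa>\<close> is an involution, and the vectors killing \<open>s\<close> are
  those of \<open>U\<close>, which restrict to zero.\<close>

lemma \<phi>1_inj: "inj_on (\<phi>1 U) (dual_space U)"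
proof (rule inj_onI)
  fix h h' assume "h \<in> dual_space U" "h' \<in> dual_space U" and eq: "\<phi>1 U h = \<phi>1 U h'"
  then obtain v v' where v: "h = res U v" "h' = res U v'" using F1_iff by blast
  obtain e f P Q where ad: "adapted_spinor B c Sp Sm \<beta> \<eta> e f s P Q" "cspan (range e) = U"
    using pure_at_parity by metis
  interpret adapted_spinor B c Sp Sm \<beta> \<eta> e f s P Q by (rule ad)
  have "\<kappa> U (c v s) = \<kappa> U (c v' s)"
    using eq tens_eq_right_unique[OF _ spinor_dual_nonzero[OF s(2)]] unfolding v \<phi>1_eq[OF U s] by blast
  then have "c (v - v') s = 0" using \<kappa>_\<kappa> by (metis c_simps(3) right_minus_eq)
  then have "v - v' \<in> U" using c_s_eq_0_iff ad(2) by simp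
  then have "res U (v - v') = 0" by (rule res_isotropic)
  then show "h = h'" unfolding v by (simp add: clinear_diff[OF clinear_res])
qed

text \<open>One inclusion is \<open>quadratic_vanish\<close>, the other
  \<open>quadratic_kernel\<close>; the hypothesis of the latter is first known on the basis
  \<open>g\<close> and then extended by linearity.\<close>

lemma exact2: "\<phi>1 U ` dual_space U = {t \<in> F2 U. \<phi>2 U t = 0}"
proof -
  obtain e f P Q where ad: "adapted_spinor B c Sp Sm \<beta> \<eta> e f s P Q" "\<And>t. t \<in> V4 \<Longrightarrow> \<kappa> U t \<in> Q"
    using pure_at_parity by metis
  interpret adapted_spinor B c Sp Sm \<beta> \<eta> e f s P Q by (rule ad)
  show ?thesis
  proof (intro equalityI subsetI)
    fix t assume "t \<in> \<phi>1 U ` dual_space U"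
    then obtain h where h: "h \<in> dual_space U" "t = \<phi>1 U h" by (rule imageE)
    obtain v where "h = res U v" using h(1) unfolding F1_iff by blast
    with h have v: "res U v \<in> dual_space U" "t = \<phi>1 U (res U v)" by simp_all
    have "quad s (c v s) a = 0" for a
      unfolding quad_def inv quadratic_vanish by simp
    then have "quad s (c v s) = 0" by (intro ext) (simp only: zero_fun_apply)
    then have "\<phi>2 U t = 0"
      unfolding v(2) \<phi>1_eq[OF U s] using \<phi>2_eq[OF U s \<kappa>_c[of v]] by (simp add: \<kappa>_\<kappa> clinear_0[OF clinear_embed])
    then show "t \<in> {t \<in> F2 U. \<phi>2 U t = 0}" using \<phi>1_into v by simp
  next
    fix t assume "t \<in> {t \<in> F2 U. \<phi>2 U t = 0}"
    then obtain \<sigma> where \<sigma>: "\<sigma> \<in> V4" "t = tens \<sigma> (spinor_dual s)" "\<phi>2 U t = 0" using F2_iff by blast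
    have "embed (quad s (\<kappa> U \<sigma>)) (qline s) = embed 0 (qline s)"
      using \<sigma>(3) unfolding \<sigma>(2) \<phi>2_eq[OF U s \<sigma>(1)] by (simp add: clinear_0[OF clinear_embed])
    then have "quad s (\<kappa> U \<sigma>) = 0" by (rule embed_unique[OF _ qline_nonzero[OF s(2)]])
    then have gv: "\<beta> (c w s) (c (g a) (\<kappa> U \<sigma>)) = 0" for a w
      using B_quad[of s "\<kappa> U \<sigma>" a w] by (simp add: B_simps)
    have "\<beta> (c w s) (c v (\<kappa> U \<sigma>)) = 0" for v w
    proof -
      have "\<beta> (c w s) (c (\<Sum>a\<in>UNIV. B (g a) v *\<^sub>C g a) (\<kappa> U \<sigma>)) = 0"
        by (simp add: c_simps \<beta>_simps gv)
      then show ?thesis unfolding g_expand .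
    qed
    then have "\<beta> s (c w (c v (\<kappa> U \<sigma>))) = 0" for v w using inv eta by simp
    then obtain v where "\<kappa> U \<sigma> = c v s" using quadratic_kernel[OF ad(2)[OF \<sigma>(1)]] by blast
    then have "\<sigma> = \<kappa> U (c v s)" using \<kappa>_\<kappa> by metis
    then have "t = \<phi>1 U (res U v)" using \<phi>1_eq[OF U s] \<sigma>(2) by simp
    then show "t \<in> \<phi>1 U ` dual_space U" using res_in_dual[OF U_subspace] by blast
  qed
qed

text \<open>An image has scalar symmetric part by the Clifford relation. Conversely a tuple in
  \<open>U\<close> with scalar symmetric part defines a form \<open>T\<close> to which
  \<open>quadratic_surjective\<close> applies.\<close>

lemma exact3: "\<phi>2 U ` F2 U = {t \<in> F3 U. \<phi>3 U t = 0}"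
proof -
  obtain e f P Q where ad: "adapted_spinor B c Sp Sm \<beta> \<eta> e f s P Q" "cspan (range e) = U"
      "\<And>t. t \<in> Q \<Longrightarrow> \<kappa> U t \<in> V4"
    using pure_at_parity by metis
  interpret adapted_spinor B c Sp Sm \<beta> \<eta> e f s P Q by (rule ad)
  show ?thesis
  proof (intro equalityI subsetI)
    fix t assume t: "t \<in> \<phi>2 U ` F2 U"
    then obtain t' where t': "t' \<in> F2 U" "t = \<phi>2 U t'" by (rule imageE)
    obtain \<sigma> where \<sigma>1: "\<sigma> \<in> V4" "t' = tens \<sigma> (spinor_dual s)" using t'(1) unfolding F2_iff by blast
    have \<sigma>: "\<sigma> \<in> V4" "t = embed (quad s (\<kappa> U \<sigma>)) (qline s)"
      unfolding t'(2) \<sigma>1(2) using \<sigma>1(1) by (simp_all only: \<phi>2_eq[OF U s])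
    let ?\<sigma> = "\<kappa> U \<sigma>"
    \<comment> \<open>The anticommutator of \<open>g a\<close> and \<open>g b\<close> is the scalar
      \<open>2 * B (g a) (g b)\<close>, so the symmetric part vanishes off the diagonal and is
      constant on it.\<close>
    have sym: "(B (g b) (quad s ?\<sigma> a) + B (g a) (quad s ?\<sigma> b)) / 2 = (if a = b then \<eta> * \<beta> s ?\<sigma> else 0)" for a b
    proof -
      have "B (g b) (quad s ?\<sigma> a) + B (g a) (quad s ?\<sigma> b) = \<eta> * \<beta> s (c (g b) (c (g a) ?\<sigma>) + c (g a) (c (g b) ?\<sigma>))"
        by (simp add: B_commute[of "g _"] B_quad inv \<beta>_simps algebra_simps)
      also have "c (g b) (c (g a) ?\<sigma>) + c (g a) (c (g b) ?\<sigma>) = (2 * B (g a) (g b)) *\<^sub>C ?\<sigma>"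
        using c_anticommute[of "g a" "g b" ?\<sigma>] by simp
      finally show ?thesis by (simp add: \<beta>_simps B_g)
    qed
    have "B (g d) (quad s ?\<sigma> d) = \<eta> * \<beta> s ?\<sigma>" for d
      using sym[of d d] by simp
    then have "(\<Sum>d\<in>UNIV. B (g d) (quad s ?\<sigma> d)) / 10 = \<eta> * \<beta> s ?\<sigma>" by simp
    then have "proj (quad s ?\<sigma>) = 0" unfolding proj_eq_0_iff using sym by simp
    then have "\<phi>3 U t = 0" using \<phi>3_eq[OF U s quad_in_U] \<sigma>(2) by (simp add: tens_simps)
    moreover have "t \<in> F3 U" using t \<phi>2_into by blast
    ultimately show "t \<in> {t \<in> F3 U. \<phi>3 U t = 0}" by simp
  next
    fix t assume "t \<in> {t \<in> F3 U. \<phi>3 U t = 0}"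
    then obtain w where w: "\<And>a. w a \<in> U" "t = embed w (qline s)" "\<phi>3 U t = 0" using F3_iff by blast
    have "tens (proj w) (qline s) = tens 0 (qline s)" using w(3) \<phi>3_eq[OF U s w(1)] w(2) by (simp add: tens_simps)
    then have "proj w = 0" using tens_eq_right_unique qline_nonzero[OF s(2)] by blast
    have double: "x = 2 * (x / 2)" for x :: complex by simp
    define \<mu> where "\<mu> = (\<Sum>d\<in>UNIV. B (g d) (w d)) / 10"
    have "(B (g b) (w a) + B (g a) (w b)) / 2 = (if a = b then \<mu> else 0)" for a b
      by (rule iffD1[OF proj_eq_0_iff \<open>proj w = 0\<close>, folded \<mu>_def, THEN spec, THEN spec])
    then have \<mu>: "B (g b) (w a) + B (g a) (w b) = 2 * (if a = b then \<mu> else 0)" for a b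
      using double[of "B (g b) (w a) + B (g a) (w b)"] by (simp only:)
    \<comment> \<open>The bilinear form whose matrix in the basis \<open>g\<close> is
      \<open>w\<close>; membership of the \<open>w a\<close> in \<open>U\<close> makes it vanish
      when the second argument is some \<open>e i\<close>.\<close>
    define T where "T v v' = B v' (\<Sum>a\<in>UNIV. B (g a) v *\<^sub>C w a)" for v v'
    have T1: "cbilinear T" by (auto simp: cbilinear_iff T_def B_simps algebra_simps sum.distrib sum_distrib_left)
    have T2: "T v (e i) = 0" for v i
    proof -
      have "e i \<in> U" unfolding ad(2)[symmetric] by (simp add: complex_vector.span_base)
      then have "B (e i) (w a) = 0" for a using U w(1) by (auto simp: OG5_def)
      then show ?thesis by (simp add: T_def B_simps)
    qed
    have Tg: "T v v' = (\<Sum>a\<in>UNIV. \<Sum>b\<in>UNIV. B (g a) v * (B (g b) v' * B (g b) (w a)))" for v v'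
      unfolding T_def B_simps by (simp only: B_expand sum_distrib_left[symmetric])
    have T3: "T v v' + T v' v = 2 * \<mu> * B v v'" for v v'
    proof -
      have "T v' v = (\<Sum>a\<in>UNIV. \<Sum>b\<in>UNIV. B (g a) v * (B (g b) v' * B (g a) (w b)))"
        unfolding Tg by (subst sum.swap) (simp only: mult.left_commute)
      then have "T v v' + T v' v = (\<Sum>a\<in>UNIV. \<Sum>b\<in>UNIV. B (g a) v * (B (g b) v' * (B (g b) (w a) + B (g a) (w b))))"
        unfolding Tg by (simp only: sum.distrib[symmetric] distrib_left)
      also have "\<dots> = (\<Sum>a\<in>UNIV. \<Sum>b\<in>UNIV. if a = b then 2 * \<mu> * (B (g a) v * B (g b) v') else 0)"
        unfolding \<mu> by (intro sum.cong refl) auto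
      also have "\<dots> = 2 * \<mu> * B v v'" by (simp add: sum_distrib_left[symmetric] B_expand)
      finally show ?thesis .
    qed
    obtain \<sigma> where \<sigma>: "\<sigma> \<in> Q" "\<And>v v'. \<beta> (c v' s) (c v \<sigma>) = T v v'"
      using quadratic_surjective[OF T1 T2 T3] by blast
    have "quad s \<sigma> = w"
    proof
      fix a
      show "quad s \<sigma> a = w a"
      proof (rule B_eqI)
        fix u
        have "(\<Sum>b\<in>UNIV. B (g b) (g a) *\<^sub>C w b) = (\<Sum>b\<in>UNIV. if b = a then w b else 0)"
          by (rule sum.cong) (auto simp: B_g)
        then show "B u (quad s \<sigma> a) = B u (w a)"
          using B_quad[of s \<sigma> a u] by (simp add: B_commute[of u "quad s \<sigma> a"] \<sigma>(2) T_def)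
      qed
    qed
    then have "t = \<phi>2 U (tens (\<kappa> U \<sigma>) (spinor_dual s))"
      using \<phi>2_eq[OF U s ad(3)[OF \<sigma>(1)]] w(2) by (simp add: \<kappa>_\<kappa>)
    then show "t \<in> \<phi>2 U ` F2 U" using F2_iff ad(3)[OF \<sigma>(1)] by blast
  qed
qed

text \<open>Each summand of \<open>casimir_hyperbolic\<close> contains some \<open>e i\<close>,
  which restricts to zero.\<close>

lemma res_casimir: "tensor_map (res U) (res U) casimir = 0"
proof -
  obtain e f where ef: "hyperbolic e f" "cspan (range e) = U" using OG5_hyperbolic[OF U] by blast
  have "e i \<in> U" for i unfolding ef(2)[symmetric] by (simp add: complex_vector.span_base)
  then have "res U (e i) = 0" for i by (rule res_isotropic)
  then show ?thesis
    by (simp only: casimir_hyperbolic[OF ef(1)] clinear_sum[OF clinear_tensor_map] clinear_scale[OF clinear_tensor_map]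
        clinear_add[OF clinear_tensor_map] tensor_map_tens[OF clinear_res clinear_res] tens_simps(9,10)
        add_0 complex_vector.scale_zero_right sum.neutral_const)
qed

text \<open>For the harder inclusion \<open>V\<close> is split into \<open>U\<close> and the span of
  \<open>f\<close>, with projection \<open>p\<close> to \<open>U\<close>. Vanishing restriction
  means that \<open>\<tau>\<close> has no component in the square of the second summand, so
  \<open>\<tau>\<close> is its image under \<open>1 \<otimes> p\<close> plus that under
  \<open>p \<otimes> 1\<close> minus that under \<open>p \<otimes> p\<close>.\<close>

lemma exact4: "\<phi>3 U ` F3 U = {t \<in> F4 U. \<phi>4 U t = 0}"
proof (intro equalityI subsetI)
  fix t assume t: "t \<in> \<phi>3 U ` F3 U"
  then obtain t' where t': "t' \<in> F3 U" "t = \<phi>3 U t'" by (rule imageE)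
  obtain w where w_U: "\<And>a. w a \<in> U" and w': "t' = embed w (qline s)" using t'(1) unfolding F3_iff by blast
  have w: "\<And>a. w a \<in> U" "t = tens (proj w) (qline s)" unfolding t'(2) w' using w_U by (simp_all only: \<phi>3_eq[OF U s])
  have "tensor_map (res U) (res U) (proj w) = 0"
    unfolding proj_def
    by (simp only: clinear_diff[OF clinear_tensor_map] clinear_sum[OF clinear_tensor_map]
        clinear_scale[OF clinear_tensor_map] clinear_add[OF clinear_tensor_map]
        tensor_map_tens[OF clinear_res clinear_res] res_isotropic[OF w(1)] tens_simps(9,10) res_casimir
        add_0 complex_vector.scale_zero_right sum.neutral_const diff_zero)
  then have "\<phi>4 U t = 0" using \<phi>4_eq[OF U s proj_in] w(2) by (simp add: tens_simps(9))
  moreover have "t \<in> F4 U" using t \<phi>3_into by blast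
  ultimately show "t \<in> {t \<in> F4 U. \<phi>4 U t = 0}" by simp
next
  fix t assume "t \<in> {t \<in> F4 U. \<phi>4 U t = 0}"
  then obtain \<tau> where \<tau>: "\<tau> \<in> V_2omega1 B" "t = tens \<tau> (qline s)" "\<phi>4 U t = 0" using F4_iff by blast
  have "tens (tensor_map (res U) (res U) \<tau>) (qline s) = tens 0 (qline s)"
    using \<tau>(3) \<phi>4_eq[OF U s \<tau>(1)] \<tau>(2) by (simp add: tens_simps(9))
  then have res0: "tensor_map (res U) (res U) \<tau> = 0" using tens_eq_right_unique qline_nonzero[OF s(2)] by blast
  obtain e f where ef: "hyperbolic e f" "cspan (range e) = U" using OG5_hyperbolic[OF U] by blast
  have eU: "e i \<in> U" for i unfolding ef(2)[symmetric] by (simp add: complex_vector.span_base)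
  define p where "p v = (\<Sum>i\<in>UNIV. (2 * B (f i) v) *\<^sub>C e i)" for v
  \<comment> \<open>Lifts a form on \<open>U\<close> to the span of \<open>f\<close>, so
    \<open>m (res U v)\<close> is the complementary projection of \<open>v\<close>.\<close>
  define m where "m \<xi> = (\<Sum>i\<in>UNIV. (2 * \<xi> (e i)) *\<^sub>C f i)" for \<xi> :: "'v \<Rightarrow> complex"
  have p_U: "p v \<in> U" for v
    unfolding p_def by (intro complex_vector.subspace_sum complex_vector.subspace_scale U_subspace eU)
  have m_res: "m (res U v) = (\<Sum>i\<in>UNIV. (2 * B (e i) v) *\<^sub>C f i)" for v
    unfolding m_def using eU by (simp add: res_def B_commute[of v])
  have split: "m (res U v) = v - p v" for v
    using arg_cong[OF hyperbolic_expand[OF ef(1), of v], of "\<lambda>x. x - p v"]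
    unfolding m_res p_def add_diff_cancel_left' by (rule sym)
  have m_lin: "clinear m"
    unfolding m_def by (intro clinear_sum_fun clinear_scaleC_const clinear_mult_left clinear_apply)
  have "\<tau> \<in> tensor_space UNIV UNIV" using \<tau>(1) sym2_space_le_tensor_space by (auto simp: V_2omega1_def)
  from dual_family_expand[OF cbasis_tens[OF cbasis_g cbasis_g] this]
  obtain x' where "\<tau> = (\<Sum>q\<in>UNIV \<times> UNIV. x' q *\<^sub>C (case q of (a, b) \<Rightarrow> tens (g a) (g b)))"
    by (rule that)
  then obtain x where x: "\<tau> = (\<Sum>a\<in>UNIV. \<Sum>b\<in>UNIV. x a b *\<^sub>C tens (g a) (g b))"
    by (intro that[of "\<lambda>a b. x' (a, b)"]) (simp add: sum.cartesian_product case_prod_beta)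
  have x_sym: "x a b = x b a" for a b
    using sym2_coefficients[OF cbasis_g, of x UNIV a b] \<tau>(1) unfolding x by (simp add: V_2omega1_def)
  let ?X = "\<lambda>h k. \<Sum>a\<in>UNIV. \<Sum>b\<in>UNIV. x a b *\<^sub>C tens (h a :: 'v) (k b :: 'v)"
  have X_flip: "(\<Sum>a\<in>UNIV. \<Sum>b\<in>UNIV. x a b *\<^sub>C tens (k b) (h a)) = ?X k h" for h k :: "bool \<times> 5 \<Rightarrow> 'v"
    by (subst sum.swap) (simp add: x_sym)
  \<comment> \<open>The tuple encoding the image of \<open>\<tau>\<close> under
    \<open>2 (1 \<otimes> p) - p \<otimes> p\<close>, an element of \<open>V \<otimes> U\<close>
    whose symmetrisation is \<open>\<tau>\<close>.\<close>
  define w where "w a = (\<Sum>b\<in>UNIV. (2 * x a b) *\<^sub>C p (g b)) -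
      (\<Sum>d\<in>UNIV. \<Sum>b\<in>UNIV. (x d b * B (g a) (p (g d))) *\<^sub>C p (g b))" for a
  have w_U: "w a \<in> U" for a
    unfolding w_def
    by (intro complex_vector.subspace_diff complex_vector.subspace_sum complex_vector.subspace_scale U_subspace p_U)
  have left: "(\<Sum>a\<in>UNIV. tens (g a) (w a)) = 2 *\<^sub>C ?X g (\<lambda>b. p (g b)) - ?X (\<lambda>a. p (g a)) (\<lambda>b. p (g b))"
  proof -
    have "(\<Sum>a\<in>UNIV. tens (g a) (w a)) = (\<Sum>a\<in>UNIV. \<Sum>b\<in>UNIV. (2 * x a b) *\<^sub>C tens (g a) (p (g b))) -
        (\<Sum>a\<in>UNIV. \<Sum>d\<in>UNIV. \<Sum>b\<in>UNIV. (x d b * B (g a) (p (g d))) *\<^sub>C tens (g a) (p (g b)))"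
      unfolding w_def by (simp only: tens_simps sum_subtractf)
    also have "(\<Sum>a\<in>UNIV. \<Sum>d\<in>UNIV. \<Sum>b\<in>UNIV. (x d b * B (g a) (p (g d))) *\<^sub>C tens (g a) (p (g b))) =
        (\<Sum>d\<in>UNIV. \<Sum>b\<in>UNIV. \<Sum>a\<in>UNIV. (x d b * B (g a) (p (g d))) *\<^sub>C tens (g a) (p (g b)))"
      by (subst sum.swap) (intro sum.cong refl sum.swap)
    also have "\<dots> = (\<Sum>d\<in>UNIV. \<Sum>b\<in>UNIV. x d b *\<^sub>C tens (\<Sum>a\<in>UNIV. B (g a) (p (g d)) *\<^sub>C g a) (p (g b)))"
      by (simp only: tens_simps complex_vector.scale_sum_right scaleC_scaleC)
    also have "(\<Sum>a\<in>UNIV. \<Sum>b\<in>UNIV. (2 * x a b) *\<^sub>C tens (g a) (p (g b))) = 2 *\<^sub>C ?X g (\<lambda>b. p (g b))"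
      by (simp only: complex_vector.scale_sum_right scaleC_scaleC)
    finally show ?thesis unfolding g_expand .
  qed
  have right: "(\<Sum>a\<in>UNIV. tens (w a) (g a)) = 2 *\<^sub>C ?X (\<lambda>b. p (g b)) g - ?X (\<lambda>a. p (g a)) (\<lambda>b. p (g b))"
  proof -
    have "(\<Sum>a\<in>UNIV. tens (w a) (g a)) = (\<Sum>a\<in>UNIV. \<Sum>b\<in>UNIV. (2 * x a b) *\<^sub>C tens (p (g b)) (g a)) -
        (\<Sum>a\<in>UNIV. \<Sum>d\<in>UNIV. \<Sum>b\<in>UNIV. (x d b * B (g a) (p (g d))) *\<^sub>C tens (p (g b)) (g a))"
      unfolding w_def by (simp only: tens_simps sum_subtractf)
    also have "(\<Sum>a\<in>UNIV. \<Sum>d\<in>UNIV. \<Sum>b\<in>UNIV. (x d b * B (g a) (p (g d))) *\<^sub>C tens (p (g b)) (g a)) =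
        (\<Sum>d\<in>UNIV. \<Sum>b\<in>UNIV. \<Sum>a\<in>UNIV. (x d b * B (g a) (p (g d))) *\<^sub>C tens (p (g b)) (g a))"
      by (subst sum.swap) (intro sum.cong refl sum.swap)
    also have "\<dots> = (\<Sum>d\<in>UNIV. \<Sum>b\<in>UNIV. x d b *\<^sub>C tens (p (g b)) (\<Sum>a\<in>UNIV. B (g a) (p (g d)) *\<^sub>C g a))"
      by (simp only: tens_simps complex_vector.scale_sum_right scaleC_scaleC)
    also have "(\<Sum>a\<in>UNIV. \<Sum>b\<in>UNIV. (2 * x a b) *\<^sub>C tens (p (g b)) (g a)) =
        2 *\<^sub>C (\<Sum>a\<in>UNIV. \<Sum>b\<in>UNIV. x a b *\<^sub>C tens (p (g b)) (g a))"
      by (simp only: complex_vector.scale_sum_right scaleC_scaleC)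
    finally show ?thesis unfolding g_expand X_flip .
  qed
  have half: "(1 / 2) *\<^sub>C (2 *\<^sub>C y - z + (2 *\<^sub>C y' - z)) = y + y' - z" for y y' z :: "('v, 'v) tensor"
  proof -
    have "(1 / 2) *\<^sub>C (2 *\<^sub>C y - z + (2 *\<^sub>C y' - z)) = y + y' - ((1 / 2) *\<^sub>C z + (1 / 2) *\<^sub>C z)"
      by (simp only: scaleC_algebra(1,3)) (simp add: algebra_simps)
    also have "(1 / 2) *\<^sub>C z + (1 / 2) *\<^sub>C z = z" by (simp add: scaleC_add_left[symmetric])
    finally show ?thesis .
  qed
  have sym: "(\<Sum>a\<in>UNIV. (1 / 2) *\<^sub>C (tens (g a) (w a) + tens (w a) (g a))) = \<tau>"
  proof -
    have "tensor_map m m (tensor_map (res U) (res U) \<tau>) = 0"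
      unfolding res0 by (rule clinear_0[OF clinear_tensor_map])
    then have "?X (\<lambda>a. m (res U (g a))) (\<lambda>b. m (res U (g b))) = 0"
      unfolding x by (simp only: clinear_sum[OF clinear_tensor_map] clinear_scale[OF clinear_tensor_map]
          tensor_map_tens[OF clinear_res clinear_res] tensor_map_tens[OF m_lin m_lin])
    then have split_X: "?X g g - ?X (\<lambda>a. p (g a)) g - (?X g (\<lambda>b. p (g b)) - ?X (\<lambda>a. p (g a)) (\<lambda>b. p (g b))) = 0"
      unfolding split by (simp only: tens_simps(3,4) complex_vector.scale_right_diff_distrib sum_subtractf)
    have alg: "y3 + y2 - y4 = y1" if "y1 - y2 - (y3 - y4) = 0" for y1 y2 y3 y4 :: "('v, 'v) tensor"
      using that by (simp add: algebra_simps)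
    have "(\<Sum>a\<in>UNIV. (1 / 2) *\<^sub>C (tens (g a) (w a) + tens (w a) (g a))) =
        ?X g (\<lambda>b. p (g b)) + ?X (\<lambda>b. p (g b)) g - ?X (\<lambda>a. p (g a)) (\<lambda>b. p (g b))"
      unfolding complex_vector.scale_sum_right[symmetric] sum.distrib left right half ..
    also have "\<dots> = \<tau>" unfolding x by (rule alg[OF split_X])
    finally show ?thesis .
  qed
  \<comment> \<open>The trace correction in \<open>proj w\<close> must vanish: \<open>\<tau>\<close>
    and \<open>proj w\<close> are trace-free while \<open>casimir\<close> is not.\<close>
  define k where "k = (\<Sum>a\<in>UNIV. B (g a) (w a)) / 10"
  have proj: "proj w = \<tau> - k *\<^sub>C casimir" unfolding proj_def sym k_def ..
  have "proj w B = 0" "\<tau> B = 0" using proj_in[of w] \<tau>(1) by (auto simp: V_2omega1_def)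
  then have "k = 0" unfolding proj by (simp add: casimir_B)
  then have "proj w = \<tau>" using proj by simp
  then have "t = \<phi>3 U (embed w (qline s))" using \<phi>3_eq[OF U s w_U] \<tau>(2) by simp
  then show "t \<in> \<phi>3 U ` F3 U" using F3_iff w_U by blast
qed

lemma surjective4: "\<phi>4 U ` F4 U = F5 U"
proof (intro equalityI subsetI)
  show "t \<in> F5 U" if "t \<in> \<phi>4 U ` F4 U" for t using that \<phi>4_into by blast
  fix t assume "t \<in> F5 U"
  then obtain \<tau> where \<tau>: "\<tau> \<in> sym2_space (dual_space U)" "t = tens \<tau> (qline s)" using F5_iff by blast
  have "\<exists>\<tau>'\<in>V_2omega1 B. tensor_map (res U) (res U) \<tau>' = \<tau>"
    using \<tau>(1)
  proof (induction rule: sym2_space_induct)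
    case zero
    show ?case
      using complex_vector.subspace_0[OF V_2omega1_subspace] clinear_0[OF clinear_tensor_map] by blast
  next
    case (add t t')
    then show ?case
      using complex_vector.subspace_add[OF V_2omega1_subspace] clinear_add[OF clinear_tensor_map] by metis
  next
    case (scale a t)
    then show ?case
      using complex_vector.subspace_scale[OF V_2omega1_subspace] clinear_scale[OF clinear_tensor_map] by metis
  next
    case (square h)
    then obtain v where v: "h = res U v" using F1_iff by blast
    \<comment> \<open>A square lifts to a square; its trace is removed by a multiple of
      \<open>casimir\<close>, which restricts to zero.\<close>
    let ?t = "tens v v - (B v v / 10) *\<^sub>C casimir"
    have "?t \<in> sym2_space UNIV"
      by (intro complex_vector.subspace_diff complex_vector.subspace_scale sym2_space_subspace
          sym2_space_square casimir_sym2) simp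
    moreover have "?t B = 0" by (simp add: tens_apply bilinear_B casimir_B)
    ultimately have "?t \<in> V_2omega1 B" by (simp add: V_2omega1_def)
    moreover have "tensor_map (res U) (res U) ?t = tens h h"
      by (simp add: clinear_diff[OF clinear_tensor_map] clinear_scale[OF clinear_tensor_map] res_casimir
          tensor_map_tens clinear_res v)
    ultimately show ?case by blast
  qed
  then obtain \<tau>' where "\<tau>' \<in> V_2omega1 B" "t = \<phi>4 U (tens \<tau>' (qline s))"
    using \<phi>4_eq[OF U s] \<tau>(2) by auto
  then show "t \<in> \<phi>4 U ` F4 U" using F4_iff by blast
qed

end

end

section \<open>The spinor variety\<close>

lemma topspace_grassmannian5: "topspace grassmannian5_top = grassmannian5"
proof
  show "topspace grassmannian5_top \<subseteq> grassmannian5"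
    unfolding grassmannian5_top_def topology_generated_by_topspace by blast
  \<comment> \<open>The constant polynomial 1, of degree 0, defines the whole Grassmannian as a
    principal open set.\<close>
  have "grassmannian5 = {U \<in> grassmannian5. \<forall>u\<in>frames5 U. (\<lambda>_. 1::complex) (pluecker u) \<noteq> 0}" by simp
  then show "grassmannian5 \<subseteq> topspace grassmannian5_top"
    unfolding grassmannian5_top_def topology_generated_by_topspace using homogeneous_const[of 1] by blast
qed

lemma openin_principal:
  assumes "homogeneous d P"
  shows "openin (subtopology grassmannian5_top X) {U \<in> X \<inter> grassmannian5. \<forall>u\<in>frames5 U. P (pluecker u) \<noteq> 0}"
proof -
  have "openin grassmannian5_top {U \<in> grassmannian5. \<forall>u\<in>frames5 U. P (pluecker u) \<noteq> 0}"
    unfolding grassmannian5_top_def by (rule topology_generated_by_Basis) (use assms in blast)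
  then have "openin (subtopology grassmannian5_top X) (X \<inter> {U \<in> grassmannian5. \<forall>u\<in>frames5 U. P (pluecker u) \<noteq> 0})"
    by (rule openin_subtopology_Int2)
  moreover have "X \<inter> {U \<in> grassmannian5. \<forall>u\<in>frames5 U. P (pluecker u) \<noteq> 0} =
      {U \<in> X \<inter> grassmannian5. \<forall>u\<in>frames5 U. P (pluecker u) \<noteq> 0}" by blast
  ultimately show ?thesis by simp
qed

lemma regular_subvariety5_iff:
  "h \<in> regular (subvariety5 X) W \<longleftrightarrow> (\<forall>x\<in>W. \<exists>N d P Q.
       openin (zariski (subvariety5 X)) N \<and> x \<in> N \<and> N \<subseteq> W \<and> homogeneous d P \<and> homogeneous d Q \<and>
       (\<forall>y\<in>N. \<forall>u\<in>frames5 y. Q (pluecker u) \<noteq> 0 \<and> h y = P (pluecker u) / Q (pluecker u)))"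
  by (simp add: subvariety5_def)

lemma regular_subvariety5E:
  assumes "h \<in> regular (subvariety5 X) W" "x \<in> W"
  obtains N d P Q where "openin (zariski (subvariety5 X)) N" "x \<in> N" "N \<subseteq> W" "homogeneous d P" "homogeneous d Q"
    "\<forall>y\<in>N. \<forall>u\<in>frames5 y. Q (pluecker u) \<noteq> 0 \<and> h y = P (pluecker u) / Q (pluecker u)"
  using bspec[OF assms(1)[unfolded regular_subvariety5_iff] assms(2)]
  by (elim exE conjE) (rule that)

lemma regular_subvariety5I:
  assumes "\<And>x. x \<in> W \<Longrightarrow> \<exists>N d P Q.
       openin (zariski (subvariety5 X)) N \<and> x \<in> N \<and> N \<subseteq> W \<and> homogeneous d P \<and> homogeneous d Q \<and>
       (\<forall>y\<in>N. \<forall>u\<in>frames5 y. Q (pluecker u) \<noteq> 0 \<and> h y = P (pluecker u) / Q (pluecker u))"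
  shows "h \<in> regular (subvariety5 X) W"
  unfolding regular_subvariety5_iff by (rule ballI) (rule assms)

lemma regular_subvariety5_quotient:
  assumes "openin (zariski (subvariety5 X)) W" "homogeneous d P" "homogeneous d Q"
    and "\<And>y u. y \<in> W \<Longrightarrow> u \<in> frames5 y \<Longrightarrow> Q (pluecker u) \<noteq> 0"
    and "\<And>y u. y \<in> W \<Longrightarrow> u \<in> frames5 y \<Longrightarrow> h y = P (pluecker u) / Q (pluecker u)"
  shows "h \<in> regular (subvariety5 X) W"
proof (rule regular_subvariety5I)
  fix x assume x: "x \<in> W"
  show "\<exists>N d P Q. openin (zariski (subvariety5 X)) N \<and> x \<in> N \<and> N \<subseteq> W \<and> homogeneous d P \<and> homogeneous d Q \<and>
       (\<forall>y\<in>N. \<forall>u\<in>frames5 y. Q (pluecker u) \<noteq> 0 \<and> h y = P (pluecker u) / Q (pluecker u))"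
    by (rule exI[of _ W], rule exI[of _ d], rule exI[of _ P], rule exI[of _ Q])
      (intro conjI ballI; use assms x in blast)
qed

lemma ringed_subvariety5: "ringed_variety (subvariety5 X)"
proof
  let ?M = "subvariety5 X"
  show "(\<lambda>_. a) \<in> regular ?M W" if "openin (zariski ?M) W" for W a
    by (rule regular_subvariety5_quotient[OF that homogeneous_const[of a] homogeneous_const[of 1]]) auto
  \<comment> \<open>Two functions are brought to one neighbourhood and one denominator; the degrees
    rise to \<open>d + d'\<close> so that the numerators can be added.\<close>
  have common: "\<exists>N d P P' Q. openin (zariski ?M) N \<and> x \<in> N \<and> N \<subseteq> W \<and>
       homogeneous d P \<and> homogeneous d P' \<and> homogeneous d Q \<and>
       (\<forall>y\<in>N. \<forall>u\<in>frames5 y. Q (pluecker u) \<noteq> 0 \<and>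
         h y = P (pluecker u) / Q (pluecker u) \<and> k y = P' (pluecker u) / Q (pluecker u))"
    if h: "h \<in> regular ?M W" and k: "k \<in> regular ?M W" and x: "x \<in> W" for W h k x
  proof -
    obtain N d P Q where N: "openin (zariski ?M) N" "x \<in> N" "N \<subseteq> W" "homogeneous d P" "homogeneous d Q"
      "\<forall>y\<in>N. \<forall>u\<in>frames5 y. Q (pluecker u) \<noteq> 0 \<and> h y = P (pluecker u) / Q (pluecker u)"
      by (rule regular_subvariety5E[OF h x])
    obtain N' d' P' Q' where N': "openin (zariski ?M) N'" "x \<in> N'" "N' \<subseteq> W" "homogeneous d' P'" "homogeneous d' Q'"
      "\<forall>y\<in>N'. \<forall>u\<in>frames5 y. Q' (pluecker u) \<noteq> 0 \<and> k y = P' (pluecker u) / Q' (pluecker u)"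
      by (rule regular_subvariety5E[OF k x])
    have hom: "homogeneous (d + d') (\<lambda>p. P p * Q' p)" "homogeneous (d + d') (\<lambda>p. P' p * Q p)"
      "homogeneous (d + d') (\<lambda>p. Q p * Q' p)"
      using homogeneous_mult[OF N(4) N'(5)] homogeneous_mult[OF N'(4) N(5)]
        homogeneous_mult[OF N(5) N'(5)] by (simp_all add: add.commute)
    have eq: "Q (pluecker u) * Q' (pluecker u) \<noteq> 0 \<and>
        h y = P (pluecker u) * Q' (pluecker u) / (Q (pluecker u) * Q' (pluecker u)) \<and>
        k y = P' (pluecker u) * Q (pluecker u) / (Q (pluecker u) * Q' (pluecker u))"
      if "y \<in> N \<inter> N'" "u \<in> frames5 y" for y u
    proof -
      have "Q (pluecker u) \<noteq> 0 \<and> h y = P (pluecker u) / Q (pluecker u)"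
        "Q' (pluecker u) \<noteq> 0 \<and> k y = P' (pluecker u) / Q' (pluecker u)" using that N(6) N'(6) by blast+
      then show ?thesis by simp
    qed
    show ?thesis
      by (rule exI[of _ "N \<inter> N'"], rule exI[of _ "d + d'"], rule exI[of _ "\<lambda>p. P p * Q' p"],
          rule exI[of _ "\<lambda>p. P' p * Q p"], rule exI[of _ "\<lambda>p. Q p * Q' p"]) (use N N' hom eq in blast)
  qed
  show "(\<lambda>x. h x + k x) \<in> regular ?M W" if h: "h \<in> regular ?M W" and k: "k \<in> regular ?M W" for W h k
  proof (rule regular_subvariety5I)
    fix x assume "x \<in> W"
    from common[OF h k this] obtain N d P P' Q where N: "openin (zariski ?M) N" "x \<in> N" "N \<subseteq> W"
      "homogeneous d P" "homogeneous d P'" "homogeneous d Q"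
      "\<forall>y\<in>N. \<forall>u\<in>frames5 y. Q (pluecker u) \<noteq> 0 \<and>
         h y = P (pluecker u) / Q (pluecker u) \<and> k y = P' (pluecker u) / Q (pluecker u)"
      by (elim exE conjE) (rule that)
    show "\<exists>N d P Q. openin (zariski ?M) N \<and> x \<in> N \<and> N \<subseteq> W \<and> homogeneous d P \<and> homogeneous d Q \<and>
       (\<forall>y\<in>N. \<forall>u\<in>frames5 y. Q (pluecker u) \<noteq> 0 \<and> h y + k y = P (pluecker u) / Q (pluecker u))"
      by (rule exI[of _ N], rule exI[of _ d], rule exI[of _ "\<lambda>p. P p + P' p"], rule exI[of _ Q])
        (use N homogeneous_add[OF N(4,5)] in \<open>simp add: add_divide_distrib\<close>)
  qed
  show "(\<lambda>x. h x * k x) \<in> regular ?M W" if h: "h \<in> regular ?M W" and k: "k \<in> regular ?M W" for W h k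
  proof (rule regular_subvariety5I)
    fix x assume "x \<in> W"
    from common[OF h k this] obtain N d P P' Q where N: "openin (zariski ?M) N" "x \<in> N" "N \<subseteq> W"
      "homogeneous d P" "homogeneous d P'" "homogeneous d Q"
      "\<forall>y\<in>N. \<forall>u\<in>frames5 y. Q (pluecker u) \<noteq> 0 \<and>
         h y = P (pluecker u) / Q (pluecker u) \<and> k y = P' (pluecker u) / Q (pluecker u)"
      by (elim exE conjE) (rule that)
    show "\<exists>N d P Q. openin (zariski ?M) N \<and> x \<in> N \<and> N \<subseteq> W \<and> homogeneous d P \<and> homogeneous d Q \<and>
       (\<forall>y\<in>N. \<forall>u\<in>frames5 y. Q (pluecker u) \<noteq> 0 \<and> h y * k y = P (pluecker u) / Q (pluecker u))"
      by (rule exI[of _ N], rule exI[of _ "d + d"], rule exI[of _ "\<lambda>p. P p * P' p"], rule exI[of _ "\<lambda>p. Q p * Q p"])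
        (use N homogeneous_mult[OF N(4,5)] homogeneous_mult[OF N(6,6)] in simp)
  qed
  show "h \<in> regular ?M W'" if W': "openin (zariski ?M) W'" "W' \<subseteq> W" and h: "h \<in> regular ?M W" for W W' h
  proof (rule regular_subvariety5I)
    fix x assume x: "x \<in> W'"
    then have "x \<in> W" using W' by blast
    obtain N d P Q where N: "openin (zariski ?M) N" "x \<in> N" "N \<subseteq> W" "homogeneous d P" "homogeneous d Q"
      "\<forall>y\<in>N. \<forall>u\<in>frames5 y. Q (pluecker u) \<noteq> 0 \<and> h y = P (pluecker u) / Q (pluecker u)"
      by (rule regular_subvariety5E[OF h \<open>x \<in> W\<close>])
    show "\<exists>N d P Q. openin (zariski ?M) N \<and> x \<in> N \<and> N \<subseteq> W' \<and> homogeneous d P \<and> homogeneous d Q \<and>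
       (\<forall>y\<in>N. \<forall>u\<in>frames5 y. Q (pluecker u) \<noteq> 0 \<and> h y = P (pluecker u) / Q (pluecker u))"
      by (rule exI[of _ "N \<inter> W'"], rule exI[of _ d], rule exI[of _ P], rule exI[of _ Q])
        (intro conjI ballI; use N W' x in blast)
  qed
  show "h \<in> regular ?M W"
    if loc: "\<And>x. x \<in> W \<Longrightarrow> \<exists>N. openin (zariski ?M) N \<and> x \<in> N \<and> N \<subseteq> W \<and> h \<in> regular ?M N" for W h
  proof (rule regular_subvariety5I)
    fix x assume x: "x \<in> W"
    obtain N' where N': "x \<in> N'" "N' \<subseteq> W" "h \<in> regular ?M N'" using loc[OF x] by blast
    obtain N d P Q where N: "openin (zariski ?M) N" "x \<in> N" "N \<subseteq> N'" "homogeneous d P" "homogeneous d Q"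
      "\<forall>y\<in>N. \<forall>u\<in>frames5 y. Q (pluecker u) \<noteq> 0 \<and> h y = P (pluecker u) / Q (pluecker u)"
      by (rule regular_subvariety5E[OF N'(3,1)])
    show "\<exists>N d P Q. openin (zariski ?M) N \<and> x \<in> N \<and> N \<subseteq> W \<and> homogeneous d P \<and> homogeneous d Q \<and>
       (\<forall>y\<in>N. \<forall>u\<in>frames5 y. Q (pluecker u) \<noteq> 0 \<and> h y = P (pluecker u) / Q (pluecker u))"
      by (rule exI[of _ N], rule exI[of _ d], rule exI[of _ P], rule exI[of _ Q])
        (intro conjI ballI; use N N' in blast)
  qed
  show "k \<in> regular ?M W" if h: "h \<in> regular ?M W" and eq: "\<And>x. x \<in> W \<Longrightarrow> h x = k x" for W h k
  proof (rule regular_subvariety5I)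
    fix x assume x: "x \<in> W"
    obtain N d P Q where N: "openin (zariski ?M) N" "x \<in> N" "N \<subseteq> W" "homogeneous d P" "homogeneous d Q"
      "\<forall>y\<in>N. \<forall>u\<in>frames5 y. Q (pluecker u) \<noteq> 0 \<and> h y = P (pluecker u) / Q (pluecker u)"
      by (rule regular_subvariety5E[OF h x])
    have "k y = P (pluecker u) / Q (pluecker u)" if "y \<in> N" "u \<in> frames5 y" for y u
      using bspec[OF bspec[OF N(6) that(1)] that(2)] eq[of y] N(3) that(1) by auto
    then show "\<exists>N d P Q. openin (zariski ?M) N \<and> x \<in> N \<and> N \<subseteq> W \<and> homogeneous d P \<and> homogeneous d Q \<and>
       (\<forall>y\<in>N. \<forall>u\<in>frames5 y. Q (pluecker u) \<noteq> 0 \<and> k y = P (pluecker u) / Q (pluecker u))"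
      by (intro exI[of _ N] exI[of _ d] exI[of _ P] exI[of _ Q]) (use N in blast)
  qed
qed

lemma frames5_cbasis: "u \<in> frames5 U \<longleftrightarrow> cbasis UNIV u U"
  by (auto simp: frames5_def cbasis_def)

lemma frames5_nonempty:
  assumes "U \<in> grassmannian5" obtains u where "u \<in> frames5 U"
proof -
  have U: "csubspace U" "cdim U = 5" using assms by (auto simp: grassmannian5_def)
  obtain C where C: "C \<subseteq> U" "cindependent C" "U \<subseteq> cspan C" "card C = cdim U"
    by (rule complex_vector.basis_exists)
  have "finite C" using C(4) U(2) card_ge_0_finite[of C] by auto
  then obtain u where u: "bij_betw u (UNIV :: 5 set) C"
    using finite_same_card_bij[of "UNIV :: 5 set" C] C(4) U(2) by auto
  have "cspan C = U" using C(1,3) complex_vector.span_minimal[OF C(1) U(1)] by blast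
  then have "u \<in> frames5 U" using u C(2) by (auto simp: frames5_def bij_betw_def)
  then show ?thesis using that by blast
qed

locale spinor_variety = spinor_sequence B c Sp Sm \<beta> \<eta> e0 f0 V4
  for B :: "'v::complex_vector \<Rightarrow> 'v \<Rightarrow> complex" and c :: "'v \<Rightarrow> 's::complex_vector \<Rightarrow> 's" and Sp Sm
    and \<beta> :: "'s \<Rightarrow> 's \<Rightarrow> complex" and \<eta> :: complex and e0 f0 :: "5 \<Rightarrow> 'v" and V4 :: "'s set" +
  fixes X :: "'v set set"
  assumes X: "X \<subseteq> OG5 B"
begin

abbreviation M :: "'v set variety"
  where "M \<equiv> subvariety5 X"

sublocale ringed_variety M
  by (rule ringed_subvariety5)

lemma topspace_M: "topspace (zariski M) = X"
  using X by (auto simp: subvariety5_def topspace_grassmannian5 OG5_def)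

text \<open>Expansion of \<open>v U\<close> in the constant basis \<open>g\<close> leaves constant
  operators \<open>c (g a)\<close> with regular coefficients.\<close>

lemma trivial_section_c:
  assumes W: "openin (zariski M) W" and v: "v \<in> sections (trivial_bundle M UNIV) W"
    and t: "t \<in> sections (trivial_bundle M UNIV) W"
  shows "(\<lambda>U. c (v U) (t U)) \<in> sections (trivial_bundle M UNIV) W"
proof (rule trivial_section_sum[OF W complex_vector.subspace_UNIV])
  show "(\<lambda>U. B (g a) (v U)) \<in> regular M W" for a
    using v cbilinear_right[OF bilinear_B] by (simp add: trivial_sections_iff)
  show "(\<lambda>U. c (g a) (t U)) \<in> sections (trivial_bundle M UNIV) W" for a
    by (rule trivial_section_clinear[OF t clinear_c]) simp
  show "c (v U) (t U) = (\<Sum>a\<in>UNIV. B (g a) (v U) *\<^sub>C c (g a) (t U))" for U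
  proof -
    have "c (\<Sum>a\<in>UNIV. B (g a) (v U) *\<^sub>C g a) (t U) = (\<Sum>a\<in>UNIV. B (g a) (v U) *\<^sub>C c (g a) (t U))"
      by (simp only: c_simps)
    then show ?thesis unfolding g_expand .
  qed
qed

end

subsection \<open>Charts\<close>

text \<open>The chart is centred at the span of \<open>e\<close>; \<open>f\<close> fixes the
  complementary subspace and \<open>\<omega>\<close> is its pure spinor.\<close>

locale spinor_chart = spinor_variety B c Sp Sm \<beta> \<eta> e0 f0 V4 X
  for B :: "'v::complex_vector \<Rightarrow> 'v \<Rightarrow> complex" and c :: "'v \<Rightarrow> 's::complex_vector \<Rightarrow> 's" and Sp Sm
    and \<beta> :: "'s \<Rightarrow> 's \<Rightarrow> complex" and \<eta> :: complex and e0 f0 :: "5 \<Rightarrow> 'v" and V4 :: "'s set"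
    and X :: "'v set set" +
  fixes e f :: "5 \<Rightarrow> 'v" and \<omega> :: 's
  assumes hyp: "hyperbolic e f" and center: "cspan (range e) \<in> X"
    and \<omega>: "\<omega> \<in> annihilator f UNIV" "\<omega> \<noteq> 0"
begin

text \<open>The coordinate along \<open>e i\<close>, vanishing on the span of \<open>f\<close>; the
  2 undoes the pairing 1/2.\<close>

definition coord :: "5 \<Rightarrow> 'v \<Rightarrow> complex"
  where "coord i v = 2 * B (f i) v"

text \<open>The members of \<open>X\<close> complementary to the span of \<open>f\<close>, written
  as a principal open set of one Pluecker coordinate.\<close>

definition N :: "'v set set"
  where "N = {U \<in> X \<inter> grassmannian5. \<forall>u\<in>frames5 U. pluecker u coord \<noteq> 0}"

definition A :: "(5 \<Rightarrow> 'v) \<Rightarrow> complex^5^5"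
  where "A u = (\<chi> i j. coord i (u j))"

lemma clinear_coord: "clinear (coord i)"
  unfolding coord_def[abs_def] by (rule clinear_mult_left[OF cbilinear_right[OF bilinear_B]])

lemma pluecker_coord: "pluecker u coord = det (A u)"
  by (simp add: pluecker_def clinear_coord A_def)

lemma coord_e: "coord i (e j) = (if i = j then 1 else 0)"
  by (simp add: coord_def hyperbolicD[OF hyp])

lemma N_open: "openin (zariski M) N"
  using openin_principal[OF homogeneous_linear[OF clinear_apply[of coord]], of X]
  by (simp add: N_def subvariety5_def)

lemma N_OG5: "U \<in> N \<Longrightarrow> U \<in> OG5 B"
  using X by (auto simp: N_def)

text \<open>Writing the \<open>e k\<close> in the frame \<open>u\<close> inverts the coordinate
  matrix of \<open>u\<close>.\<close>

lemma center_N: "cspan (range e) \<in> N"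
proof -
  let ?U = "cspan (range e)"
  have "pluecker u coord \<noteq> 0" if u: "u \<in> frames5 ?U" for u
  proof -
    have b: "cbasis UNIV u ?U" using u by (simp add: frames5_cbasis)
    let ?Y = "\<chi> j k. dual_family UNIV u j (e k)"
    have ce: "coord i (e k) = (\<Sum>j\<in>UNIV. coord i (u j) * dual_family UNIV u j (e k))" for i k
    proof -
      have "e k = (\<Sum>j\<in>UNIV. dual_family UNIV u j (e k) *\<^sub>C u j)"
        by (rule dual_family_expand[OF b]) (simp add: complex_vector.span_base)
      from arg_cong[OF this, of "coord i"] show ?thesis
        by (simp only: clinear_sum[OF clinear_coord] clinear_scale[OF clinear_coord] scaleC_complex mult.commute)
    qed
    have "(\<Sum>j\<in>UNIV. coord i (u j) * dual_family UNIV u j (e k)) = (if i = k then 1 else 0)" for i k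
      using ce[of i k] unfolding coord_e by (rule sym)
    then have AY: "A u ** ?Y = mat 1" by (simp add: vec_eq_iff matrix_matrix_mult_def A_def mat_def)
    have "det (A u) * det ?Y = 1" unfolding det_mul[symmetric] AY by (rule det_I)
    then show ?thesis by (auto simp: pluecker_coord)
  qed
  then show ?thesis using center X by (auto simp: N_def OG5_def)
qed

lemma coord_injective:
  assumes "U \<in> N" "v \<in> U" "\<And>i. coord i v = 0"
  shows "v = 0"
proof -
  obtain u where u: "u \<in> frames5 U" using frames5_nonempty assms(1) by (auto simp: N_def)
  then have b: "cbasis UNIV u U" by (simp add: frames5_cbasis)
  have "det (A u) \<noteq> 0" using assms(1) u by (auto simp: N_def pluecker_coord)
  then obtain A' where A': "A' ** A u = mat 1" using invertible_det_nz[of "A u"] by (auto simp: invertible_def)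
  let ?x = "\<chi> j. dual_family UNIV u j v"
  have ex: "v = (\<Sum>j\<in>UNIV. dual_family UNIV u j v *\<^sub>C u j)" by (rule dual_family_expand[OF b assms(2)])
  have "(\<Sum>j\<in>UNIV. coord i (u j) * dual_family UNIV u j v) = 0" for i
    using arg_cong[OF ex, of "coord i"] assms(3)[of i]
    by (simp add: clinear_sum[OF clinear_coord] clinear_scale[OF clinear_coord] mult.commute)
  then have "A u *v ?x = 0" by (simp add: vec_eq_iff matrix_vector_mult_def A_def)
  then have "A' *v (A u *v ?x) = 0" by simp
  then have "?x = 0" by (simp add: matrix_vector_mul_assoc A')
  then have "dual_family UNIV u j v = 0" for j by (simp add: vec_eq_iff)
  then show ?thesis using ex by simp
qed

text \<open>The frame of \<open>U\<close> whose coordinate matrix is the identity: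
  \<open>e i\<close> plus a vector of the span of \<open>f\<close>.\<close>

definition nf :: "5 \<Rightarrow> 'v set \<Rightarrow> 'v"
  where "nf i U = (SOME v. v \<in> U \<and> (\<forall>k. coord k v = (if k = i then 1 else 0)))"

lemma nf:
  assumes "U \<in> N" shows "nf i U \<in> U" "coord k (nf i U) = (if k = i then 1 else 0)"
proof -
  obtain u where u: "u \<in> frames5 U" using frames5_nonempty assms(1) by (auto simp: N_def)
  then have b: "cbasis UNIV u U" by (simp add: frames5_cbasis)
  have "det (A u) \<noteq> 0" using assms(1) u by (auto simp: N_def pluecker_coord)
  then obtain A' where A': "A u ** A' = mat 1" using invertible_det_nz[of "A u"] by (auto simp: invertible_def)
  have "\<exists>v. v \<in> U \<and> (\<forall>k. coord k v = (if k = i then 1 else 0))"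
  proof (intro exI conjI allI)
    show "(\<Sum>j\<in>UNIV. (A' $ j $ i) *\<^sub>C u j) \<in> U"
      using cbasisD(5,6)[OF b] by (intro complex_vector.subspace_sum complex_vector.subspace_scale) auto
    fix k
    have "coord k (\<Sum>j\<in>UNIV. (A' $ j $ i) *\<^sub>C u j) = (A u ** A') $ k $ i"
      by (simp add: clinear_sum[OF clinear_coord] clinear_scale[OF clinear_coord] matrix_matrix_mult_def A_def mult.commute)
    then show "coord k (\<Sum>j\<in>UNIV. (A' $ j $ i) *\<^sub>C u j) = (if k = i then 1 else 0)" by (simp add: A' mat_def)
  qed
  from someI_ex[OF this] show "nf i U \<in> U" "coord k (nf i U) = (if k = i then 1 else 0)" by (auto simp: nf_def)
qed

text \<open>Cramer's rule for the rows \<open>coord i\<close> of the matrix \<open>A u\<close>.\<close>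

lemma nf_pluecker:
  assumes U: "U \<in> N" and u: "u \<in> frames5 U" and l: "clinear l"
  shows "pluecker u (coord(i := l)) = l (nf i U) * pluecker u coord"
proof -
  have Us: "csubspace U" using U by (simp add: N_def grassmannian5_def)
  have uU: "u j \<in> U" for j using u by (auto simp: frames5_def complex_vector.span_base)
  have "u j = (\<Sum>k\<in>UNIV. coord k (u j) *\<^sub>C nf k U)" for j
  proof -
    have "u j - (\<Sum>k\<in>UNIV. coord k (u j) *\<^sub>C nf k U) = 0"
    proof (rule coord_injective[OF U])
      show "u j - (\<Sum>k\<in>UNIV. coord k (u j) *\<^sub>C nf k U) \<in> U"
        by (intro complex_vector.subspace_diff complex_vector.subspace_sum complex_vector.subspace_scale Us uU nf(1)[OF U])
      fix i
      have "coord i (\<Sum>k\<in>UNIV. coord k (u j) *\<^sub>C nf k U) = (\<Sum>k\<in>UNIV. if i = k then coord k (u j) else 0)"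
        unfolding clinear_sum[OF clinear_coord] clinear_scale[OF clinear_coord]
        by (rule sum.cong) (auto simp: nf(2)[OF U])
      then show "coord i (u j - (\<Sum>k\<in>UNIV. coord k (u j) *\<^sub>C nf k U)) = 0"
        by (simp add: clinear_diff[OF clinear_coord])
    qed
    then show ?thesis by simp
  qed
  from arg_cong[OF this, of l] have l_u: "l (u j) = (\<Sum>k\<in>UNIV. l (nf k U) * coord k (u j))" for j
    by (simp only: clinear_sum[OF l] clinear_scale[OF l] scaleC_complex mult.commute)
  let ?x = "\<chi> k. l (nf k U)"
  have "pluecker u (coord(i := l)) = det (\<chi> k j. (coord(i := l)) k (u j))"
    using l clinear_coord by (simp add: pluecker_def)
  \<comment> \<open>The coefficients of \<open>u j\<close> in the frame \<open>nf\<close> are its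
    coordinates, so the new row \<open>l (u j)\<close> is a combination of all rows of
    \<open>A u\<close>.\<close>
  also have "(\<chi> k j. (coord(i := l)) k (u j)) =
      (\<chi> k. if k = i then (\<Sum>k\<in>UNIV. ?x $ k *s row k (A u)) else row k (A u))"
    by (simp add: vec_eq_iff row_def A_def l_u)
  also have "det \<dots> = ?x $ i * det (A u)" by (rule cramer_lemma_transpose)
  finally show ?thesis unfolding pluecker_coord vec_lambda_beta .
qed

lemma nf_section: "nf i \<in> sections (trivial_bundle M UNIV) N"
  unfolding trivial_sections_iff
proof (intro conjI ballI allI impI)
  fix l :: "'v \<Rightarrow> complex" assume l: "clinear l"
  have nz: "pluecker u coord \<noteq> 0" if "U \<in> N" "u \<in> frames5 U" for U u using that by (simp add: N_def)
  show "(\<lambda>U. l (nf i U)) \<in> regular M N"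
  proof (rule regular_subvariety5_quotient[OF N_open])
    show "homogeneous 1 (\<lambda>p. p (coord(i := l)))" "homogeneous 1 (\<lambda>p. p coord)"
      by (rule homogeneous_linear[OF clinear_apply])+
    show "pluecker u coord \<noteq> 0" if "U \<in> N" "u \<in> frames5 U" for U u by (rule nz[OF that])
    show "l (nf i U) = pluecker u (coord(i := l)) / pluecker u coord" if "U \<in> N" "u \<in> frames5 U" for U u
      using nz[OF that] nf_pluecker[OF that l] by simp
  qed
qed simp

text \<open>Normalised coordinates say precisely that the fixed \<open>f\<close> stays dual to the
  moving frame.\<close>

lemma nf_hyperbolic:
  assumes "U \<in> N" shows "hyperbolic (\<lambda>i. nf i U) f"
proof -
  have "B (nf i U) (f j) = (if i = j then 1 / 2 else 0)" for i j
  proof -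
    have "2 * B (nf i U) (f j) = (if j = i then 1 else 0)"
      using nf(2)[OF assms, of j i] by (simp only: coord_def B_commute[of "f j"])
    then show ?thesis by (auto simp: field_simps)
  qed
  moreover have "B (nf i U) (nf j U) = 0" for i j
    using nf(1)[OF assms] N_OG5[OF assms] by (auto simp: OG5_def)
  moreover have "B (f i) (f j) = 0" for i j by (rule hyperbolicD(2)[OF hyp])
  ultimately show ?thesis unfolding hyperbolic_def by blast
qed

lemma nf_span:
  assumes "U \<in> N" shows "cspan (range (\<lambda>i. nf i U)) = U"
proof
  have "csubspace U" using assms by (simp add: N_def grassmannian5_def)
  then show "cspan (range (\<lambda>i. nf i U)) \<subseteq> U" using nf(1)[OF assms] by (intro complex_vector.span_minimal) auto
  show "U \<subseteq> cspan (range (\<lambda>i. nf i U))"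
  proof
    fix v assume "v \<in> U"
    then have "B (nf i U) v = 0" for i using nf(1)[OF assms] N_OG5[OF assms] by (auto simp: OG5_def)
    then show "v \<in> cspan (range (\<lambda>i. nf i U))" by (rule hyperbolic_perp[OF nf_hyperbolic[OF assms]])
  qed
qed

lemma nf_cbasis: "U \<in> N \<Longrightarrow> cbasis UNIV (\<lambda>i. nf i U) U"
  using hyperbolic_cbasis[OF nf_hyperbolic] nf_span by metis

text \<open>Multiplying the fixed spinor \<open>\<omega>\<close> by all vectors of a frame gives a
  spinor killed by \<open>U\<close>, depending on \<open>U\<close> only through the regular frame
  \<open>nf\<close>.\<close>

definition sp :: "'v set \<Rightarrow> 's"
  where "sp U = word (\<lambda>i. nf i U) indices \<omega>"

lemma f_\<omega>: "c (f i) \<omega> = 0"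
  using \<omega>(1) by (simp add: annihilator_def)

text \<open>The inverse word is independent of \<open>U\<close>. It yields both the nonvanishing of
  \<open>sp\<close> and a constant linear form normalising it.\<close>

lemma sp_inverse: "U \<in> N \<Longrightarrow> word f (rev indices) (sp U) = \<omega>"
  unfolding sp_def by (rule word_inverse[OF nf_hyperbolic indices(1) f_\<omega>])

lemma sp_nonzero: "U \<in> N \<Longrightarrow> sp U \<noteq> 0"
  using sp_inverse \<omega>(2) clinear_0[OF clinear_word] by metis

lemma sp_pure: "U \<in> N \<Longrightarrow> sp U \<in> pure_spinors c U"
proof -
  assume U: "U \<in> N"
  have "sp U \<in> annihilator (\<lambda>i. nf i U) UNIV"
    unfolding sp_def annihilator_def using word_kill(1)[OF nf_hyperbolic[OF U]] indices(2) by blast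
  then show ?thesis using pure_spinors_annihilator[of "\<lambda>i. nf i U"] nf_span[OF U] by simp
qed

lemma sp_section: "sp \<in> sections (trivial_bundle M UNIV) N"
proof -
  have "(\<lambda>U. word (\<lambda>i. nf i U) xs \<omega>) \<in> sections (trivial_bundle M UNIV) N" for xs
  proof (induction xs)
    case Nil
    show ?case using trivial_section_const[OF N_open UNIV_I[of \<omega>]] by simp
  next
    case (Cons x xs)
    then show ?case using trivial_section_c[OF N_open nf_section Cons] by simp
  qed
  then show ?thesis by (simp add: sp_def[abs_def])
qed

text \<open>\<open>sp U\<close> is five factors away from the fixed \<open>\<omega>\<close>, so its
  half is the same throughout the chart and the case distinction in \<open>\<kappa>\<close> is
  uniform there.\<close>

lemma \<kappa>_constant: "\<exists>\<kappa>0. clinear \<kappa>0 \<and> (\<forall>U\<in>N. \<kappa> U = \<kappa>0)"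
proof -
  obtain P Q where PQ: "half_spins P Q" "\<omega> \<in> P"
    using annihilator_parity[OF hyperbolic_swap[OF hyp]] \<omega>(1) unfolding half_spins_def by blast
  have sp: "sp U \<in> Q" for U
    using word_parity[OF PQ, of "\<lambda>i. nf i U" indices] by (simp add: sp_def indices(3))
  have line: "pure_spinors c U \<subseteq> V4 \<longleftrightarrow> V4 = Q" if U: "U \<in> N" for U
  proof
    assume "pure_spinors c U \<subseteq> V4"
    then have "sp U \<in> V4" using sp_pure[OF U] by blast
    then have "V4 \<noteq> P" using sp[of U] sp_nonzero[OF U] half_spinsD(3)[OF PQ(1)] by blast
    then show "V4 = Q" using V4 PQ(1) by (auto simp: half_spins_def)
  next
    assume V: "V4 = Q"
    show "pure_spinors c U \<subseteq> V4"
    proof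
      fix t assume "t \<in> pure_spinors c U"
      then obtain z where "t = z *\<^sub>C sp U"
        using dual_family_expand[OF pure_line[OF N_OG5[OF U] sp_pure[OF U] sp_nonzero[OF U]]] by (auto simp: UNIV_unit)
      then show "t \<in> V4" using V sp[of U] half_spinsD(2)[OF PQ(1)] complex_vector.subspace_scale by blast
    qed
  qed
  show ?thesis
  proof (cases "V4 = Q")
    case True
    have "\<kappa> U = c v0" if "U \<in> N" for U using line[OF that] True unfolding \<kappa>_def by (intro ext) simp
    then show ?thesis using clinear_c by blast
  next
    case False
    have "\<kappa> U = (\<lambda>t. t)" if "U \<in> N" for U using line[OF that] False unfolding \<kappa>_def by (intro ext) simp
    then show ?thesis using clinear_id by blast
  qed
qed

end

section \<open>The five bundles, their fibres and their sheaf conditions\<close>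

context spinor_variety
begin

abbreviation E1 :: "('v set, 'v \<Rightarrow> complex) vbundle"
  where "E1 \<equiv> dual_bundle M (tautological X)"

abbreviation E2 :: "('v set, ('s, 's \<Rightarrow> complex) tensor) vbundle"
  where "E2 \<equiv> tensor_bundle M (trivial_bundle M V4) (O_1 c X)"

abbreviation E3 :: "('v set, ('v, ('v, ('s \<Rightarrow> complex, 's \<Rightarrow> complex) tensor) tensor) tensor) vbundle"
  where "E3 \<equiv> tensor_bundle M (trivial_bundle M UNIV) (tensor_bundle M (tautological X) (O_2 c X))"

abbreviation E4 :: "('v set, (('v, 'v) tensor, ('s \<Rightarrow> complex, 's \<Rightarrow> complex) tensor) tensor) vbundle"
  where "E4 \<equiv> tensor_bundle M (trivial_bundle M (V_2omega1 B)) (O_2 c X)"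

abbreviation E5 :: "('v set, (('v \<Rightarrow> complex, 'v \<Rightarrow> complex) tensor, ('s \<Rightarrow> complex, 's \<Rightarrow> complex) tensor) tensor) vbundle"
  where "E5 \<equiv> tensor_bundle M (sym2_bundle M E1) (O_2 c X)"

lemma fibre_taut: "fibre (tautological X) U = U"
  by (simp add: tautological_def sub_bundle_def)

lemma fibre_E1: "fibre E1 U = dual_space U"
  by (simp add: dual_bundle_def fibre_taut)

lemma fibre_O1: "fibre (O_1 c X) U = dual_space (pure_spinors c U)"
  by (simp add: O_1_def dual_bundle_def O_minus1_def sub_bundle_def)

lemma fibre_O2: "fibre (O_2 c X) U = O2 U"
  by (simp add: O_2_def tensor_bundle_def fibre_O1 O2_def)

lemma fibre_E2: "fibre E2 U = F2 U"
  by (simp add: tensor_bundle_def fibre_O1 F2_def trivial_bundle_def)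

lemma fibre_E3: "fibre E3 U = F3 U"
  using fibre_O2 by (simp add: tensor_bundle_def fibre_taut F3_def trivial_bundle_def)

lemma fibre_E4: "fibre E4 U = F4 U"
  using fibre_O2 by (simp add: tensor_bundle_def F4_def trivial_bundle_def)

lemma fibre_E5: "fibre E5 U = F5 U"
  using fibre_O2 fibre_E1 by (simp add: tensor_bundle_def sym2_bundle_def sub_bundle_def F5_def)

lemma sheaf_taut: "bundle_sheaf M (tautological X)"
  unfolding tautological_def by (rule bundle_sheaf_sub[OF bundle_sheaf_trivial])

lemma sheaf_O1: "bundle_sheaf M (O_1 c X)"
  unfolding O_1_def O_minus1_def by (rule bundle_sheaf_dual[OF bundle_sheaf_sub[OF bundle_sheaf_trivial]])

lemma sheaf_O2: "bundle_sheaf M (O_2 c X)"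
  unfolding O_2_def by (rule bundle_sheaf_tensor[OF sheaf_O1 sheaf_O1])

lemma sheaf_sym2: "bundle_sheaf M (sym2_bundle M E1)"
  unfolding sym2_bundle_def
  by (rule bundle_sheaf_sub[OF bundle_sheaf_tensor[OF bundle_sheaf_dual[OF sheaf_taut] bundle_sheaf_dual[OF sheaf_taut]]])

lemma V4_basis: obtains n :: nat and b where "cbasis {..<n} b V4"
proof -
  obtain C :: "'s set" where C: "finite C" "cindependent C" "cspan C = UNIV" "card C = 32"
    by (rule spinor_finite_basis)
  then show ?thesis using csubspace_has_cbasis[OF V4_subspace, of C] that by blast
qed

lemma V_2omega1_basis: obtains n :: nat and b where "cbasis {..<n} b (V_2omega1 B)"
proof -
  let ?T = "(\<lambda>(a, b). tens (g a) (g b)) ` (UNIV \<times> UNIV)"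
  have "V_2omega1 B \<subseteq> tensor_space UNIV UNIV"
    using sym2_space_le_tensor_space by (auto simp: V_2omega1_def)
  also have "\<dots> = cspan ?T" using cbasisD(4)[OF cbasis_tens[OF cbasis_g cbasis_g]] by simp
  finally have "V_2omega1 B \<subseteq> cspan ?T" .
  moreover have "finite ?T" by simp
  ultimately show ?thesis using csubspace_has_cbasis[OF V_2omega1_subspace, of ?T] that by blast
qed

end

section \<open>Frames over a chart and regularity of the four maps\<close>

context spinor_chart
begin

lemma frame_taut: "local_frame M (tautological X) N UNIV nf"
  unfolding tautological_def
  by (rule local_frame_sub_trivial[OF N_open nf_cbasis finite nf_section clinear_coord]) (auto simp: nf(2))

lemma frame_O_minus1: "local_frame M (O_minus1 c X) N UNIV (\<lambda>_::unit. sp)"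
proof -
  obtain l where l: "clinear l" "l \<omega> = (1::complex)" using linear_functional_nonzero[OF \<omega>(2)] .
  show ?thesis
    unfolding O_minus1_def
  proof (rule local_frame_sub_trivial[OF N_open _ finite sp_section])
    show "cbasis UNIV (\<lambda>i::unit. sp U) (pure_spinors c U)" if "U \<in> N" for U
      by (rule pure_line[OF N_OG5 sp_pure sp_nonzero]) (fact that)+
    show "clinear (\<lambda>t. l (word f (rev indices) t))" by (rule clinear_compose[OF clinear_word l(1)])
    show "l (word f (rev indices) (sp U)) = (if i = j then 1 else 0)" if "U \<in> N" for i j :: unit and U
      using sp_inverse[OF that] l(2) by simp
  qed
qed

lemma frame_O1: "local_frame M (O_1 c X) N UNIV (\<lambda>(_::unit) U. spinor_dual (sp U))"
proof -
  have "(\<lambda>(i::unit) U. dual_family UNIV (\<lambda>i. sp U) i) = (\<lambda>_ U. spinor_dual (sp U))"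
    by (simp add: spinor_dual_def fun_eq_iff)
  then show ?thesis using local_frame_dual[OF frame_O_minus1] by (simp add: O_1_def)
qed

lemma section_O1: "(\<lambda>U. spinor_dual (sp U)) \<in> sections (O_1 c X) N"
  using local_frame_section[OF frame_O1 N_open subset_refl UNIV_I] .

lemma frame_O2: "local_frame M (O_2 c X) N (UNIV \<times> UNIV) (\<lambda>(i::unit, j::unit) U. qline (sp U))"
  using local_frame_tensor[OF frame_O1 frame_O1] by (simp add: O_2_def qline_def)

lemma section_O2: "(\<lambda>U. qline (sp U)) \<in> sections (O_2 c X) N"
  unfolding O_2_def qline_def by (rule tensor_section_tens[OF N_open section_O1 section_O1])

lemma at_N:
  assumes "U \<in> N" shows "U \<in> OG5 B" "sp U \<in> pure_spinors c U" "sp U \<noteq> 0"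
  using N_OG5 sp_pure sp_nonzero assms by auto

text \<open>Sections of the tautological bundle never meet the extension by zero, and pairing with
  the constant vector \<open>v\<close> is a constant linear form.\<close>

lemma section_E1: "(\<lambda>U. res U v) \<in> sections E1 N"
proof -
  have "res U v \<in> dual_space U" if "U \<in> N" for U
    by (rule res_in_dual) (use at_N(1)[OF that] in \<open>simp add: OG5_def grassmannian5_def\<close>)
  moreover have "(\<lambda>U. res U v (s U)) \<in> regular M W" if W: "openin (zariski M) W" "s \<in> sections (tautological X) W" for W s
  proof -
    have s: "s \<in> sections (trivial_bundle M UNIV) W" "\<And>U. U \<in> W \<Longrightarrow> s U \<in> U"
      using W(2) by (auto simp: tautological_def sub_bundle_def)
    have "(\<lambda>U. B v (s U)) \<in> regular M W"
      using s(1) cbilinear_right[OF bilinear_B] by (simp add: trivial_sections_iff)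
    then show ?thesis by (rule regular_cong[OF W(1)]) (simp add: res_def s(2))
  qed
  ultimately show ?thesis by (auto simp: dual_bundle_def fibre_taut)
qed

text \<open>Since \<open>coord i\<close> is pairing with \<open>2 *\<^sub>C f i\<close>, the dual
  frame consists of restrictions of constant vectors, to which \<open>\<phi>1_eq\<close>
  applies.\<close>

lemma frame_E1_eq: "U \<in> N \<Longrightarrow> dual_family UNIV (\<lambda>i. nf i U) i = res U (2 *\<^sub>C f i)"
proof -
  assume U: "U \<in> N"
  have Us: "csubspace U" using at_N(1)[OF U] by (simp add: OG5_def grassmannian5_def)
  show ?thesis
  proof (rule dual_space_eqI[OF nf_cbasis[OF U] dual_family_in_dual[OF nf_cbasis[OF U]] res_in_dual[OF Us]])
    fix j
    have "res U (2 *\<^sub>C f i) (nf j U) = coord i (nf j U)"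
      using nf(1)[OF U] by (simp add: res_def coord_def B_simps)
    then show "dual_family UNIV (\<lambda>i. nf i U) i (nf j U) = res U (2 *\<^sub>C f i) (nf j U)"
      using dual_family_basis[OF nf_cbasis[OF U], of i j] nf(2)[OF U] by simp
  qed
qed

lemma \<phi>1_section: "(\<lambda>U. \<phi>1 U (dual_family UNIV (\<lambda>i. nf i U) i)) \<in> sections E2 N"
proof -
  obtain \<kappa>0 where \<kappa>0: "clinear \<kappa>0" "\<And>U. U \<in> N \<Longrightarrow> \<kappa> U = \<kappa>0" using \<kappa>_constant by blast
  show ?thesis
  proof (rule tensor_sectionI[OF N_open, of "{()}"])
    show "(\<lambda>U. \<kappa>0 (c (2 *\<^sub>C f i) (sp U))) \<in> sections (trivial_bundle M V4) N"
    proof (rule trivial_section_clinear[OF sp_section clinear_compose[OF clinear_c \<kappa>0(1)]])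
      show "\<kappa>0 (c (2 *\<^sub>C f i) (sp U)) \<in> V4" if "U \<in> N" for U
        using \<kappa>_c[OF at_N[OF that]] \<kappa>0(2)[OF that] by simp
    qed
    show "(\<lambda>U. spinor_dual (sp U)) \<in> sections (O_1 c X) N" by (rule section_O1)
    show "\<phi>1 U (dual_family UNIV (\<lambda>i. nf i U) i) =
        (\<Sum>k\<in>{()}. tens (\<kappa>0 (c (2 *\<^sub>C f i) (sp U))) (spinor_dual (sp U)))" if U: "U \<in> N" for U
      unfolding frame_E1_eq[OF U] \<phi>1_eq[OF at_N[OF U]] \<kappa>0(2)[OF U] by simp
  qed simp
qed

text \<open>For fixed \<open>\<sigma>\<close> each slot of \<open>quad\<close> depends on the spinor
  through one constant linear map, and \<open>sp\<close> is regular.\<close>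

lemma \<phi>2_section:
  assumes "\<sigma> \<in> V4"
  shows "(\<lambda>U. \<phi>2 U (tens \<sigma> (spinor_dual (sp U)))) \<in> sections E3 N"
proof -
  obtain \<kappa>0 where \<kappa>0: "clinear \<kappa>0" "\<And>U. U \<in> N \<Longrightarrow> \<kappa> U = \<kappa>0" using \<kappa>_constant by blast
  show ?thesis
  proof (rule tensor_sectionI[OF N_open, of UNIV])
    show "(\<lambda>_. g a) \<in> sections (trivial_bundle M UNIV) N" for a
      by (rule trivial_section_const[OF N_open UNIV_I])
    have "clinear (\<lambda>s. quad s (\<kappa>0 \<sigma>) a)" for a
      unfolding quad_def
      by (intro clinear_sum_fun clinear_scaleC_const clinear_compose[OF clinear_c cbilinear_left[OF bil]])
    from trivial_section_clinear[OF sp_section this UNIV_I]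
    have "(\<lambda>U. quad (sp U) (\<kappa>0 \<sigma>) a) \<in> sections (trivial_bundle M UNIV) N" for a .
    then have "(\<lambda>U. quad (sp U) (\<kappa>0 \<sigma>) a) \<in> sections (tautological X) N" for a
      using quad_in_U[OF at_N] by (simp add: tautological_def sub_bundle_def)
    then show "(\<lambda>U. tens (quad (sp U) (\<kappa>0 \<sigma>) a) (qline (sp U))) \<in> sections (tensor_bundle M (tautological X) (O_2 c X)) N" for a
      by (rule tensor_section_tens[OF N_open _ section_O2])
    show "\<phi>2 U (tens \<sigma> (spinor_dual (sp U))) = (\<Sum>a\<in>UNIV. tens (g a) (tens (quad (sp U) (\<kappa>0 \<sigma>) a) (qline (sp U))))"
      if U: "U \<in> N" for U
      unfolding \<phi>2_eq[OF at_N[OF U] assms] \<kappa>0(2)[OF U] embed_def ..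
  qed simp
qed

lemma \<phi>3_section: "(\<lambda>U. \<phi>3 U (tens (g a) (tens (nf i U) (qline (sp U))))) \<in> sections E4 N"
proof (rule tensor_sectionI[OF N_open, of "{()}"])
  \<comment> \<open>A frame vector of the third bundle is the tuple whose only nonzero slot is
    \<open>a\<close>.\<close>
  let ?w = "\<lambda>v b. if b = a then v else 0"
  have "clinear ?w" by (auto simp: clinear_iff fun_eq_iff)
  then have "clinear (\<lambda>v. proj (?w v))" by (rule clinear_compose[OF _ clinear_proj])
  from trivial_section_clinear[OF nf_section this proj_in]
  show "(\<lambda>U. proj (?w (nf i U))) \<in> sections (trivial_bundle M (V_2omega1 B)) N" .
  show "(\<lambda>U. qline (sp U)) \<in> sections (O_2 c X) N" by (rule section_O2)
  show "\<phi>3 U (tens (g a) (tens (nf i U) (qline (sp U)))) = (\<Sum>k\<in>{()}. tens (proj (?w (nf i U))) (qline (sp U)))"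
    if U: "U \<in> N" for U
  proof -
    have "embed (?w (nf i U)) (qline (sp U)) =
        (\<Sum>b\<in>UNIV. if b = a then tens (g b) (tens (nf i U) (qline (sp U))) else 0)"
      unfolding embed_def by (rule sum.cong) (auto simp: tens_simps(9,10))
    then have "tens (g a) (tens (nf i U) (qline (sp U))) = embed (?w (nf i U)) (qline (sp U))" by simp
    moreover have "?w (nf i U) b \<in> U" for b
      using nf(1)[OF U] complex_vector.subspace_0[OF U_subspace[OF at_N[OF U]]] by simp
    ultimately show ?thesis using \<phi>3_eq[OF at_N[OF U], of "?w (nf i U)"] by simp
  qed
qed simp

text \<open>The tensor \<open>\<tau>\<close> is constant; only the restriction varies, and it is
  regular on each basis vector by \<open>section_E1\<close>.\<close>

lemma \<phi>4_section:
  assumes "\<tau> \<in> V_2omega1 B"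
  shows "(\<lambda>U. \<phi>4 U (tens \<tau> (qline (sp U)))) \<in> sections E5 N"
proof (rule tensor_sectionI[OF N_open, of "{()}"])
  have "\<tau> \<in> tensor_space UNIV UNIV" using assms sym2_space_le_tensor_space by (auto simp: V_2omega1_def)
  from dual_family_expand[OF cbasis_tens[OF cbasis_g cbasis_g] this]
  obtain x where x: "\<tau> = (\<Sum>q\<in>UNIV \<times> UNIV. x q *\<^sub>C (case q of (a, b) \<Rightarrow> tens (g a) (g b)))" by (rule that)
  have "(\<lambda>U. tensor_map (res U) (res U) \<tau>) \<in> sections (tensor_bundle M E1 E1) N"
  proof (rule tensor_sectionI[OF N_open, of "UNIV \<times> UNIV"])
    show "(\<lambda>U. res U (x q *\<^sub>C g (fst q))) \<in> sections E1 N" "(\<lambda>U. res U (g (snd q))) \<in> sections E1 N" for q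
      by (rule section_E1)+
    show "tensor_map (res U) (res U) \<tau> = (\<Sum>q\<in>UNIV \<times> UNIV. tens (res U (x q *\<^sub>C g (fst q))) (res U (g (snd q))))" for U
      unfolding x case_prod_beta
      by (simp only: clinear_sum[OF clinear_tensor_map] clinear_scale[OF clinear_tensor_map]
          tensor_map_tens[OF clinear_res clinear_res] clinear_scale[OF clinear_res] tens_simps(5))
  qed simp
  moreover have "tensor_map (res U) (res U) \<tau> \<in> sym2_space (fibre E1 U)" if "U \<in> N" for U
    using tensor_map_res_in[OF at_N[OF that] assms] by (simp add: fibre_E1)
  ultimately show "(\<lambda>U. tensor_map (res U) (res U) \<tau>) \<in> sections (sym2_bundle M E1) N"
    by (simp add: sym2_bundle_def sub_bundle_def)
  show "(\<lambda>U. qline (sp U)) \<in> sections (O_2 c X) N" by (rule section_O2)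
  show "\<phi>4 U (tens \<tau> (qline (sp U))) = (\<Sum>k\<in>{()}. tens (tensor_map (res U) (res U) \<tau>) (qline (sp U)))"
    if U: "U \<in> N" for U
    using \<phi>4_eq[OF at_N[OF U] assms] by simp
qed simp

end

section \<open>Local freeness, the morphisms and the assembled sequence\<close>

context spinor_variety
begin

text \<open>Every point is the centre of a chart of its own: an adapted hyperbolic pair supplies
  \<open>e\<close> and \<open>f\<close>, and the annihilator line of \<open>f\<close> supplies
  \<open>\<omega>\<close>.\<close>

lemma ex_chart:
  assumes "x \<in> topspace (zariski M)"
  obtains e f \<omega> where "spinor_chart B c Sp Sm \<beta> \<eta> e0 f0 V4 X e f \<omega>" "cspan (range e) = x"
proof -
  have x: "x \<in> X" using assms by (simp add: topspace_M)
  obtain e f where ef: "hyperbolic e f" "cspan (range e) = x" using OG5_hyperbolic x X by blast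
  obtain \<omega> where \<omega>: "\<omega> \<noteq> 0" "annihilator f UNIV = range (\<lambda>z. z *\<^sub>C \<omega>)"
    using annihilator_line[OF hyperbolic_swap[OF ef(1)]] .
  have "\<omega> \<in> annihilator f UNIV" unfolding \<omega>(2) by (rule range_eqI[of _ _ 1]) simp
  then have "spinor_chart B c Sp Sm \<beta> \<eta> e0 f0 V4 X e f \<omega>"
    using ef x \<omega>(1) by unfold_locales auto
  then show ?thesis using that ef(2) by blast
qed

lemma bundle_E1: "vector_bundle M E1"
proof (rule vector_bundleI[OF bundle_sheaf_dual[OF sheaf_taut]])
  fix x assume "x \<in> topspace (zariski M)"
  then obtain e f \<omega> where ch: "spinor_chart B c Sp Sm \<beta> \<eta> e0 f0 V4 X e f \<omega>" "cspan (range e) = x"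
    by (rule ex_chart)
  interpret spinor_chart B c Sp Sm \<beta> \<eta> e0 f0 V4 X e f \<omega> by (rule ch(1))
  show "\<exists>N (I :: 5 set) e. x \<in> N \<and> local_frame M E1 N I e"
    using center_N ch(2) local_frame_dual[OF frame_taut] by blast
qed

lemma bundle_E2: "vector_bundle M E2"
proof (rule vector_bundleI[OF bundle_sheaf_tensor[OF bundle_sheaf_trivial sheaf_O1]])
  fix x assume "x \<in> topspace (zariski M)"
  then obtain e f \<omega> where ch: "spinor_chart B c Sp Sm \<beta> \<eta> e0 f0 V4 X e f \<omega>" "cspan (range e) = x"
    by (rule ex_chart)
  interpret spinor_chart B c Sp Sm \<beta> \<eta> e0 f0 V4 X e f \<omega> by (rule ch(1))
  obtain n :: nat and b where b: "cbasis {..<n} b V4" by (rule V4_basis)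
  show "\<exists>N (I :: (nat \<times> unit) set) e. x \<in> N \<and> local_frame M E2 N I e"
    using center_N ch(2) local_frame_tensor[OF local_frame_trivial[OF b N_open] frame_O1] by blast
qed

lemma bundle_E3: "vector_bundle M E3"
proof (rule vector_bundleI[OF bundle_sheaf_tensor[OF bundle_sheaf_trivial bundle_sheaf_tensor[OF sheaf_taut sheaf_O2]]])
  fix x assume "x \<in> topspace (zariski M)"
  then obtain e f \<omega> where ch: "spinor_chart B c Sp Sm \<beta> \<eta> e0 f0 V4 X e f \<omega>" "cspan (range e) = x"
    by (rule ex_chart)
  interpret spinor_chart B c Sp Sm \<beta> \<eta> e0 f0 V4 X e f \<omega> by (rule ch(1))
  show "\<exists>N (I :: ((bool \<times> 5) \<times> 5 \<times> unit \<times> unit) set) e. x \<in> N \<and> local_frame M E3 N I e"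
    using center_N ch(2)
      local_frame_tensor[OF local_frame_trivial[OF cbasis_g N_open] local_frame_tensor[OF frame_taut frame_O2]] by blast
qed

lemma bundle_E4: "vector_bundle M E4"
proof (rule vector_bundleI[OF bundle_sheaf_tensor[OF bundle_sheaf_trivial sheaf_O2]])
  fix x assume "x \<in> topspace (zariski M)"
  then obtain e f \<omega> where ch: "spinor_chart B c Sp Sm \<beta> \<eta> e0 f0 V4 X e f \<omega>" "cspan (range e) = x"
    by (rule ex_chart)
  interpret spinor_chart B c Sp Sm \<beta> \<eta> e0 f0 V4 X e f \<omega> by (rule ch(1))
  obtain n :: nat and b where b: "cbasis {..<n} b (V_2omega1 B)" by (rule V_2omega1_basis)
  show "\<exists>N (I :: (nat \<times> unit \<times> unit) set) e. x \<in> N \<and> local_frame M E4 N I e"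
    using center_N ch(2) local_frame_tensor[OF local_frame_trivial[OF b N_open] frame_O2] by blast
qed

lemma bundle_E5: "vector_bundle M E5"
proof (rule vector_bundleI[OF bundle_sheaf_tensor[OF sheaf_sym2 sheaf_O2]])
  fix x assume "x \<in> topspace (zariski M)"
  then obtain e f \<omega> where ch: "spinor_chart B c Sp Sm \<beta> \<eta> e0 f0 V4 X e f \<omega>" "cspan (range e) = x"
    by (rule ex_chart)
  interpret spinor_chart B c Sp Sm \<beta> \<eta> e0 f0 V4 X e f \<omega> by (rule ch(1))
  show "\<exists>N (I :: ((5 \<times> 5) \<times> unit \<times> unit) set) e. x \<in> N \<and> local_frame M E5 N I e"
    using center_N ch(2)
      local_frame_tensor[OF local_frame_sym2[OF local_frame_dual[OF frame_taut]] frame_O2] by blast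
qed

lemma at_X:
  assumes "x \<in> topspace (zariski M)"
  shows "x \<in> OG5 B" "point_spinor x \<in> pure_spinors c x" "point_spinor x \<noteq> 0"
  using assms X point_spinor by (auto simp: topspace_M)

lemma morphism1: "bundle_morphism M E1 E2 \<phi>1"
proof (rule bundle_morphismI[OF bundle_E1 bundle_E2])
  fix x assume x: "x \<in> topspace (zariski M)"
  show "clinear_on (fibre E1 x) (\<phi>1 x)" unfolding fibre_E1 by (rule \<phi>1_linear[OF at_X[OF x]])
  show "\<phi>1 x v \<in> fibre E2 x" if "v \<in> fibre E1 x" for v
    using \<phi>1_into[OF at_X[OF x]] that unfolding fibre_E1 fibre_E2 .
  obtain e f \<omega> where ch: "spinor_chart B c Sp Sm \<beta> \<eta> e0 f0 V4 X e f \<omega>" "cspan (range e) = x"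
    by (rule ex_chart[OF x])
  interpret spinor_chart B c Sp Sm \<beta> \<eta> e0 f0 V4 X e f \<omega> by (rule ch(1))
  show "\<exists>N (I :: 5 set) e. x \<in> N \<and> local_frame M E1 N I e \<and> (\<forall>i\<in>I. (\<lambda>y. \<phi>1 y (e i y)) \<in> sections E2 N)"
  proof (intro exI conjI ballI)
    show "x \<in> N" using center_N ch(2) by simp
    show "local_frame M E1 N UNIV (\<lambda>i U. dual_family UNIV (\<lambda>i. nf i U) i)" by (rule local_frame_dual[OF frame_taut])
    show "(\<lambda>U. \<phi>1 U (dual_family UNIV (\<lambda>i. nf i U) i)) \<in> sections E2 N" for i by (rule \<phi>1_section)
  qed
qed

lemma morphism2: "bundle_morphism M E2 E3 \<phi>2"
proof (rule bundle_morphismI[OF bundle_E2 bundle_E3])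
  fix x assume x: "x \<in> topspace (zariski M)"
  show "clinear_on (fibre E2 x) (\<phi>2 x)" unfolding fibre_E2 by (rule \<phi>2_linear[OF at_X[OF x]])
  show "\<phi>2 x v \<in> fibre E3 x" if "v \<in> fibre E2 x" for v
    using \<phi>2_into[OF at_X[OF x]] that unfolding fibre_E2 fibre_E3 .
  obtain e f \<omega> where ch: "spinor_chart B c Sp Sm \<beta> \<eta> e0 f0 V4 X e f \<omega>" "cspan (range e) = x"
    by (rule ex_chart[OF x])
  interpret spinor_chart B c Sp Sm \<beta> \<eta> e0 f0 V4 X e f \<omega> by (rule ch(1))
  obtain n :: nat and b where b: "cbasis {..<n} b V4" by (rule V4_basis)
  show "\<exists>N (I :: (nat \<times> unit) set) e. x \<in> N \<and> local_frame M E2 N I e \<and> (\<forall>i\<in>I. (\<lambda>y. \<phi>2 y (e i y)) \<in> sections E3 N)"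
  proof (intro exI conjI ballI)
    show "x \<in> N" using center_N ch(2) by simp
    show "local_frame M E2 N ({..<n} \<times> UNIV) (\<lambda>(i, j :: unit) U. tens (b i) (spinor_dual (sp U)))"
      by (rule local_frame_tensor[OF local_frame_trivial[OF b N_open] frame_O1])
    show "(\<lambda>U. \<phi>2 U ((case p of (i, j) \<Rightarrow> \<lambda>U. tens (b i) (spinor_dual (sp U))) U)) \<in> sections E3 N"
      if "p \<in> {..<n} \<times> UNIV" for p :: "nat \<times> unit"
      using \<phi>2_section[OF cbasisD(6)[OF b], of "fst p"] that by (auto simp: case_prod_beta)
  qed
qed

lemma morphism3: "bundle_morphism M E3 E4 \<phi>3"
proof (rule bundle_morphismI[OF bundle_E3 bundle_E4])
  fix x assume x: "x \<in> topspace (zariski M)"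
  show "clinear_on (fibre E3 x) (\<phi>3 x)" unfolding fibre_E3 by (rule \<phi>3_linear[OF at_X[OF x]])
  show "\<phi>3 x v \<in> fibre E4 x" if "v \<in> fibre E3 x" for v
    using \<phi>3_into[OF at_X[OF x]] that unfolding fibre_E3 fibre_E4 .
  obtain e f \<omega> where ch: "spinor_chart B c Sp Sm \<beta> \<eta> e0 f0 V4 X e f \<omega>" "cspan (range e) = x"
    by (rule ex_chart[OF x])
  interpret spinor_chart B c Sp Sm \<beta> \<eta> e0 f0 V4 X e f \<omega> by (rule ch(1))
  let ?I = "UNIV \<times> (UNIV \<times> (UNIV \<times> UNIV)) :: ((bool \<times> 5) \<times> 5 \<times> unit \<times> unit) set"
  let ?q = "\<lambda>(i :: unit, j :: unit) U. qline (sp U)"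
  let ?u = "\<lambda>(i, j) U. tens (nf i U) (?q j U)"
  show "\<exists>N (I :: ((bool \<times> 5) \<times> 5 \<times> unit \<times> unit) set) e. x \<in> N \<and> local_frame M E3 N I e \<and>
      (\<forall>i\<in>I. (\<lambda>y. \<phi>3 y (e i y)) \<in> sections E4 N)"
  proof (intro exI conjI ballI)
    show "x \<in> N" using center_N ch(2) by simp
    show "local_frame M E3 N ?I (\<lambda>(a, j) U. tens (g a) (?u j U))"
      by (rule local_frame_tensor[OF local_frame_trivial[OF cbasis_g N_open] local_frame_tensor[OF frame_taut frame_O2]])
    show "(\<lambda>U. \<phi>3 U ((case p of (a, j) \<Rightarrow> \<lambda>U. tens (g a) (?u j U)) U)) \<in> sections E4 N" for p
      using \<phi>3_section[of "fst p" "fst (snd p)"] by (simp add: case_prod_beta)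
  qed
qed

lemma morphism4: "bundle_morphism M E4 E5 \<phi>4"
proof (rule bundle_morphismI[OF bundle_E4 bundle_E5])
  fix x assume x: "x \<in> topspace (zariski M)"
  show "clinear_on (fibre E4 x) (\<phi>4 x)" unfolding fibre_E4 by (rule \<phi>4_linear[OF at_X[OF x]])
  show "\<phi>4 x v \<in> fibre E5 x" if "v \<in> fibre E4 x" for v
    using \<phi>4_into[OF at_X[OF x]] that unfolding fibre_E4 fibre_E5 .
  obtain e f \<omega> where ch: "spinor_chart B c Sp Sm \<beta> \<eta> e0 f0 V4 X e f \<omega>" "cspan (range e) = x"
    by (rule ex_chart[OF x])
  interpret spinor_chart B c Sp Sm \<beta> \<eta> e0 f0 V4 X e f \<omega> by (rule ch(1))
  obtain n :: nat and b where b: "cbasis {..<n} b (V_2omega1 B)" by (rule V_2omega1_basis)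
  let ?q = "\<lambda>(i :: unit, j :: unit) U. qline (sp U)"
  show "\<exists>N (I :: (nat \<times> unit \<times> unit) set) e. x \<in> N \<and> local_frame M E4 N I e \<and>
      (\<forall>i\<in>I. (\<lambda>y. \<phi>4 y (e i y)) \<in> sections E5 N)"
  proof (intro exI conjI ballI)
    show "x \<in> N" using center_N ch(2) by simp
    show "local_frame M E4 N ({..<n} \<times> (UNIV \<times> UNIV)) (\<lambda>(i, j) U. tens (b i) (?q j U))"
      by (rule local_frame_tensor[OF local_frame_trivial[OF b N_open] frame_O2])
    show "(\<lambda>U. \<phi>4 U ((case p of (i, j) \<Rightarrow> \<lambda>U. tens (b i) (?q j U)) U)) \<in> sections E5 N"
      if "p \<in> {..<n} \<times> (UNIV \<times> UNIV)" for p :: "nat \<times> unit \<times> unit"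
      using \<phi>4_section[OF cbasisD(6)[OF b], of "fst p"] that by (auto simp: case_prod_beta)
  qed
qed

lemma exact_sequence: "exact_sequence5 M E1 \<phi>1 E2 \<phi>2 E3 \<phi>3 E4 \<phi>4 E5"
  unfolding exact_sequence5_def exact_at_def fibre_E1 fibre_E2 fibre_E3 fibre_E4 fibre_E5
  by (intro conjI ballI bundle_E1 bundle_E2 bundle_E3 bundle_E4 bundle_E5 morphism1 morphism2 morphism3 morphism4
      \<phi>1_inj[OF at_X] exact2[OF at_X] exact3[OF at_X] exact4[OF at_X] surjective4[OF at_X])

end

section \<open>The exact sequence on the spinor tenfold\<close>

theorem lemma2p5:
  fixes B :: "'v::complex_vector \<Rightarrow> 'v \<Rightarrow> complex"
    and c :: "'v \<Rightarrow> 's::complex_vector \<Rightarrow> 's"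
    and Sp Sm V_omega4 :: "'s set"
    and X :: "'v set set"
  assumes "cdim (UNIV :: 'v set) = 10"
    and "nondegenerate_symmetric B"
    and "spinor_tenfold B X"
    and "spin_module B c Sp Sm"
    and "V_omega4 \<in> {Sp, Sm}"
  shows "let M = subvariety5 X in
    \<exists>\<phi>1 \<phi>2 \<phi>3 \<phi>4. exact_sequence5 M
    (dual_bundle M (tautological X))
      \<phi>1
    (tensor_bundle M (trivial_bundle M V_omega4) (O_1 c X))
      \<phi>2
    (tensor_bundle M (trivial_bundle M (UNIV :: 'v set)) (tensor_bundle M (tautological X) (O_2 c X)))
      \<phi>3
    (tensor_bundle M (trivial_bundle M (V_2omega1 B)) (O_2 c X))
      \<phi>4
    (tensor_bundle M (sym2_bundle M (dual_bundle M (tautological X))) (O_2 c X))"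
proof -
  interpret spinor_module B c Sp Sm by unfold_locales (fact assms)+
  \<comment> \<open>A connected component is nonempty; a point of \<open>X\<close> supplies the
    hyperbolic pair behind the constant basis \<open>g\<close>.\<close>
  have X: "X \<subseteq> OG5 B" "X \<noteq> {}"
    using assms(3) connected_components_of_subset nonempty_connected_components_of
    unfolding spinor_tenfold_def topspace_subtopology by fastforce+
  then obtain e0 f0 where hyp0: "hyperbolic e0 f0" using OG5_hyperbolic by blast
  obtain \<beta> :: "'s \<Rightarrow> 's \<Rightarrow> complex" and \<eta> where \<beta>: "cbilinear \<beta>" "\<exists>x y. \<beta> x y \<noteq> 0" "\<eta> \<noteq> 0"
    "\<forall>v x y. \<beta> (c v x) y = \<eta> * \<beta> x (c v y)"
    by (rule invariant_form[OF hyp0])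
  interpret spinor_variety B c Sp Sm \<beta> \<eta> e0 f0 V_omega4 X
    by unfold_locales (fact \<beta>(1-3) \<beta>(4)[rule_format] hyp0 assms X)+
  show ?thesis unfolding Let_def using exact_sequence by blast
qed

end
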